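(* (1) Let $A$ be an operator algebra. If $A^{**}$ is semiprime then $A$ is semiprime; if $A^{**}$ is radical then $A$ is radical; if $A^{**}$ is semisimple and commutative then $A$ is semisimple. (2) There exists a semiprime operator algebra $A$ such that $A^{**}$ is not semiprime; there exists an approximately unital radical operator algebra $A$ such that $A^{**}$ is not radical; and there exists a unital semisimple operator algebra $A$ such that $A^{**}$ is not semiprime (and hence not semisimple).
   Context: An operator algebra is a norm closed algebra of operators on a complex Hilbert space; $A^{**}$ is an operator algebra with its (unique) Arens product. Approximately unital means having a contractive approximate identity. $J(A)$ denotes the Jacobson radical; $A$ is semisimple if $J(A) = (0)$ and radical if $J(A) = A$. $A$ is semiprime if $(0)$ is the only closed two-sided ideal with square $(0)$. *)

theory Defs
  imports "HOL-Analysis.Analysis"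
begin

section \<open>Complex spaces with an explicit carrier\<close>

record 'a cvec =
  carr :: "'a set"
  vadd :: "'a \<Rightarrow> 'a \<Rightarrow> 'a"
  vzero :: "'a"
  vscale :: "complex \<Rightarrow> 'a \<Rightarrow> 'a"

record 'a cinner_space = "'a cvec" +
  cinner :: "'a \<Rightarrow> 'a \<Rightarrow> complex"

record 'a cnormed = "'a cvec" +
  nrm :: "'a \<Rightarrow> real"

record 'a cnalg = "'a cnormed" +
  amult :: "'a \<Rightarrow> 'a \<Rightarrow> 'a"

definition complex_vector_space :: "('a, 'm) cvec_scheme \<Rightarrow> bool" where
  "complex_vector_space V \<longleftrightarrow>
     vzero V \<in> carr V \<and>
     (\<forall>x\<in>carr V. \<forall>y\<in>carr V. vadd V x y \<in> carr V) \<and>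
     (\<forall>c. \<forall>x\<in>carr V. vscale V c x \<in> carr V) \<and>
     (\<forall>x\<in>carr V. \<forall>y\<in>carr V. \<forall>z\<in>carr V. vadd V (vadd V x y) z = vadd V x (vadd V y z)) \<and>
     (\<forall>x\<in>carr V. \<forall>y\<in>carr V. vadd V x y = vadd V y x) \<and>
     (\<forall>x\<in>carr V. vadd V (vzero V) x = x) \<and>
     (\<forall>x\<in>carr V. \<exists>y\<in>carr V. vadd V x y = vzero V) \<and>
     (\<forall>c. \<forall>x\<in>carr V. \<forall>y\<in>carr V. vscale V c (vadd V x y) = vadd V (vscale V c x) (vscale V c y)) \<and>
     (\<forall>c d. \<forall>x\<in>carr V. vscale V (c + d) x = vadd V (vscale V c x) (vscale V d x)) \<and>
     (\<forall>c d. \<forall>x\<in>carr V. vscale V (c * d) x = vscale V c (vscale V d x)) \<and>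
     (\<forall>x\<in>carr V. vscale V 1 x = x)"

definition vsub :: "('a, 'm) cvec_scheme \<Rightarrow> 'a \<Rightarrow> 'a \<Rightarrow> 'a" where
  "vsub V x y = vadd V x (vscale V (- 1) y)"

definition subspace_of :: "('a, 'm) cvec_scheme \<Rightarrow> 'a set \<Rightarrow> bool" where
  "subspace_of V S \<longleftrightarrow> S \<subseteq> carr V \<and> vzero V \<in> S \<and>
     (\<forall>x\<in>S. \<forall>y\<in>S. vadd V x y \<in> S) \<and> (\<forall>c. \<forall>x\<in>S. vscale V c x \<in> S)"

text \<open>The locale \<^locale>\<open>Metric_space\<close> asks for symmetry and nonnegativity of the distance also
  off the carrier, hence the value \<open>0\<close> there.\<close>

definition norm_dist :: "('a, 'm) cvec_scheme \<Rightarrow> ('a \<Rightarrow> real) \<Rightarrow> 'a \<Rightarrow> 'a \<Rightarrow> real" where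
  "norm_dist V n x y = (if x \<in> carr V \<and> y \<in> carr V then n (vsub V x y) else 0)"


section \<open>Hilbert spaces and operator algebras\<close>

definition hnorm :: "('h, 'm) cinner_space_scheme \<Rightarrow> 'h \<Rightarrow> real" where
  "hnorm H x = sqrt (Re (cinner H x x))"

definition complex_hilbert_space :: "('h, 'm) cinner_space_scheme \<Rightarrow> bool" where
  "complex_hilbert_space H \<longleftrightarrow>
     complex_vector_space H \<and>
     (\<forall>x\<in>carr H. \<forall>y\<in>carr H. \<forall>z\<in>carr H. cinner H (vadd H x y) z = cinner H x z + cinner H y z) \<and>
     (\<forall>c. \<forall>x\<in>carr H. \<forall>y\<in>carr H. cinner H (vscale H c x) y = c * cinner H x y) \<and>
     (\<forall>x\<in>carr H. \<forall>y\<in>carr H. cinner H y x = cnj (cinner H x y)) \<and>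
     (\<forall>x\<in>carr H. 0 \<le> Re (cinner H x x)) \<and>
     (\<forall>x\<in>carr H. cinner H x x = 0 \<longrightarrow> x = vzero H) \<and>
     Metric_space.mcomplete (carr H) (norm_dist H (hnorm H))"

text \<open>The algebra of all bounded linear operators on \<open>H\<close> with the operator norm. Operators are
  extensional functions, so that equality of operators is equality on \<open>H\<close>.\<close>

definition bounded_operators :: "('h, 'm) cinner_space_scheme \<Rightarrow> ('h \<Rightarrow> 'h) cnalg" where
  "bounded_operators H =
     \<lparr> carr = {T \<in> carr H \<rightarrow>\<^sub>E carr H.
          (\<forall>x\<in>carr H. \<forall>y\<in>carr H. T (vadd H x y) = vadd H (T x) (T y)) \<and>
          (\<forall>c. \<forall>x\<in>carr H. T (vscale H c x) = vscale H c (T x)) \<and>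
          (\<exists>K. \<forall>x\<in>carr H. hnorm H (T x) \<le> K * hnorm H x)},
       vadd = (\<lambda>S T. \<lambda>x\<in>carr H. vadd H (S x) (T x)),
       vzero = (\<lambda>x\<in>carr H. vzero H),
       vscale = (\<lambda>c T. \<lambda>x\<in>carr H. vscale H c (T x)),
       nrm = (\<lambda>T. Sup {hnorm H (T x) | x. x \<in> carr H \<and> hnorm H x \<le> 1}),
       amult = (\<lambda>S T. compose (carr H) S T) \<rparr>"

definition norm_closed :: "('a, 'm) cnormed_scheme \<Rightarrow> 'a set \<Rightarrow> bool" where
  "norm_closed A S \<longleftrightarrow> closedin (Metric_space.mtopology (carr A) (norm_dist A (nrm A))) S"

definition subalgebra_of :: "('a, 'm) cnalg_scheme \<Rightarrow> 'a set \<Rightarrow> bool" where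
  "subalgebra_of A S \<longleftrightarrow> subspace_of A S \<and> (\<forall>x\<in>S. \<forall>y\<in>S. amult A x y \<in> S)"

text \<open>For existence statements the type \<open>'h\<close> has to be fixed. As \<open>H\<close> is any Hilbert space whose
  vectors are elements of \<open>'h\<close>, this only bounds the cardinality of \<open>H\<close>; the type
  \<^typ>\<open>real \<Rightarrow> complex\<close> leaves room for all separable spaces.\<close>

definition operator_algebra :: "('h \<Rightarrow> 'h) cnalg \<Rightarrow> bool" where
  "operator_algebra A \<longleftrightarrow>
     (\<exists>(H :: 'h cinner_space) S. complex_hilbert_space H \<and>
        subalgebra_of (bounded_operators H) S \<and> norm_closed (bounded_operators H) S \<and>
        A = (bounded_operators H) \<lparr> carr := S \<rparr>)"


section \<open>The bidual with its Arens product\<close>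

definition dual :: "('a, 'm) cnormed_scheme \<Rightarrow> ('a \<Rightarrow> complex) cnormed" where
  "dual V =
     \<lparr> carr = {f \<in> extensional (carr V).
          (\<forall>x\<in>carr V. \<forall>y\<in>carr V. f (vadd V x y) = f x + f y) \<and>
          (\<forall>c. \<forall>x\<in>carr V. f (vscale V c x) = c * f x) \<and>
          (\<exists>K. \<forall>x\<in>carr V. cmod (f x) \<le> K * nrm V x)},
       vadd = (\<lambda>f g. \<lambda>x\<in>carr V. f x + g x),
       vzero = (\<lambda>x\<in>carr V. 0),
       vscale = (\<lambda>c f. \<lambda>x\<in>carr V. c * f x),
       nrm = (\<lambda>f. Sup {cmod (f x) | x. x \<in> carr V \<and> nrm V x \<le> 1}) \<rparr>"

text \<open>The first Arens product: \<open>(F G)(\<phi>) = F (G \<phi>)\<close>, where \<open>(G \<phi>)(a) = G (\<phi> a)\<close> and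
  \<open>(\<phi> a)(b) = \<phi> (a b)\<close>. Operator algebras are Arens regular, so the second Arens product
  is the same.\<close>

definition arens :: "('a, 'm) cnalg_scheme \<Rightarrow>
    (('a \<Rightarrow> complex) \<Rightarrow> complex) \<Rightarrow> (('a \<Rightarrow> complex) \<Rightarrow> complex) \<Rightarrow> (('a \<Rightarrow> complex) \<Rightarrow> complex)" where
  "arens A F G =
     (\<lambda>\<phi>\<in>carr (dual A). F (\<lambda>a\<in>carr A. G (\<lambda>b\<in>carr A. \<phi> (amult A a b))))"

definition bidual :: "('a, 'm) cnalg_scheme \<Rightarrow> (('a \<Rightarrow> complex) \<Rightarrow> complex) cnalg" where
  "bidual A = cnormed.extend (dual (dual A)) (cnalg.fields (arens A))"


section \<open>Ideals, radical, units\<close>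

definition commutative :: "('a, 'm) cnalg_scheme \<Rightarrow> bool" where
  "commutative A \<longleftrightarrow> (\<forall>x\<in>carr A. \<forall>y\<in>carr A. amult A x y = amult A y x)"

definition left_ideal :: "('a, 'm) cnalg_scheme \<Rightarrow> 'a set \<Rightarrow> bool" where
  "left_ideal A L \<longleftrightarrow> subspace_of A L \<and> (\<forall>a\<in>carr A. \<forall>x\<in>L. amult A a x \<in> L)"

definition two_sided_ideal :: "('a, 'm) cnalg_scheme \<Rightarrow> 'a set \<Rightarrow> bool" where
  "two_sided_ideal A J \<longleftrightarrow> left_ideal A J \<and> (\<forall>a\<in>carr A. \<forall>x\<in>J. amult A x a \<in> J)"

definition semiprime :: "('a, 'm) cnalg_scheme \<Rightarrow> bool" where
  "semiprime A \<longleftrightarrow>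
     (\<forall>J. two_sided_ideal A J \<and> norm_closed A J \<and>
          {amult A x y | x y. x \<in> J \<and> y \<in> J} = {vzero A} \<longrightarrow> J = {vzero A})"

definition modular_left_ideal :: "('a, 'm) cnalg_scheme \<Rightarrow> 'a set \<Rightarrow> bool" where
  "modular_left_ideal A L \<longleftrightarrow>
     left_ideal A L \<and> (\<exists>e\<in>carr A. \<forall>a\<in>carr A. vsub A a (amult A a e) \<in> L)"

definition maximal_modular_left_ideal :: "('a, 'm) cnalg_scheme \<Rightarrow> 'a set \<Rightarrow> bool" where
  "maximal_modular_left_ideal A L \<longleftrightarrow>
     modular_left_ideal A L \<and> L \<noteq> carr A \<and>
     (\<forall>L'. left_ideal A L' \<and> L \<subseteq> L' \<longrightarrow> L' = L \<or> L' = carr A)"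

text \<open>The intersection of all maximal modular left ideals; the whole algebra if there are none.\<close>

definition jacobson_radical :: "('a, 'm) cnalg_scheme \<Rightarrow> 'a set" where
  "jacobson_radical A = {a \<in> carr A. \<forall>L. maximal_modular_left_ideal A L \<longrightarrow> a \<in> L}"

definition semisimple :: "('a, 'm) cnalg_scheme \<Rightarrow> bool" where
  "semisimple A \<longleftrightarrow> jacobson_radical A = {vzero A}"

definition radical_algebra :: "('a, 'm) cnalg_scheme \<Rightarrow> bool" where
  "radical_algebra A \<longleftrightarrow> jacobson_radical A = carr A"

text \<open>As usual for operator algebras, the identity is required to have norm one.\<close>

definition unital :: "('a, 'm) cnalg_scheme \<Rightarrow> bool" where
  "unital A \<longleftrightarrow>
     (\<exists>e\<in>carr A. nrm A e = 1 \<and> (\<forall>a\<in>carr A. amult A e a = a \<and> amult A a e = a))"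

text \<open>A contractive approximate identity, given as a proper filter on the algebra (the image of
  the section filter of a net) instead of as a net.\<close>

definition approximately_unital :: "('a, 'm) cnalg_scheme \<Rightarrow> bool" where
  "approximately_unital A \<longleftrightarrow>
     (\<exists>F :: 'a filter. F \<noteq> bot \<and> (\<forall>\<^sub>F e in F. e \<in> carr A \<and> nrm A e \<le> 1) \<and>
        (\<forall>a\<in>carr A. ((\<lambda>e. nrm A (vsub A (amult A e a) a)) \<longlongrightarrow> 0) F \<and>
                    ((\<lambda>e. nrm A (vsub A (amult A a e) a)) \<longlongrightarrow> 0) F))"

end

theory Submission
  imports Defs "HOL-Complex_Analysis.Complex_Analysis"
begin

text \<open>For an ideal \<open>J\<close> of \<open>A\<close>, the weak* closure \<open>J\<^sup>\<bottom>\<^sup>\<bottom>\<close> in the bidual is an ideal with the same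
  nilpotency, and for a maximal modular left ideal it is a proper modular left ideal, since a modular
  unit has distance at least one from the ideal. If \<open>x\<close> is in the radical of a commutative \<open>A\<close>, then
  \<open>(1 - l x)\<^sup>-\<^sup>1\<close> is entire in \<open>l\<close>, and Cauchy's inequality bounds \<open>\<phi> (x\<^sup>n)\<close> uniformly for \<open>\<phi>\<close> in the
  unit ball of the dual; so \<open>x\<close> is quasinilpotent in the bidual and lies in its radical.

  A unital semisimple algebra with a bidual that is not semiprime is spanned by \<open>1\<close> and the sums
  \<open>\<Sum>j. \<beta> j X j\<close> with \<open>\<beta>\<close> convergent, where the \<open>X j\<close> act on orthogonal planes and
  \<open>X j X j = w j X j\<close> with \<open>w j \<longrightarrow> 0\<close>: the weak* limit of \<open>\<Sum>j\<ge>n. X j\<close> spans an ideal of square zero.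

  The closed algebra generated by the Volterra operator \<open>V\<close> is radical because \<open>V\<close> is quasinilpotent, and
  \<open>n V (1 + n V)\<^sup>-\<^sup>1\<close> is a contractive approximate identity because \<open>V\<close> is accretive. A weak* cluster
  point of it is a right identity of the bidual, which is therefore not radical.\<close>

section \<open>Normed spaces and normed algebras with explicit carrier\<close>

text \<open>Hahn--Banach is stated for epigraph cones because two sublinear functionals are needed:
  a distance to an ideal and an upper limit along an approximate identity. For semisimplicity,
  injectivity of \<open>emb\<close> is what is used, and it comes from vector functionals. The
  powers of \<open>emb V x\<close> are therefore estimated through all functionals at once, with a
  Cauchy constant independent of the functional.

  The \<open>X j / w j\<close> are idempotents whose norms grow like \<open>1 / w j\<close>. Since
  \<open>w j\<close> is nonzero, the characters \<open>a + w j * \<beta> j\<close> separate points;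
  since \<open>w j\<close> tends to zero, they merge at infinity and do not see the limit of
  \<open>\<beta>\<close>. That limit is what carries the square-zero ideal of the bidual.

  The Hilbert space has to consist of functions with genuine equality, which suits square-summable
  sequences better than classes of square-integrable functions. So the Volterra operator is realised
  as a tridiagonal matrix in a Lanczos basis of continuous functions on the unit interval, and its
  estimates reach sequences through finite expansions.\<close>

locale cvs =
  fixes V :: "('a, 'm) cvec_scheme"
  assumes cvs: "complex_vector_space V"
begin

abbreviation plus_V (infixl "\<oplus>" 65) where "x \<oplus> y \<equiv> vadd V x y"
abbreviation scale_V (infixr "\<odot>" 75) where "c \<odot> x \<equiv> vscale V c x"
abbreviation minus_V (infixl "\<ominus>" 65) where "x \<ominus> y \<equiv> vsub V x y"
abbreviation zero_V ("\<zero>") where "\<zero> \<equiv> vzero V"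

lemma
  shows zero_closed [simp]: "\<zero> \<in> carr V"
    and add_closed [simp]: "\<lbrakk>x \<in> carr V; y \<in> carr V\<rbrakk> \<Longrightarrow> x \<oplus> y \<in> carr V"
    and scale_closed [simp]: "x \<in> carr V \<Longrightarrow> c \<odot> x \<in> carr V"
    and add_assoc: "\<lbrakk>x \<in> carr V; y \<in> carr V; z \<in> carr V\<rbrakk> \<Longrightarrow> (x \<oplus> y) \<oplus> z = x \<oplus> (y \<oplus> z)"
    and add_commute: "\<lbrakk>x \<in> carr V; y \<in> carr V\<rbrakk> \<Longrightarrow> x \<oplus> y = y \<oplus> x"
    and zero_add [simp]: "x \<in> carr V \<Longrightarrow> \<zero> \<oplus> x = x"
    and ex_neg: "x \<in> carr V \<Longrightarrow> \<exists>y\<in>carr V. x \<oplus> y = \<zero>"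
    and scale_add_right: "\<lbrakk>x \<in> carr V; y \<in> carr V\<rbrakk> \<Longrightarrow> c \<odot> (x \<oplus> y) = c \<odot> x \<oplus> c \<odot> y"
    and scale_add_left: "x \<in> carr V \<Longrightarrow> (c + d) \<odot> x = c \<odot> x \<oplus> d \<odot> x"
    and scale_scale [simp]: "x \<in> carr V \<Longrightarrow> c \<odot> (d \<odot> x) = (c * d) \<odot> x"
    and scale_one [simp]: "x \<in> carr V \<Longrightarrow> 1 \<odot> x = x"
  using cvs unfolding complex_vector_space_def by (blast | metis)+

lemma add_left_commute: "\<lbrakk>x \<in> carr V; y \<in> carr V; z \<in> carr V\<rbrakk> \<Longrightarrow> x \<oplus> (y \<oplus> z) = y \<oplus> (x \<oplus> z)"
  by (metis add_assoc add_commute)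

lemmas add_ac = add_assoc add_commute add_left_commute

lemma add_zero [simp]: "x \<in> carr V \<Longrightarrow> x \<oplus> \<zero> = x"
  by (metis add_commute zero_add zero_closed)

lemma scale_zero_left [simp]:
  assumes "x \<in> carr V"
  shows "0 \<odot> x = \<zero>"
proof -
  obtain y where y: "y \<in> carr V" "0 \<odot> x \<oplus> y = \<zero>"
    using ex_neg[OF scale_closed[OF assms, of 0]] by blast
  have "0 \<odot> x \<oplus> 0 \<odot> x = 0 \<odot> x"
    using scale_add_left[of x 0 0] assms by simp
  then show ?thesis
    by (metis add_assoc add_zero assms scale_closed y)
qed

lemma add_neg [simp]: "x \<in> carr V \<Longrightarrow> x \<oplus> (-1) \<odot> x = \<zero>"
  using scale_add_left[of x 1 "-1"] by simp

lemma neg_add [simp]: "x \<in> carr V \<Longrightarrow> (-1) \<odot> x \<oplus> x = \<zero>"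
  by (metis add_commute add_neg scale_closed)

lemma add_neg_cancel [simp]: "\<lbrakk>x \<in> carr V; y \<in> carr V\<rbrakk> \<Longrightarrow> x \<oplus> ((-1) \<odot> x \<oplus> y) = y"
  by (metis add_assoc add_neg scale_closed zero_add)

lemma neg_add_cancel [simp]: "\<lbrakk>x \<in> carr V; y \<in> carr V\<rbrakk> \<Longrightarrow> (-1) \<odot> x \<oplus> (x \<oplus> y) = y"
  by (metis add_assoc neg_add scale_closed zero_add)

lemma scale_zero_right [simp]: "c \<odot> \<zero> = \<zero>"
  by (metis mult_zero_right scale_scale scale_zero_left zero_closed)

lemma sub_closed [simp]: "\<lbrakk>x \<in> carr V; y \<in> carr V\<rbrakk> \<Longrightarrow> x \<ominus> y \<in> carr V"
  by (simp add: vsub_def)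

lemma sub_self [simp]: "x \<in> carr V \<Longrightarrow> x \<ominus> x = \<zero>"
  by (simp add: vsub_def)

lemma sub_zero [simp]: "x \<in> carr V \<Longrightarrow> x \<ominus> \<zero> = x"
  by (simp add: vsub_def)

lemma sub_eq_zeroD: "\<lbrakk>x \<ominus> y = \<zero>; x \<in> carr V; y \<in> carr V\<rbrakk> \<Longrightarrow> x = y"
  by (metis add_neg_cancel add_zero add_commute scale_closed vsub_def)

lemma add_sub_cancel [simp]: "\<lbrakk>x \<in> carr V; y \<in> carr V\<rbrakk> \<Longrightarrow> y \<oplus> (x \<ominus> y) = x"
  by (simp add: vsub_def add_left_commute)

lemma sub_add_cancel [simp]: "\<lbrakk>x \<in> carr V; y \<in> carr V\<rbrakk> \<Longrightarrow> (x \<ominus> y) \<oplus> y = x"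
  by (simp add: vsub_def add_assoc)

lemma sub_sub: "\<lbrakk>x \<in> carr V; y \<in> carr V; z \<in> carr V\<rbrakk> \<Longrightarrow> x \<ominus> z = (x \<ominus> y) \<oplus> (y \<ominus> z)"
  by (simp add: vsub_def add_assoc)

lemma neg_sub: "\<lbrakk>x \<in> carr V; y \<in> carr V\<rbrakk> \<Longrightarrow> (-1) \<odot> (x \<ominus> y) = y \<ominus> x"
  by (simp add: vsub_def scale_add_right add_commute)

lemma scale_sub_right: "\<lbrakk>x \<in> carr V; y \<in> carr V\<rbrakk> \<Longrightarrow> c \<odot> (x \<ominus> y) = c \<odot> x \<ominus> c \<odot> y"
  by (simp add: vsub_def scale_add_right mult.commute)

lemma sub_add_sub:
  "\<lbrakk>x \<in> carr V; y \<in> carr V; x' \<in> carr V; y' \<in> carr V\<rbrakk> \<Longrightarrow> (x \<oplus> y) \<ominus> (x' \<oplus> y') = (x \<ominus> x') \<oplus> (y \<ominus> y')"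
  by (simp add: vsub_def scale_add_right add_ac)

end

locale nspace = cvs V for V :: "('a, 'm) cnormed_scheme" +
  assumes nrm_ge_0 [simp]: "x \<in> carr V \<Longrightarrow> 0 \<le> nrm V x"
    and nrm_zeroD: "\<lbrakk>x \<in> carr V; nrm V x = 0\<rbrakk> \<Longrightarrow> x = vzero V"
    and nrm_scale: "x \<in> carr V \<Longrightarrow> nrm V (vscale V c x) = cmod c * nrm V x"
    and nrm_triangle: "\<lbrakk>x \<in> carr V; y \<in> carr V\<rbrakk> \<Longrightarrow> nrm V (vadd V x y) \<le> nrm V x + nrm V y"
begin

lemma nrm_zero [simp]: "nrm V \<zero> = 0"
  using nrm_scale[of \<zero> 0] by simp

lemma nrm_sub_commute: "\<lbrakk>x \<in> carr V; y \<in> carr V\<rbrakk> \<Longrightarrow> nrm V (x \<ominus> y) = nrm V (y \<ominus> x)"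
  by (metis neg_sub norm_minus_cancel norm_one nrm_scale mult_1 sub_closed)

lemma nrm_sub_triangle:
  "\<lbrakk>x \<in> carr V; y \<in> carr V; z \<in> carr V\<rbrakk> \<Longrightarrow> nrm V (x \<ominus> z) \<le> nrm V (x \<ominus> y) + nrm V (y \<ominus> z)"
  by (metis nrm_triangle sub_closed sub_sub)

lemma nrm_le_sub: "\<lbrakk>x \<in> carr V; y \<in> carr V\<rbrakk> \<Longrightarrow> nrm V x \<le> nrm V y + nrm V (x \<ominus> y)"
  using nrm_triangle[of y "x \<ominus> y"] by simp

definition tendsto_nrm :: "(nat \<Rightarrow> 'a) \<Rightarrow> 'a \<Rightarrow> bool" where
  "tendsto_nrm x l \<longleftrightarrow> (\<lambda>n. nrm V (x n \<ominus> l)) \<longlonglongrightarrow> 0"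

lemma metric: "Metric_space (carr V) (norm_dist V (nrm V))"
proof
  show "norm_dist V (nrm V) x y = 0 \<longleftrightarrow> x = y" if "x \<in> carr V" "y \<in> carr V" for x y
    using that by (auto simp: norm_dist_def intro: sub_eq_zeroD nrm_zeroD sub_closed)
qed (auto simp: norm_dist_def nrm_sub_commute nrm_sub_triangle)

lemma limitin_iff:
  assumes "\<And>n. x n \<in> carr V"
  shows "limitin (Metric_space.mtopology (carr V) (norm_dist V (nrm V))) x l sequentially
    \<longleftrightarrow> l \<in> carr V \<and> tendsto_nrm x l"
  using assms
  by (auto simp: Metric_space.limit_metric_sequentially[OF metric] tendsto_nrm_def lim_sequentially
      norm_dist_def dist_real_def)

lemma norm_closed_iff:
  "norm_closed V S \<longleftrightarrow> S \<subseteq> carr V \<and> (\<forall>x l. (\<forall>n. x n \<in> S) \<and> l \<in> carr V \<and> tendsto_nrm x l \<longrightarrow> l \<in> S)"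
proof -
  have "norm_closed V S \<longleftrightarrow> S \<subseteq> carr V \<and> (\<forall>x l. range x \<subseteq> S \<and>
     limitin (Metric_space.mtopology (carr V) (norm_dist V (nrm V))) x l sequentially \<longrightarrow> l \<in> S)"
    by (simp add: norm_closed_def Metric_space.metric_closedin_iff_sequentially_closed[OF metric])
  also have "\<dots> \<longleftrightarrow> S \<subseteq> carr V \<and> (\<forall>x l. (\<forall>n. x n \<in> S) \<and> l \<in> carr V \<and> tendsto_nrm x l \<longrightarrow> l \<in> S)"
    by (intro conj_cong refl all_cong1) (auto simp: limitin_iff image_subset_iff subset_iff)
  finally show ?thesis .
qed

definition cauchy_nrm :: "(nat \<Rightarrow> 'a) \<Rightarrow> bool" where
  "cauchy_nrm x \<longleftrightarrow> (\<forall>n. x n \<in> carr V) \<and> (\<forall>e>0. \<exists>N. \<forall>m\<ge>N. \<forall>n\<ge>N. nrm V (x m \<ominus> x n) < e)"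

lemma mcomplete_iff:
  "Metric_space.mcomplete (carr V) (norm_dist V (nrm V)) \<longleftrightarrow>
     (\<forall>x. cauchy_nrm x \<longrightarrow> (\<exists>l\<in>carr V. tendsto_nrm x l))"
proof -
  have "Metric_space.MCauchy (carr V) (norm_dist V (nrm V)) x \<longleftrightarrow> cauchy_nrm x" for x
    by (auto simp: Metric_space.MCauchy_def[OF metric] cauchy_nrm_def norm_dist_def image_subset_iff)
  moreover have "(\<exists>l. limitin (Metric_space.mtopology (carr V) (norm_dist V (nrm V))) x l sequentially)
      \<longleftrightarrow> (\<exists>l\<in>carr V. tendsto_nrm x l)" if "cauchy_nrm x" for x
    using that limitin_iff[of x] by (auto simp: cauchy_nrm_def)
  ultimately show ?thesis
    by (auto simp: Metric_space.mcomplete_def[OF metric])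
qed

lemma tendsto_nrm_sandwich:
  assumes "\<And>n. nrm V (x n \<ominus> l) \<le> f n" "f \<longlonglongrightarrow> 0" "\<And>n. x n \<in> carr V" "l \<in> carr V"
  shows "tendsto_nrm x l"
  unfolding tendsto_nrm_def
  by (rule tendsto_sandwich[OF _ _ tendsto_const assms(2)]) (use assms in auto)

end

locale banach = nspace V for V :: "('a, 'm) cnormed_scheme" +
  assumes complete: "cauchy_nrm x \<Longrightarrow> \<exists>l\<in>carr V. tendsto_nrm x l"

locale nalgebra = nspace V for V :: "('a, 'm) cnalg_scheme" +
  assumes mult_closed [simp]: "\<lbrakk>x \<in> carr V; y \<in> carr V\<rbrakk> \<Longrightarrow> amult V x y \<in> carr V"
    and mult_assoc: "\<lbrakk>x \<in> carr V; y \<in> carr V; z \<in> carr V\<rbrakk> \<Longrightarrow>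
      amult V (amult V x y) z = amult V x (amult V y z)"
    and distrib_left: "\<lbrakk>x \<in> carr V; y \<in> carr V; z \<in> carr V\<rbrakk> \<Longrightarrow>
      amult V x (vadd V y z) = vadd V (amult V x y) (amult V x z)"
    and distrib_right: "\<lbrakk>x \<in> carr V; y \<in> carr V; z \<in> carr V\<rbrakk> \<Longrightarrow>
      amult V (vadd V x y) z = vadd V (amult V x z) (amult V y z)"
    and mult_scale_left [simp]: "\<lbrakk>x \<in> carr V; y \<in> carr V\<rbrakk> \<Longrightarrow>
      amult V (vscale V c x) y = vscale V c (amult V x y)"
    and mult_scale_right [simp]: "\<lbrakk>x \<in> carr V; y \<in> carr V\<rbrakk> \<Longrightarrow>
      amult V x (vscale V c y) = vscale V c (amult V x y)"
    and nrm_mult: "\<lbrakk>x \<in> carr V; y \<in> carr V\<rbrakk> \<Longrightarrow> nrm V (amult V x y) \<le> nrm V x * nrm V y"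
begin

abbreviation mult_A (infixl "\<otimes>" 70) where "x \<otimes> y \<equiv> amult V x y"

lemma mult_zero_left [simp]: "x \<in> carr V \<Longrightarrow> \<zero> \<otimes> x = \<zero>"
  by (metis mult_scale_left scale_zero_left zero_closed mult_closed)

lemma mult_zero_right [simp]: "x \<in> carr V \<Longrightarrow> x \<otimes> \<zero> = \<zero>"
  by (metis mult_scale_right scale_zero_left zero_closed mult_closed)

lemma mult_sub_left: "\<lbrakk>x \<in> carr V; y \<in> carr V; z \<in> carr V\<rbrakk> \<Longrightarrow> (x \<ominus> y) \<otimes> z = x \<otimes> z \<ominus> y \<otimes> z"
  by (simp add: vsub_def distrib_right)

lemma mult_sub_right: "\<lbrakk>x \<in> carr V; y \<in> carr V; z \<in> carr V\<rbrakk> \<Longrightarrow> x \<otimes> (y \<ominus> z) = x \<otimes> y \<ominus> x \<otimes> z"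
  by (simp add: vsub_def distrib_left)

text \<open>The exponent is shifted by one, as there need not be a unit.\<close>

fun pw :: "'a \<Rightarrow> nat \<Rightarrow> 'a" where
  "pw x 0 = x"
| "pw x (Suc n) = pw x n \<otimes> x"

lemma pw_closed [simp]: "x \<in> carr V \<Longrightarrow> pw x n \<in> carr V"
  by (induction n) auto

lemma nrm_pw_le: "x \<in> carr V \<Longrightarrow> nrm V (pw x n) \<le> nrm V x ^ Suc n"
proof (induction n)
  case (Suc n)
  have "nrm V (pw x (Suc n)) \<le> nrm V (pw x n) * nrm V x"
    using nrm_mult Suc.prems by simp
  also have "\<dots> \<le> nrm V x ^ Suc n * nrm V x"
    using Suc by (intro mult_right_mono) auto
  finally show ?case by (simp add: mult_ac)
qed simp

end

locale banach_algebra = nalgebra V + banach V for V :: "('a, 'm) cnalg_scheme"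

section \<open>Spaces of bounded linear maps\<close>

text \<open>Common source of duals (with target \<open>cplx\<close>) and of operator algebras (with
  equal source and target), so that the norm axioms and completeness are proved once for
  both.\<close>

definition bl_maps :: "('a, 'm) cnormed_scheme \<Rightarrow> ('b, 'n) cnormed_scheme \<Rightarrow> ('a \<Rightarrow> 'b) cnormed" where
  "bl_maps V W =
     \<lparr> carr = {T \<in> carr V \<rightarrow>\<^sub>E carr W.
          (\<forall>x\<in>carr V. \<forall>y\<in>carr V. T (vadd V x y) = vadd W (T x) (T y)) \<and>
          (\<forall>c. \<forall>x\<in>carr V. T (vscale V c x) = vscale W c (T x)) \<and>
          (\<exists>K. \<forall>x\<in>carr V. nrm W (T x) \<le> K * nrm V x)},
       vadd = (\<lambda>S T. \<lambda>x\<in>carr V. vadd W (S x) (T x)),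
       vzero = (\<lambda>x\<in>carr V. vzero W),
       vscale = (\<lambda>c T. \<lambda>x\<in>carr V. vscale W c (T x)),
       nrm = (\<lambda>T. Sup {nrm W (T x) | x. x \<in> carr V \<and> nrm V x \<le> 1}) \<rparr>"

locale nspace_pair = V: nspace V + W: nspace W
  for V :: "('a, 'm) cnormed_scheme" and W :: "('b, 'n) cnormed_scheme"
begin

abbreviation "B \<equiv> bl_maps V W"

lemma B_sel:
  "vadd B S T = (\<lambda>x\<in>carr V. vadd W (S x) (T x))"
  "vzero B = (\<lambda>x\<in>carr V. vzero W)"
  "vscale B c T = (\<lambda>x\<in>carr V. vscale W c (T x))"
  by (simp_all add: bl_maps_def)

lemma B_app [simp]:
  "x \<in> carr V \<Longrightarrow> vadd B S T x = vadd W (S x) (T x)"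
  "x \<in> carr V \<Longrightarrow> vzero B x = vzero W"
  "x \<in> carr V \<Longrightarrow> vscale B c T x = vscale W c (T x)"
  "x \<in> carr V \<Longrightarrow> vsub B S T x = vsub W (S x) (T x)"
  by (simp_all add: B_sel vsub_def)

lemma carr_B: "T \<in> carr B \<longleftrightarrow> T \<in> extensional (carr V) \<and> (\<forall>x\<in>carr V. T x \<in> carr W) \<and>
    (\<forall>x\<in>carr V. \<forall>y\<in>carr V. T (vadd V x y) = vadd W (T x) (T y)) \<and>
    (\<forall>c. \<forall>x\<in>carr V. T (vscale V c x) = vscale W c (T x)) \<and>
    (\<exists>K. \<forall>x\<in>carr V. nrm W (T x) \<le> K * nrm V x)"
  by (simp add: bl_maps_def PiE_iff Pi_iff conj_ac)

lemma
  assumes "T \<in> carr B"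
  shows B_closed [simp]: "x \<in> carr V \<Longrightarrow> T x \<in> carr W"
    and B_add: "\<lbrakk>x \<in> carr V; y \<in> carr V\<rbrakk> \<Longrightarrow> T (vadd V x y) = vadd W (T x) (T y)"
    and B_scale: "x \<in> carr V \<Longrightarrow> T (vscale V c x) = vscale W c (T x)"
    and B_bound: "\<exists>K. \<forall>x\<in>carr V. nrm W (T x) \<le> K * nrm V x"
    and B_ext: "T \<in> extensional (carr V)"
  using assms unfolding carr_B by blast+

lemma B_sub: "\<lbrakk>T \<in> carr B; x \<in> carr V; y \<in> carr V\<rbrakk> \<Longrightarrow> T (vsub V x y) = vsub W (T x) (T y)"
  by (simp add: vsub_def B_add B_scale)

lemma BI:
  assumes "T \<in> extensional (carr V)" "\<And>x. x \<in> carr V \<Longrightarrow> T x \<in> carr W"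
    "\<And>x y. \<lbrakk>x \<in> carr V; y \<in> carr V\<rbrakk> \<Longrightarrow> T (vadd V x y) = vadd W (T x) (T y)"
    "\<And>c x. x \<in> carr V \<Longrightarrow> T (vscale V c x) = vscale W c (T x)"
    "\<And>x. x \<in> carr V \<Longrightarrow> nrm W (T x) \<le> K * nrm V x"
  shows "T \<in> carr B"
  unfolding carr_B using assms by blast

lemma B_eqI: "\<lbrakk>S \<in> carr B; T \<in> carr B; \<And>x. x \<in> carr V \<Longrightarrow> S x = T x\<rbrakk> \<Longrightarrow> S = T"
  by (rule extensionalityI[of S "carr V" T]) (simp_all add: B_ext)

lemma B_zero: "T \<in> carr B \<Longrightarrow> T (vzero V) = vzero W"
  by (metis B_closed B_scale V.scale_zero_left V.zero_closed W.scale_zero_left)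

text \<open>The norm is a real \<open>Sup\<close>, which carries information only for sets that are
  bounded above.\<close>

lemma B_bdd:
  assumes T: "T \<in> carr B"
  shows "bdd_above {nrm W (T x) | x. x \<in> carr V \<and> nrm V x \<le> 1}"
proof -
  obtain K where K: "\<forall>x\<in>carr V. nrm W (T x) \<le> K * nrm V x"
    using B_bound[OF T] by blast
  have "nrm W (T y) \<le> \<bar>K\<bar>" if y: "y \<in> carr V" "nrm V y \<le> 1" for y
  proof -
    have "nrm W (T y) \<le> K * nrm V y" using K y by blast
    also have "\<dots> \<le> \<bar>K\<bar> * nrm V y" using V.nrm_ge_0[OF y(1)] by (intro mult_right_mono) auto
    also have "\<dots> \<le> \<bar>K\<bar> * 1" using y(2) by (intro mult_left_mono) auto
    finally show ?thesis by simp
  qed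
  then show ?thesis
    by (intro bdd_aboveI[of _ "\<bar>K\<bar>"]) auto
qed

lemma nrm_B_apply:
  assumes T: "T \<in> carr B" and x: "x \<in> carr V"
  shows "nrm W (T x) \<le> nrm B T * nrm V x"
proof (cases "nrm V x = 0")
  case True
  then show ?thesis
    using V.nrm_zeroD[OF x True] B_zero[OF T] by simp
next
  case False
  then have p: "nrm V x > 0" using V.nrm_ge_0[OF x] by linarith
  define c where "c = complex_of_real (1 / nrm V x)"
  let ?y = "vscale V c x"
  have c: "cmod c = 1 / nrm V x"
    unfolding c_def norm_of_real using p by simp
  have y: "?y \<in> carr V" "nrm V ?y = 1"
    using x V.nrm_scale[OF x, of c] p c by auto
  have "nrm W (T ?y) \<le> Sup {nrm W (T x) | x. x \<in> carr V \<and> nrm V x \<le> 1}"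
    using y by (intro cSup_upper[OF _ B_bdd[OF T]] CollectI exI[of _ ?y]) simp
  then have "nrm W (T ?y) \<le> nrm B T"
    by (simp add: bl_maps_def)
  moreover have "nrm W (T ?y) = nrm W (T x) / nrm V x"
    using x T c by (simp add: B_scale W.nrm_scale)
  ultimately show ?thesis
    using p by (simp add: pos_divide_le_eq)
qed

lemma nrm_B_le:
  assumes "\<And>x. x \<in> carr V \<Longrightarrow> nrm W (T x) \<le> K * nrm V x" "K \<ge> 0"
  shows "nrm B T \<le> K"
proof -
  have *: "nrm W (T y) \<le> K" if "y \<in> carr V" "nrm V y \<le> 1" for y
    using assms(1)[OF that(1)] mult_left_le[OF that(2) assms(2)] by linarith
  have "\<exists>x. x \<in> carr V \<and> nrm V x \<le> 1"
    by (rule exI[of _ "vzero V"]) simp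
  then have "Sup {nrm W (T x) | x. x \<in> carr V \<and> nrm V x \<le> 1} \<le> K"
    using * by (intro cSup_least) blast+
  then show ?thesis
    by (simp add: bl_maps_def)
qed

lemma nrm_B_ge_0:
  assumes "T \<in> carr B"
  shows "0 \<le> nrm B T"
proof -
  have "nrm W (T (vzero V)) \<le> Sup {nrm W (T x) | x. x \<in> carr V \<and> nrm V x \<le> 1}"
    by (intro cSup_upper[OF _ B_bdd[OF assms]] CollectI exI[of _ "vzero V"]) simp
  then show ?thesis
    using B_zero[OF assms] by (simp add: bl_maps_def)
qed

lemma B_add_closed:
  assumes S: "S \<in> carr B" and T: "T \<in> carr B"
  shows "vadd B S T \<in> carr B"
proof (rule BI[where K = "nrm B S + nrm B T"])
  fix x assume x: "x \<in> carr V"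
  show "vadd B S T x \<in> carr W"
    using S T x by simp
  have "nrm W (vadd B S T x) \<le> nrm W (S x) + nrm W (T x)"
    using S T x by (simp add: W.nrm_triangle)
  also have "\<dots> \<le> nrm B S * nrm V x + nrm B T * nrm V x"
    using S T x by (intro add_mono nrm_B_apply)
  finally show "nrm W (vadd B S T x) \<le> (nrm B S + nrm B T) * nrm V x"
    by (simp add: distrib_right)
  show "vadd B S T (vscale V c x) = vscale W c (vadd B S T x)" for c
    using S T x by (simp add: B_scale W.scale_add_right)
  fix y assume y: "y \<in> carr V"
  show "vadd B S T (vadd V x y) = vadd W (vadd B S T x) (vadd B S T y)"
    using B_closed[OF S x] B_closed[OF S y] B_closed[OF T x] B_closed[OF T y] x y
    by (simp add: B_add[OF S x y] B_add[OF T x y] W.add_ac)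
qed (simp add: B_sel)

lemma B_scale_closed:
  assumes T: "T \<in> carr B"
  shows "vscale B c T \<in> carr B"
proof (rule BI[where K = "cmod c * nrm B T"])
  fix x assume x: "x \<in> carr V"
  show "vscale B c T x \<in> carr W"
    using T x by simp
  show "nrm W (vscale B c T x) \<le> cmod c * nrm B T * nrm V x"
    using mult_left_mono[OF nrm_B_apply[OF T x], of "cmod c"] T x by (simp add: W.nrm_scale mult.assoc)
  show "vscale B c T (vscale V d x) = vscale W d (vscale B c T x)" for d
    using T x by (simp add: B_scale mult.commute)
  fix y assume y: "y \<in> carr V"
  show "vscale B c T (vadd V x y) = vadd W (vscale B c T x) (vscale B c T y)"
    using T x y by (simp add: B_add W.scale_add_right)
qed (simp add: B_sel)

lemma B_zero_closed: "vzero B \<in> carr B"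
  by (rule BI[where K = 0]) (auto simp: B_sel)

lemma B_cvs: "complex_vector_space B"
  unfolding complex_vector_space_def
proof (intro conjI ballI allI)
  show "vzero B \<in> carr B" by (rule B_zero_closed)
  fix x assume x: "x \<in> carr B"
  show "vscale B c x \<in> carr B" for c using x by (rule B_scale_closed)
  show "vadd B (vzero B) x = x"
    using x by (intro B_eqI B_add_closed B_zero_closed) simp_all
  show "\<exists>y\<in>carr B. vadd B x y = vzero B"
    using x B_scale_closed[OF x, of "-1"]
    by (intro bexI[of _ "vscale B (-1) x"] B_eqI B_add_closed B_zero_closed) simp_all
  show "vscale B (c + d) x = vadd B (vscale B c x) (vscale B d x)" for c d
    using x by (intro B_eqI B_add_closed B_scale_closed) (simp_all add: W.scale_add_left)
  show "vscale B (c * d) x = vscale B c (vscale B d x)" for c d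
    using x by (intro B_eqI B_scale_closed) simp_all
  show "vscale B 1 x = x"
    using x by (intro B_eqI B_scale_closed) simp_all
  fix y assume y: "y \<in> carr B"
  show "vadd B x y \<in> carr B" using x y by (rule B_add_closed)
  show "vadd B x y = vadd B y x"
    using x y by (intro B_eqI B_add_closed) (simp_all add: W.add_commute)
  show "vscale B c (vadd B x y) = vadd B (vscale B c x) (vscale B c y)" for c
    using x y by (intro B_eqI B_add_closed B_scale_closed) (simp_all add: W.scale_add_right)
  fix z assume z: "z \<in> carr B"
  show "vadd B (vadd B x y) z = vadd B x (vadd B y z)"
    using x y z by (intro B_eqI B_add_closed) (simp_all add: W.add_assoc)
qed

lemma B_nspace: "nspace B"
proof (intro nspace.intro cvs.intro nspace_axioms.intro B_cvs nrm_B_ge_0, goal_cases)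
  case (2 T)
  show ?case
  proof (rule B_eqI)
    fix x assume x: "x \<in> carr V"
    show "T x = vzero B x"
      using nrm_B_apply[OF 2(1) x] 2 x W.nrm_ge_0[OF B_closed[OF 2(1) x]]
      by (simp add: W.nrm_zeroD order.antisym)
  qed (use 2 B_zero_closed in simp_all)
next
  case (3 T c)
  \<comment> \<open>One inequality suffices: applied to \<open>1/c\<close> and
    \<open>vscale B c T\<close> it gives the reverse one.\<close>
  have le: "nrm B (vscale B c T) \<le> cmod c * nrm B T" if "T \<in> carr B" for c T
  proof (rule nrm_B_le)
    show "nrm W (vscale B c T x) \<le> cmod c * nrm B T * nrm V x" if "x \<in> carr V" for x
      using mult_left_mono[OF nrm_B_apply[OF \<open>T \<in> carr B\<close> that], of "cmod c"] that \<open>T \<in> carr B\<close>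
      by (simp add: W.nrm_scale mult_ac)
  qed (use nrm_B_ge_0[OF that] in simp)
  show ?case
  proof (cases "c = 0")
    case True
    then show ?thesis
      using le[OF 3, of 0] nrm_B_ge_0[OF B_scale_closed[OF 3, of 0]] by simp
  next
    case False
    have "vscale B (1/c) (vscale B c T) = T"
      using 3 False by (intro B_eqI B_scale_closed) auto
    then have "nrm B T \<le> cmod (1/c) * nrm B (vscale B c T)"
      using le[OF B_scale_closed[OF 3, of c], of "1/c"] by simp
    then have "cmod c * nrm B T \<le> nrm B (vscale B c T)"
      using False by (simp add: norm_divide field_simps)
    then show ?thesis using le[OF 3, of c] by simp
  qed
next
  case (4 S T)
  show ?case
  proof (rule nrm_B_le)
    fix x assume x: "x \<in> carr V"
    have "nrm W (vadd B S T x) \<le> nrm W (S x) + nrm W (T x)"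
      using 4 x by (simp add: W.nrm_triangle)
    also have "\<dots> \<le> nrm B S * nrm V x + nrm B T * nrm V x"
      using 4 x by (intro add_mono nrm_B_apply)
    finally show "nrm W (vadd B S T x) \<le> (nrm B S + nrm B T) * nrm V x"
      by (simp add: distrib_right)
  qed (use nrm_B_ge_0[OF 4(1)] nrm_B_ge_0[OF 4(2)] in simp)
qed

end

context nspace
begin

lemma tendsto_nrm_unique:
  assumes "tendsto_nrm x l" "tendsto_nrm x l'" "\<And>n. x n \<in> carr V" "l \<in> carr V" "l' \<in> carr V"
  shows "l = l'"
proof -
  have "(\<lambda>n. nrm V (x n \<ominus> l) + nrm V (x n \<ominus> l')) \<longlonglongrightarrow> 0 + 0"
    using assms(1,2) unfolding tendsto_nrm_def by (rule tendsto_add)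
  moreover have "nrm V (l \<ominus> l') \<le> nrm V (x n \<ominus> l) + nrm V (x n \<ominus> l')" for n
    using nrm_sub_triangle[of l "x n" l'] nrm_sub_commute[of l "x n"] assms by simp
  ultimately have "nrm V (l \<ominus> l') \<le> 0 + 0"
    by (intro LIMSEQ_le_const) auto
  then have "nrm V (l \<ominus> l') = 0"
    using nrm_ge_0[of "l \<ominus> l'"] assms by (simp del: nrm_ge_0)
  then show ?thesis
    using assms nrm_zeroD[of "l \<ominus> l'"] sub_eq_zeroD by simp
qed

lemma tendsto_nrm_add:
  assumes "tendsto_nrm x l" "tendsto_nrm y k" "\<And>n. x n \<in> carr V" "\<And>n. y n \<in> carr V"
    "l \<in> carr V" "k \<in> carr V"
  shows "tendsto_nrm (\<lambda>n. x n \<oplus> y n) (l \<oplus> k)"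
proof (rule tendsto_nrm_sandwich)
  show "(\<lambda>n. nrm V (x n \<ominus> l) + nrm V (y n \<ominus> k)) \<longlonglongrightarrow> 0"
    using tendsto_add[OF assms(1,2)[unfolded tendsto_nrm_def]] by simp
  show "nrm V (x n \<oplus> y n \<ominus> (l \<oplus> k)) \<le> nrm V (x n \<ominus> l) + nrm V (y n \<ominus> k)" for n
    using assms by (simp add: sub_add_sub nrm_triangle)
qed (use assms in simp_all)

lemma tendsto_nrm_scale:
  assumes "tendsto_nrm x l" "\<And>n. x n \<in> carr V" "l \<in> carr V"
  shows "tendsto_nrm (\<lambda>n. c \<odot> x n) (c \<odot> l)"
proof (rule tendsto_nrm_sandwich)
  show "(\<lambda>n. cmod c * nrm V (x n \<ominus> l)) \<longlonglongrightarrow> 0"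
    using tendsto_mult_left[OF assms(1)[unfolded tendsto_nrm_def], of "cmod c"] by simp
  show "nrm V (c \<odot> x n \<ominus> c \<odot> l) \<le> cmod c * nrm V (x n \<ominus> l)" for n
    using assms by (simp add: nrm_scale flip: scale_sub_right)
qed (use assms in simp_all)

lemma tendsto_nrm_const: "l \<in> carr V \<Longrightarrow> tendsto_nrm (\<lambda>n. l) l"
  by (simp add: tendsto_nrm_def)

lemma tendsto_nrm_bound:
  assumes "tendsto_nrm x l" "\<And>n. x n \<in> carr V" "l \<in> carr V" "y \<in> carr V"
    "\<And>n. n \<ge> N \<Longrightarrow> nrm V (y \<ominus> x n) \<le> K"
  shows "nrm V (y \<ominus> l) \<le> K"
proof -
  have "(\<lambda>n. K + nrm V (x n \<ominus> l)) \<longlonglongrightarrow> K + 0"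
    using assms(1) unfolding tendsto_nrm_def by (intro tendsto_intros)
  moreover have "nrm V (y \<ominus> l) \<le> K + nrm V (x n \<ominus> l)" if "n \<ge> N" for n
    using nrm_sub_triangle[of y "x n" l] assms(5)[OF that] assms by simp
  ultimately show ?thesis
    using LIMSEQ_le_const[of "\<lambda>n. K + nrm V (x n \<ominus> l)" "K + 0" "nrm V (y \<ominus> l)"] by auto
qed

end

context nspace_pair
begin

lemma B_banach:
  assumes W: "banach W"
  shows "banach B"
proof -
  interpret B: nspace B by (rule B_nspace)
  interpret W: banach W by (rule W)
  show ?thesis
  proof
    fix T assume "B.cauchy_nrm T"
    then have T: "\<And>n. T n \<in> carr B" and C: "\<And>e. e > 0 \<Longrightarrow> \<exists>N. \<forall>m\<ge>N. \<forall>n\<ge>N. nrm B (vsub B (T m) (T n)) < e"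
      by (auto simp: B.cauchy_nrm_def)
    have diff: "nrm W (vsub W (T m x) (T n x)) \<le> nrm B (vsub B (T m) (T n)) * nrm V x"
      if "x \<in> carr V" for m n x
      using nrm_B_apply[OF B.sub_closed[OF T T] that, of m n] that by simp
    have "\<exists>l\<in>carr W. W.tendsto_nrm (\<lambda>n. T n x) l" if x: "x \<in> carr V" for x
    proof (rule W.complete, unfold W.cauchy_nrm_def, intro conjI allI impI)
      show "T n x \<in> carr W" for n using T x by simp
      fix e :: real assume e: "e > 0"
      have p: "0 < nrm V x + 1" using V.nrm_ge_0[OF x] by linarith
      obtain N where N: "\<forall>m\<ge>N. \<forall>n\<ge>N. nrm B (vsub B (T m) (T n)) < e / (nrm V x + 1)"
        using C[of "e / (nrm V x + 1)"] e p by auto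
      have "nrm W (vsub W (T m x) (T n x)) < e" if "m \<ge> N" "n \<ge> N" for m n
      proof -
        have "nrm W (vsub W (T m x) (T n x)) \<le> e / (nrm V x + 1) * nrm V x"
          using diff[OF x, of m n] N that V.nrm_ge_0[OF x]
          by (smt (verit) mult_right_mono)
        also have "\<dots> < e / (nrm V x + 1) * (nrm V x + 1)"
          using e p by (intro mult_strict_left_mono) simp_all
        finally show ?thesis using p by simp
      qed
      then show "\<exists>N. \<forall>m\<ge>N. \<forall>n\<ge>N. nrm W (vsub W (T m x) (T n x)) < e" by blast
    qed
    then obtain L where L: "\<And>x. x \<in> carr V \<Longrightarrow> L x \<in> carr W"
        "\<And>x. x \<in> carr V \<Longrightarrow> W.tendsto_nrm (\<lambda>n. T n x) (L x)"
      by metis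
    define S where "S = restrict L (carr V)"
    have S: "S x \<in> carr W" "W.tendsto_nrm (\<lambda>n. T n x) (S x)" if "x \<in> carr V" for x
      using L that by (simp_all add: S_def)
    \<comment> \<open>Letting \<open>n\<close> grow in the Cauchy estimate gives a bound
      proportional to \<open>nrm V x\<close>. It yields both the boundedness of \<open>S\<close> and
      the convergence in operator norm.\<close>
    have near: "nrm W (vsub W (T m x) (S x)) \<le> e * nrm V x"
      if N: "\<forall>m\<ge>N. \<forall>n\<ge>N. nrm B (vsub B (T m) (T n)) < e" and "m \<ge> N" and x: "x \<in> carr V" for N m e x
    proof (rule W.tendsto_nrm_bound[OF S(2)[OF x] _ S(1)[OF x], of _ N])
      fix n assume "n \<ge> N"
      then have "nrm B (vsub B (T m) (T n)) \<le> e" using N \<open>m \<ge> N\<close> by (simp add: less_imp_le)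
      then show "nrm W (vsub W (T m x) (T n x)) \<le> e * nrm V x"
        using diff[OF x, of m n] V.nrm_ge_0[OF x] by (smt (verit) mult_right_mono)
    qed (use T x in simp_all)
    obtain N1 where N1: "\<forall>m\<ge>N1. \<forall>n\<ge>N1. nrm B (vsub B (T m) (T n)) < 1"
      using C[of 1] by auto
    have SB: "S \<in> carr B"
    proof (rule BI[where K = "nrm B (T N1) + 1"])
      fix x assume x: "x \<in> carr V"
      show "S x \<in> carr W" by (rule S(1)[OF x])
      have "nrm W (S x) \<le> nrm W (T N1 x) + nrm W (vsub W (S x) (T N1 x))"
        using W.nrm_le_sub[of "S x" "T N1 x"] S(1)[OF x] T x by simp
      also have "\<dots> \<le> nrm B (T N1) * nrm V x + 1 * nrm V x"
        using near[OF N1 order.refl x] nrm_B_apply[OF T x, of N1] W.nrm_sub_commute[of "S x" "T N1 x"] S(1)[OF x] T x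
        by simp
      finally show "nrm W (S x) \<le> (nrm B (T N1) + 1) * nrm V x"
        by (simp add: distrib_right)
      show "S (vscale V c x) = vscale W c (S x)" for c
      proof (rule W.tendsto_nrm_unique[OF S(2)])
        show "W.tendsto_nrm (\<lambda>n. T n (vscale V c x)) (vscale W c (S x))"
          using W.tendsto_nrm_scale[OF S(2)[OF x] _ S(1)[OF x], of c] T x by (simp add: B_scale[OF T])
      qed (use x S T in simp_all)
      fix y assume y: "y \<in> carr V"
      show "S (vadd V x y) = vadd W (S x) (S y)"
      proof (rule W.tendsto_nrm_unique[OF S(2)])
        show "W.tendsto_nrm (\<lambda>n. T n (vadd V x y)) (vadd W (S x) (S y))"
          using W.tendsto_nrm_add[OF S(2)[OF x] S(2)[OF y] _ _ S(1)[OF x] S(1)[OF y]] T x y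
          by (simp add: B_add[OF T])
      qed (use x y S T in simp_all)
    qed (simp add: S_def)
    moreover have "B.tendsto_nrm T S"
      unfolding B.tendsto_nrm_def lim_sequentially
    proof (intro allI impI)
      fix e :: real assume e: "e > 0"
      obtain N where N: "\<forall>m\<ge>N. \<forall>n\<ge>N. nrm B (vsub B (T m) (T n)) < e/2"
        using C[of "e/2"] e by auto
      have "nrm B (vsub B (T m) S) \<le> e/2" if "m \<ge> N" for m
        using near[OF N that] e by (intro nrm_B_le) simp_all
      then show "\<exists>N. \<forall>m\<ge>N. dist (nrm B (vsub B (T m) S)) 0 < e"
        using e T SB by (intro exI[of _ N]) (force simp: dist_real_def)
    qed
    ultimately show "\<exists>l\<in>carr B. B.tendsto_nrm T l" by blast
  qed
qed

end

section \<open>Duals\<close>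

definition cplx :: "complex cnormed" where
  "cplx = \<lparr>carr = UNIV, vadd = (+), vzero = 0, vscale = (*), nrm = cmod\<rparr>"

lemma cplx_sel [simp]: "carr cplx = UNIV" "vadd cplx = (+)" "vzero cplx = 0" "vscale cplx = (*)"
  "nrm cplx = cmod"
  by (simp_all add: cplx_def)

lemma vsub_cplx [simp]: "vsub cplx x y = x - y"
  by (simp add: vsub_def)

lemma banach_cplx: "banach cplx"
proof -
  interpret nspace cplx
  proof (intro nspace.intro cvs.intro nspace_axioms.intro)
    show "complex_vector_space cplx"
      unfolding complex_vector_space_def
      by (auto simp: algebra_simps intro: exI[of _ "- x" for x])
  qed (auto simp: norm_mult norm_triangle_ineq)
  show ?thesis
  proof
    fix x :: "nat \<Rightarrow> complex" assume "cauchy_nrm x"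
    then have "Cauchy x"
      by (simp add: cauchy_nrm_def Cauchy_def dist_norm)
    then obtain l where "x \<longlonglongrightarrow> l"
      using Cauchy_convergent convergent_def by blast
    then show "\<exists>l\<in>carr cplx. tendsto_nrm x l"
      by (auto simp: tendsto_nrm_def intro!: exI[of _ l] tendsto_norm_zero LIM_zero)
  qed
qed

lemma dual_eq_bl_maps: "dual V = bl_maps V cplx"
  by (simp add: dual_def bl_maps_def PiE_def Pi_def)

context nspace
begin

lemma pair_cplx: "nspace_pair V cplx"
proof -
  interpret C: banach cplx by (rule banach_cplx)
  show ?thesis by unfold_locales
qed

lemma dual_banach: "banach (dual V)"
  unfolding dual_eq_bl_maps by (rule nspace_pair.B_banach[OF pair_cplx banach_cplx])

lemma dual_app [simp]:
  "x \<in> carr V \<Longrightarrow> vadd (dual V) f g x = f x + g x"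
  "x \<in> carr V \<Longrightarrow> vzero (dual V) x = 0"
  "x \<in> carr V \<Longrightarrow> vscale (dual V) c f x = c * f x"
  "x \<in> carr V \<Longrightarrow> vsub (dual V) f g x = f x - g x"
  using nspace_pair.B_app[OF pair_cplx] by (simp_all add: dual_eq_bl_maps)

lemma
  assumes "f \<in> carr (dual V)"
  shows dual_add: "\<lbrakk>x \<in> carr V; y \<in> carr V\<rbrakk> \<Longrightarrow> f (x \<oplus> y) = f x + f y"
    and dual_scale: "x \<in> carr V \<Longrightarrow> f (c \<odot> x) = c * f x"
    and dual_sub: "\<lbrakk>x \<in> carr V; y \<in> carr V\<rbrakk> \<Longrightarrow> f (x \<ominus> y) = f x - f y"
    and dual_zero: "f \<zero> = 0"
    and dual_bound: "x \<in> carr V \<Longrightarrow> cmod (f x) \<le> nrm (dual V) f * nrm V x"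
    and dual_ge_0: "0 \<le> nrm (dual V) f"
  using nspace_pair.B_add[OF pair_cplx] nspace_pair.B_scale[OF pair_cplx] nspace_pair.B_sub[OF pair_cplx]
    nspace_pair.B_zero[OF pair_cplx] nspace_pair.nrm_B_apply[OF pair_cplx]
    nspace_pair.nrm_B_ge_0[OF pair_cplx] assms
  by (simp_all add: dual_eq_bl_maps)

lemma dualI:
  assumes "f \<in> extensional (carr V)"
    "\<And>x y. \<lbrakk>x \<in> carr V; y \<in> carr V\<rbrakk> \<Longrightarrow> f (x \<oplus> y) = f x + f y"
    "\<And>c x. x \<in> carr V \<Longrightarrow> f (c \<odot> x) = c * f x"
    "\<And>x. x \<in> carr V \<Longrightarrow> cmod (f x) \<le> K * nrm V x"
  shows "f \<in> carr (dual V)"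
  unfolding dual_eq_bl_maps
  by (rule nspace_pair.BI[OF pair_cplx, where K = K]) (use assms in simp_all)

lemma dual_eqI: "\<lbrakk>f \<in> carr (dual V); g \<in> carr (dual V); \<And>x. x \<in> carr V \<Longrightarrow> f x = g x\<rbrakk> \<Longrightarrow> f = g"
  unfolding dual_eq_bl_maps by (rule nspace_pair.B_eqI[OF pair_cplx])

lemma dual_nrm_le: "\<lbrakk>\<And>x. x \<in> carr V \<Longrightarrow> cmod (f x) \<le> K * nrm V x; K \<ge> 0\<rbrakk> \<Longrightarrow> nrm (dual V) f \<le> K"
  unfolding dual_eq_bl_maps by (rule nspace_pair.nrm_B_le[OF pair_cplx]) simp_all

lemma dual_tendsto:
  assumes "f \<in> carr (dual V)" "tendsto_nrm x l" "\<And>n. x n \<in> carr V" "l \<in> carr V"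
  shows "(\<lambda>n. f (x n)) \<longlonglongrightarrow> f l"
proof -
  have "(\<lambda>n. nrm (dual V) f * nrm V (x n \<ominus> l)) \<longlonglongrightarrow> 0"
    using tendsto_mult_left[OF assms(2)[unfolded tendsto_nrm_def], of "nrm (dual V) f"] by simp
  then have "(\<lambda>n. f (x n) - f l) \<longlonglongrightarrow> 0"
    by (rule Lim_null_comparison[rotated])
       (use assms dual_bound[of f "x n \<ominus> l" for n] in \<open>simp add: dual_sub\<close>)
  then show ?thesis by (rule LIM_zero_cancel)
qed

end

text \<open>The same space occurs in records with different extension fields, for instance with and
  without a product; agreement of the shared fields is the equality that can be stated.\<close>

lemma banach_cong:
  fixes V :: "('a, 'm) cnormed_scheme" and W :: "('a, 'n) cnormed_scheme"
  assumes V: "banach V" and eq: "carr W = carr V" "vadd W = vadd V" "vzero W = vzero V"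
    "vscale W = vscale V" "nrm W = nrm V"
  shows "banach W"
proof -
  interpret V: banach V by (rule V)
  have sub: "vsub W = vsub V"
    by (intro ext) (simp add: vsub_def eq)
  interpret W: nspace W
  proof (intro nspace.intro cvs.intro nspace_axioms.intro)
    show "complex_vector_space W"
      using V.cvs unfolding complex_vector_space_def eq .
  qed (simp_all add: eq V.nrm_scale V.nrm_triangle V.nrm_zeroD)
  show ?thesis
  proof
    fix x assume "W.cauchy_nrm x"
    then have "V.cauchy_nrm x"
      by (simp add: V.cauchy_nrm_def W.cauchy_nrm_def eq sub)
    then show "\<exists>l\<in>carr W. W.tendsto_nrm x l"
      using V.complete[of x] by (simp add: V.tendsto_nrm_def W.tendsto_nrm_def eq sub)
  qed
qed

section \<open>The bidual as a Banach algebra\<close>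

lemma bidual_sel [simp]:
  "carr (bidual A) = carr (dual (dual A))" "vadd (bidual A) = vadd (dual (dual A))"
  "vzero (bidual A) = vzero (dual (dual A))" "vscale (bidual A) = vscale (dual (dual A))"
  "nrm (bidual A) = nrm (dual (dual A))" "amult (bidual A) = arens A"
  by (simp_all add: bidual_def cnormed.defs cnalg.defs)

lemma vsub_bidual [simp]: "vsub (bidual A) = vsub (dual (dual A))"
  by (intro ext) (simp add: vsub_def)

text \<open>\<open>rmul\<close> and \<open>lact\<close> name the inner layers
  \<open>\<phi> a\<close> and \<open>G \<phi>\<close> of the Arens product. Each must be shown to be
  a bounded functional before the next layer can be applied to it.\<close>

definition rmul :: "('a, 'm) cnalg_scheme \<Rightarrow> ('a \<Rightarrow> complex) \<Rightarrow> 'a \<Rightarrow> 'a \<Rightarrow> complex" where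
  "rmul A \<phi> a = (\<lambda>b\<in>carr A. \<phi> (amult A a b))"

definition lact :: "('a, 'm) cnalg_scheme \<Rightarrow> (('a \<Rightarrow> complex) \<Rightarrow> complex) \<Rightarrow> ('a \<Rightarrow> complex) \<Rightarrow> 'a \<Rightarrow> complex" where
  "lact A G \<phi> = (\<lambda>a\<in>carr A. G (rmul A \<phi> a))"

definition emb :: "('a, 'm) cnormed_scheme \<Rightarrow> 'a \<Rightarrow> ('a \<Rightarrow> complex) \<Rightarrow> complex" where
  "emb V x = (\<lambda>\<phi>\<in>carr (dual V). \<phi> x)"

lemma rmul_app [simp]: "b \<in> carr A \<Longrightarrow> rmul A \<phi> a b = \<phi> (amult A a b)"
  by (simp add: rmul_def)

lemma lact_app [simp]: "a \<in> carr A \<Longrightarrow> lact A G \<phi> a = G (rmul A \<phi> a)"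
  by (simp add: lact_def)

lemma emb_app [simp]: "\<phi> \<in> carr (dual V) \<Longrightarrow> emb V x \<phi> = \<phi> x"
  by (simp add: emb_def)

lemma arens_app [simp]: "\<phi> \<in> carr (dual A) \<Longrightarrow> arens A F G \<phi> = F (lact A G \<phi>)"
  by (simp add: arens_def lact_def rmul_def)

context nspace
begin

lemma dual_nspace: "nspace (dual V)"
  by (rule banach.axioms(1)[OF dual_banach])

lemma bidual_banach: "banach (dual (dual V))"
  by (rule nspace.dual_banach[OF dual_nspace])

lemma bidual_nspace: "nspace (dual (dual V))"
  by (rule nspace.dual_nspace[OF dual_nspace])

lemma bidual_app [simp]:
  "\<phi> \<in> carr (dual V) \<Longrightarrow> vadd (dual (dual V)) F G \<phi> = F \<phi> + G \<phi>"
  "\<phi> \<in> carr (dual V) \<Longrightarrow> vzero (dual (dual V)) \<phi> = 0"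
  "\<phi> \<in> carr (dual V) \<Longrightarrow> vscale (dual (dual V)) c F \<phi> = c * F \<phi>"
  "\<phi> \<in> carr (dual V) \<Longrightarrow> vsub (dual (dual V)) F G \<phi> = F \<phi> - G \<phi>"
  using nspace.dual_app[OF dual_nspace] by simp_all

lemmas bidual_add = nspace.dual_add[OF dual_nspace]
  and bidual_scale = nspace.dual_scale[OF dual_nspace]
  and bidual_sub = nspace.dual_sub[OF dual_nspace]
  and bidual_zero = nspace.dual_zero[OF dual_nspace]
  and bidual_bound = nspace.dual_bound[OF dual_nspace]
  and bidual_ge_0 = nspace.dual_ge_0[OF dual_nspace]
  and bidualI = nspace.dualI[OF dual_nspace]
  and bidual_eqI = nspace.dual_eqI[OF dual_nspace]
  and bidual_nrm_le = nspace.dual_nrm_le[OF dual_nspace]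

lemmas dual_add_closed [simp] = cvs.add_closed[OF nspace.axioms(1)[OF dual_nspace]]
  and dual_scale_closed [simp] = cvs.scale_closed[OF nspace.axioms(1)[OF dual_nspace]]
  and dual_zero_closed [simp] = cvs.zero_closed[OF nspace.axioms(1)[OF dual_nspace]]
  and bidual_add_closed [simp] = cvs.add_closed[OF nspace.axioms(1)[OF bidual_nspace]]
  and bidual_scale_closed [simp] = cvs.scale_closed[OF nspace.axioms(1)[OF bidual_nspace]]
  and bidual_zero_closed [simp] = cvs.zero_closed[OF nspace.axioms(1)[OF bidual_nspace]]

lemma emb_closed [simp]:
  assumes "x \<in> carr V"
  shows "emb V x \<in> carr (dual (dual V))"
  by (rule bidualI[where K = "nrm V x"])
     (use assms dual_bound in \<open>simp_all add: emb_def mult.commute\<close>)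

text \<open>This is injectivity of \<open>emb\<close>. Operator algebras have it through vector
  functionals.\<close>

definition separated :: bool where
  "separated \<longleftrightarrow> (\<forall>x\<in>carr V. x \<noteq> \<zero> \<longrightarrow> (\<exists>\<phi>\<in>carr (dual V). \<phi> x \<noteq> 0))"

lemma emb_eq_zeroD:
  assumes "separated" "x \<in> carr V" "emb V x = vzero (dual (dual V))"
  shows "x = \<zero>"
proof (rule ccontr)
  assume "x \<noteq> \<zero>"
  then obtain \<phi> where "\<phi> \<in> carr (dual V)" "\<phi> x \<noteq> 0"
    using assms by (auto simp: separated_def)
  then show False
    using fun_cong[OF assms(3), of \<phi>] by simp
qed

end

context nalgebra
begin

lemma rmul_closed [simp]:
  assumes "\<phi> \<in> carr (dual V)" "a \<in> carr V"
  shows "rmul V \<phi> a \<in> carr (dual V)"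
proof (rule dualI[where K = "nrm (dual V) \<phi> * nrm V a"])
  fix b assume b: "b \<in> carr V"
  have "cmod (\<phi> (a \<otimes> b)) \<le> nrm (dual V) \<phi> * nrm V (a \<otimes> b)"
    using assms b by (intro dual_bound) simp_all
  also have "\<dots> \<le> nrm (dual V) \<phi> * (nrm V a * nrm V b)"
    using assms b by (intro mult_left_mono nrm_mult dual_ge_0)
  finally show "cmod (rmul V \<phi> a b) \<le> nrm (dual V) \<phi> * nrm V a * nrm V b"
    using b by (simp add: mult.assoc)
qed (use assms in \<open>simp_all add: rmul_def distrib_left dual_add dual_scale\<close>)

lemma rmul_nrm:
  assumes "\<phi> \<in> carr (dual V)" "a \<in> carr V"
  shows "nrm (dual V) (rmul V \<phi> a) \<le> nrm (dual V) \<phi> * nrm V a"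
proof (rule dual_nrm_le)
  fix b assume b: "b \<in> carr V"
  have "cmod (\<phi> (a \<otimes> b)) \<le> nrm (dual V) \<phi> * nrm V (a \<otimes> b)"
    using assms b by (intro dual_bound) simp_all
  also have "\<dots> \<le> nrm (dual V) \<phi> * (nrm V a * nrm V b)"
    using assms b by (intro mult_left_mono nrm_mult dual_ge_0)
  finally show "cmod (rmul V \<phi> a b) \<le> nrm (dual V) \<phi> * nrm V a * nrm V b"
    using b by (simp add: mult.assoc)
qed (use assms dual_ge_0 in simp)

lemma rmul_add_left:
  assumes "\<phi> \<in> carr (dual V)" "\<psi> \<in> carr (dual V)" "a \<in> carr V"
  shows "rmul V (vadd (dual V) \<phi> \<psi>) a = vadd (dual V) (rmul V \<phi> a) (rmul V \<psi> a)"
  by (rule dual_eqI) (use assms in simp_all)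

lemma rmul_scale_left:
  assumes "\<phi> \<in> carr (dual V)" "a \<in> carr V"
  shows "rmul V (vscale (dual V) c \<phi>) a = vscale (dual V) c (rmul V \<phi> a)"
  by (rule dual_eqI) (use assms in simp_all)

lemma rmul_add_right:
  assumes "\<phi> \<in> carr (dual V)" "a \<in> carr V" "b \<in> carr V"
  shows "rmul V \<phi> (a \<oplus> b) = vadd (dual V) (rmul V \<phi> a) (rmul V \<phi> b)"
  by (rule dual_eqI) (use assms in \<open>simp_all add: distrib_right dual_add\<close>)

lemma rmul_scale_right:
  assumes "\<phi> \<in> carr (dual V)" "a \<in> carr V"
  shows "rmul V \<phi> (c \<odot> a) = vscale (dual V) c (rmul V \<phi> a)"
  by (rule dual_eqI) (use assms in \<open>simp_all add: dual_scale\<close>)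

lemma lact_bound:
  assumes "G \<in> carr (dual (dual V))" "\<phi> \<in> carr (dual V)" "a \<in> carr V"
  shows "cmod (lact V G \<phi> a) \<le> nrm (dual (dual V)) G * nrm (dual V) \<phi> * nrm V a"
proof -
  have "cmod (G (rmul V \<phi> a)) \<le> nrm (dual (dual V)) G * nrm (dual V) (rmul V \<phi> a)"
    using assms by (intro bidual_bound) simp_all
  also have "\<dots> \<le> nrm (dual (dual V)) G * (nrm (dual V) \<phi> * nrm V a)"
    using assms by (intro mult_left_mono rmul_nrm bidual_ge_0)
  finally show ?thesis
    using assms by (simp add: mult.assoc)
qed

lemma lact_closed [simp]:
  assumes "G \<in> carr (dual (dual V))" "\<phi> \<in> carr (dual V)"
  shows "lact V G \<phi> \<in> carr (dual V)"
proof (rule dualI[where K = "nrm (dual (dual V)) G * nrm (dual V) \<phi>"])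
  show "lact V G \<phi> \<in> extensional (carr V)" by (simp add: lact_def)
qed (use assms in \<open>simp_all add: lact_bound rmul_add_right rmul_scale_right bidual_add bidual_scale del: lact_app,
      simp_all add: rmul_add_right rmul_scale_right bidual_add bidual_scale\<close>)

lemma lact_nrm:
  assumes "G \<in> carr (dual (dual V))" "\<phi> \<in> carr (dual V)"
  shows "nrm (dual V) (lact V G \<phi>) \<le> nrm (dual (dual V)) G * nrm (dual V) \<phi>"
  by (rule dual_nrm_le) (use assms lact_bound bidual_ge_0 dual_ge_0 in simp_all)

lemma lact_add_right:
  assumes "G \<in> carr (dual (dual V))" "\<phi> \<in> carr (dual V)" "\<psi> \<in> carr (dual V)"
  shows "lact V G (vadd (dual V) \<phi> \<psi>) = vadd (dual V) (lact V G \<phi>) (lact V G \<psi>)"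
  by (rule dual_eqI) (use assms in \<open>simp_all add: rmul_add_left bidual_add\<close>)

lemma lact_scale_right:
  assumes "G \<in> carr (dual (dual V))" "\<phi> \<in> carr (dual V)"
  shows "lact V G (vscale (dual V) c \<phi>) = vscale (dual V) c (lact V G \<phi>)"
  by (rule dual_eqI) (use assms in \<open>simp_all add: rmul_scale_left bidual_scale\<close>)

lemma lact_add_left:
  assumes "F \<in> carr (dual (dual V))" "G \<in> carr (dual (dual V))" "\<phi> \<in> carr (dual V)"
  shows "lact V (vadd (dual (dual V)) F G) \<phi> = vadd (dual V) (lact V F \<phi>) (lact V G \<phi>)"
  by (rule dual_eqI) (use assms in simp_all)

lemma lact_scale_left:
  assumes "G \<in> carr (dual (dual V))" "\<phi> \<in> carr (dual V)"
  shows "lact V (vscale (dual (dual V)) c G) \<phi> = vscale (dual V) c (lact V G \<phi>)"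
  by (rule dual_eqI) (use assms in simp_all)

lemma arens_bound:
  assumes "F \<in> carr (dual (dual V))" "G \<in> carr (dual (dual V))" "\<phi> \<in> carr (dual V)"
  shows "cmod (arens V F G \<phi>) \<le> nrm (dual (dual V)) F * nrm (dual (dual V)) G * nrm (dual V) \<phi>"
proof -
  have "cmod (F (lact V G \<phi>)) \<le> nrm (dual (dual V)) F * nrm (dual V) (lact V G \<phi>)"
    using assms by (intro bidual_bound) simp_all
  also have "\<dots> \<le> nrm (dual (dual V)) F * (nrm (dual (dual V)) G * nrm (dual V) \<phi>)"
    using assms by (intro mult_left_mono lact_nrm bidual_ge_0)
  finally show ?thesis
    using assms by (simp add: mult.assoc)
qed

lemma arens_closed [simp]:
  assumes "F \<in> carr (dual (dual V))" "G \<in> carr (dual (dual V))"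
  shows "arens V F G \<in> carr (dual (dual V))"
proof (rule bidualI[where K = "nrm (dual (dual V)) F * nrm (dual (dual V)) G"])
  show "arens V F G \<in> extensional (carr (dual V))" by (simp add: arens_def)
  show "cmod (arens V F G \<phi>) \<le> nrm (dual (dual V)) F * nrm (dual (dual V)) G * nrm (dual V) \<phi>"
    if "\<phi> \<in> carr (dual V)" for \<phi>
    using assms that by (rule arens_bound)
qed (use assms in \<open>simp_all add: lact_add_right lact_scale_right bidual_add bidual_scale\<close>)

lemma rmul_rmul:
  assumes "\<phi> \<in> carr (dual V)" "a \<in> carr V" "b \<in> carr V"
  shows "rmul V (rmul V \<phi> a) b = rmul V \<phi> (a \<otimes> b)"
  by (rule dual_eqI) (use assms in \<open>simp_all add: mult_assoc\<close>)

lemma rmul_lact: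
  assumes "G \<in> carr (dual (dual V))" "\<phi> \<in> carr (dual V)" "a \<in> carr V"
  shows "rmul V (lact V G \<phi>) a = lact V G (rmul V \<phi> a)"
  by (rule dual_eqI) (use assms in \<open>simp_all add: rmul_rmul\<close>)

text \<open>Associativity of the Arens product, read off in the dual: the bidual acts on the dual
  from the left because \<open>lact\<close> commutes with \<open>rmul\<close>.\<close>

lemma lact_lact:
  assumes "F \<in> carr (dual (dual V))" "G \<in> carr (dual (dual V))" "\<phi> \<in> carr (dual V)"
  shows "lact V F (lact V G \<phi>) = lact V (arens V F G) \<phi>"
  by (rule dual_eqI) (use assms in \<open>simp_all add: rmul_lact\<close>)

lemma bidual_algebra: "banach_algebra (bidual V)"
proof -
  interpret B: banach "bidual V"
    by (rule banach_cong[OF bidual_banach]) simp_all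
  show ?thesis
  proof
    fix F G H assume F: "F \<in> carr (bidual V)" and G: "G \<in> carr (bidual V)"
    show "amult (bidual V) F G \<in> carr (bidual V)"
      using F G by simp
    show "amult (bidual V) (vscale (bidual V) c F) G = vscale (bidual V) c (amult (bidual V) F G)" for c
      using F G by (intro bidual_eqI) simp_all
    show "amult (bidual V) F (vscale (bidual V) c G) = vscale (bidual V) c (amult (bidual V) F G)" for c
      using F G by (intro bidual_eqI) (simp_all add: lact_scale_left bidual_scale)
    show "nrm (bidual V) (amult (bidual V) F G) \<le> nrm (bidual V) F * nrm (bidual V) G"
      using F G arens_bound bidual_ge_0 by (simp add: bidual_nrm_le)
    assume H: "H \<in> carr (bidual V)"
    show "amult (bidual V) (amult (bidual V) F G) H = amult (bidual V) F (amult (bidual V) G H)"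
      using F G H by (intro bidual_eqI) (simp_all add: lact_lact)
    show "amult (bidual V) F (vadd (bidual V) G H) =
        vadd (bidual V) (amult (bidual V) F G) (amult (bidual V) F H)"
      using F G H by (intro bidual_eqI) (simp_all add: lact_add_left bidual_add)
    show "amult (bidual V) (vadd (bidual V) F G) H =
        vadd (bidual V) (amult (bidual V) F H) (amult (bidual V) G H)"
      using F G H by (intro bidual_eqI) simp_all
  qed
qed

lemma emb_mult:
  assumes "x \<in> carr V" "y \<in> carr V"
  shows "arens V (emb V x) (emb V y) = emb V (x \<otimes> y)"
  using assms by (intro bidual_eqI) simp_all

lemma pw_emb:
  assumes "x \<in> carr V"
  shows "nalgebra.pw (bidual V) (emb V x) n = emb V (pw x n)"
proof -
  interpret B: banach_algebra "bidual V" by (rule bidual_algebra)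
  show ?thesis
    using assms by (induction n) (simp_all add: emb_mult)
qed

end

section \<open>Operator algebras as Banach algebras\<close>

lemma (in banach_algebra) closed_subalgebra:
  assumes S: "subalgebra_of V S" and cl: "norm_closed V S"
  shows "banach_algebra (V\<lparr>carr := S\<rparr>)"
proof -
  have sub: "S \<subseteq> carr V" and z: "\<zero> \<in> S" and add: "\<And>x y. \<lbrakk>x \<in> S; y \<in> S\<rbrakk> \<Longrightarrow> x \<oplus> y \<in> S"
    and sc: "\<And>c x. x \<in> S \<Longrightarrow> c \<odot> x \<in> S" and mu: "\<And>x y. \<lbrakk>x \<in> S; y \<in> S\<rbrakk> \<Longrightarrow> x \<otimes> y \<in> S"
    using S unfolding subalgebra_of_def subspace_of_def by blast+
  have inV: "x \<in> S \<Longrightarrow> x \<in> carr V" for x using sub by blast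
  have vs: "vsub (V\<lparr>carr := S\<rparr>) = vsub V"
    by (intro ext) (simp add: vsub_def)
  interpret S: nspace "V\<lparr>carr := S\<rparr>"
  proof (intro nspace.intro cvs.intro nspace_axioms.intro)
    have neg: "\<exists>y\<in>S. x \<oplus> y = \<zero>" if "x \<in> S" for x
      using that inV sc[OF that, of "-1"] by (intro bexI[of _ "(-1) \<odot> x"]) simp_all
    show "complex_vector_space (V\<lparr>carr := S\<rparr>)"
      unfolding complex_vector_space_def
      by (intro conjI ballI allI)
         (simp_all add: z add sc neg inV add_ac scale_add_right scale_add_left)
  qed (simp_all add: inV nrm_scale nrm_triangle nrm_zeroD)
  show ?thesis
  proof
    fix x assume "S.cauchy_nrm x"
    then have x: "\<And>n. x n \<in> S" "cauchy_nrm x"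
      using inV by (simp_all add: S.cauchy_nrm_def cauchy_nrm_def vs)
    then obtain l where "l \<in> carr V" "tendsto_nrm x l"
      using complete by blast
    then show "\<exists>l\<in>carr (V\<lparr>carr := S\<rparr>). S.tendsto_nrm x l"
      using cl x(1) unfolding norm_closed_iff by (intro bexI[of _ l]) (simp_all add: S.tendsto_nrm_def tendsto_nrm_def vs, blast)
  qed (simp_all add: inV mu mult_assoc distrib_left distrib_right nrm_mult)
qed

section \<open>Inner product spaces and the Banach algebra of bounded operators\<close>

definition hnormed :: "('h, 'm) cinner_space_scheme \<Rightarrow> 'h cnormed" where
  "hnormed H = \<lparr>carr = carr H, vadd = vadd H, vzero = vzero H, vscale = vscale H, nrm = hnorm H\<rparr>"

lemma hnormed_sel [simp]: "carr (hnormed H) = carr H" "vadd (hnormed H) = vadd H"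
  "vzero (hnormed H) = vzero H" "vscale (hnormed H) = vscale H" "nrm (hnormed H) = hnorm H"
  by (simp_all add: hnormed_def)

lemma vsub_hnormed [simp]: "vsub (hnormed H) = vsub H"
  by (intro ext) (simp add: vsub_def)

locale inner_space = cvs V for V :: "('h, 'm) cinner_space_scheme" +
  assumes inner_add_left: "\<lbrakk>x \<in> carr V; y \<in> carr V; z \<in> carr V\<rbrakk> \<Longrightarrow>
      cinner V (vadd V x y) z = cinner V x z + cinner V y z"
    and inner_scale_left: "\<lbrakk>x \<in> carr V; y \<in> carr V\<rbrakk> \<Longrightarrow> cinner V (vscale V c x) y = c * cinner V x y"
    and inner_commute: "\<lbrakk>x \<in> carr V; y \<in> carr V\<rbrakk> \<Longrightarrow> cinner V y x = cnj (cinner V x y)"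
    and inner_ge_0: "x \<in> carr V \<Longrightarrow> 0 \<le> Re (cinner V x x)"
    and inner_zeroD: "\<lbrakk>x \<in> carr V; cinner V x x = 0\<rbrakk> \<Longrightarrow> x = vzero V"
begin

lemma inner_add_right: "\<lbrakk>x \<in> carr V; y \<in> carr V; z \<in> carr V\<rbrakk> \<Longrightarrow> cinner V z (x \<oplus> y) = cinner V z x + cinner V z y"
  by (metis add_closed complex_cnj_add inner_add_left inner_commute)

lemma inner_scale_right: "\<lbrakk>x \<in> carr V; y \<in> carr V\<rbrakk> \<Longrightarrow> cinner V y (c \<odot> x) = cnj c * cinner V y x"
  by (metis complex_cnj_mult inner_commute inner_scale_left scale_closed)

lemma inner_real: "x \<in> carr V \<Longrightarrow> cinner V x x = of_real ((hnorm V x)\<^sup>2)"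
  using inner_commute[of x x] inner_ge_0[of x] by (simp add: hnorm_def complex_eq_iff)

lemma hnorm_ge_0: "x \<in> carr V \<Longrightarrow> 0 \<le> hnorm V x"
  using inner_ge_0 by (simp add: hnorm_def)

lemma hnorm_add_sq:
  assumes "x \<in> carr V" "y \<in> carr V"
  shows "(hnorm V (x \<oplus> y))\<^sup>2 = (hnorm V x)\<^sup>2 + 2 * Re (cinner V x y) + (hnorm V y)\<^sup>2"
proof -
  have "cinner V (x \<oplus> y) (x \<oplus> y) = cinner V x x + cinner V x y + cinner V y x + cinner V y y"
    using assms by (simp add: inner_add_left inner_add_right)
  then have "Re (cinner V (x \<oplus> y) (x \<oplus> y)) = Re (cinner V x x) + 2 * Re (cinner V x y) + Re (cinner V y y)"
    using inner_commute[OF assms] by simp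
  then show ?thesis
    using assms by (simp add: inner_real)
qed

lemma hnorm_scale: "x \<in> carr V \<Longrightarrow> hnorm V (c \<odot> x) = cmod c * hnorm V x"
proof -
  assume x: "x \<in> carr V"
  have "cinner V (c \<odot> x) (c \<odot> x) = (c * cnj c) * cinner V x x"
    using x inner_scale_left[OF x scale_closed[OF x], of c c] inner_scale_right[OF x x, of c]
    by (simp only: mult.assoc)
  also have "\<dots> = of_real ((cmod c * hnorm V x)\<^sup>2)"
    by (simp only: inner_real[OF x] power_mult_distrib of_real_mult complex_norm_square)
  finally have "cinner V (c \<odot> x) (c \<odot> x) = of_real ((cmod c * hnorm V x)\<^sup>2)" .
  then have "(hnorm V (c \<odot> x))\<^sup>2 = (cmod c * hnorm V x)\<^sup>2"
    using x inner_real[of "c \<odot> x"] by (simp only: of_real_eq_iff scale_closed)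
  then show ?thesis
    using x hnorm_ge_0[of "c \<odot> x"] hnorm_ge_0[of x] by simp
qed

lemma cauchy_schwarz:
  assumes x: "x \<in> carr V" and y: "y \<in> carr V"
  shows "cmod (cinner V x y) \<le> hnorm V x * hnorm V y"
proof (cases "hnorm V y = 0")
  case True
  then have "y = \<zero>" using inner_real[OF y] inner_zeroD[OF y] by simp
  then show ?thesis
    using x True inner_scale_right[of \<zero> x 0] by simp
next
  case False
  let ?n = "(hnorm V y)\<^sup>2" and ?p = "cinner V x y"
  \<comment> \<open>This scalar makes \<open>x \<oplus> c \<odot> y\<close> orthogonal to
    \<open>y\<close>; its squared norm is then nonnegative, which is the claim.\<close>
  define c where "c = - ?p / of_real ?n"
  have n: "?n > 0" using False by simp
  have 1: "Re (cinner V x (c \<odot> y)) = - (cmod ?p)\<^sup>2 / ?n"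
  proof -
    have "cinner V x (c \<odot> y) = cnj c * ?p" using x y by (simp add: inner_scale_right)
    also have "\<dots> = - of_real ((cmod ?p)\<^sup>2) / of_real ?n"
      unfolding complex_norm_square by (simp add: c_def mult.commute)
    finally show ?thesis
      by (metis Re_complex_of_real of_real_divide of_real_minus)
  qed
  have 2: "(hnorm V (c \<odot> y))\<^sup>2 = (cmod ?p)\<^sup>2 / ?n"
  proof -
    have "cmod c = cmod ?p / ?n"
      by (simp only: c_def norm_divide norm_minus_cancel norm_of_real abs_power2)
    then have "(hnorm V (c \<odot> y))\<^sup>2 = (cmod ?p / ?n)\<^sup>2 * ?n"
      using y by (simp only: hnorm_scale power_mult_distrib)
    also have "\<dots> = (cmod ?p)\<^sup>2 / ?n"
    proof -
      have "(a / m)\<^sup>2 * m = a\<^sup>2 / m" for a m :: real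
        by (simp add: power2_eq_square)
      then show ?thesis .
    qed
    finally show ?thesis .
  qed
  have "0 \<le> (hnorm V (x \<oplus> c \<odot> y))\<^sup>2" by simp
  also have "\<dots> = (hnorm V x)\<^sup>2 - (cmod ?p)\<^sup>2 / ?n"
    using x y 1 2 by (simp add: hnorm_add_sq)
  finally have "(cmod ?p)\<^sup>2 \<le> (hnorm V x * hnorm V y)\<^sup>2"
    using n by (simp add: divide_le_eq power_mult_distrib)
  then show ?thesis
    by (rule power2_le_imp_le) (use hnorm_ge_0[OF x] hnorm_ge_0[OF y] in simp)
qed

lemma hnorm_triangle:
  assumes "x \<in> carr V" "y \<in> carr V"
  shows "hnorm V (x \<oplus> y) \<le> hnorm V x + hnorm V y"
proof -
  have "Re (cinner V x y) \<le> hnorm V x * hnorm V y"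
    using cauchy_schwarz[OF assms] complex_Re_le_cmod order_trans by blast
  then have "(hnorm V (x \<oplus> y))\<^sup>2 \<le> (hnorm V x + hnorm V y)\<^sup>2"
    using assms by (simp add: hnorm_add_sq power2_sum)
  then show ?thesis
    by (rule power2_le_imp_le) (use hnorm_ge_0 assms in simp)
qed

lemma hnormed_nspace: "nspace (hnormed V)"
proof (intro nspace.intro cvs.intro nspace_axioms.intro)
  show "complex_vector_space (hnormed V)"
    using cvs unfolding complex_vector_space_def hnormed_sel .
  show "x = vzero (hnormed V)" if "x \<in> carr (hnormed V)" "nrm (hnormed V) x = 0" for x
    using that inner_real[of x] inner_zeroD[of x] by simp
qed (simp_all add: hnorm_ge_0 hnorm_scale hnorm_triangle)

end

locale hilbert = inner_space V for V :: "('h, 'm) cinner_space_scheme" +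
  assumes hcomplete: "Metric_space.mcomplete (carr V) (norm_dist V (hnorm V))"
begin

lemma hnormed_banach: "banach (hnormed V)"
proof -
  interpret N: nspace "hnormed V" by (rule hnormed_nspace)
  have "norm_dist (hnormed V) (nrm (hnormed V)) = norm_dist V (hnorm V)"
    by (intro ext) (simp add: norm_dist_def)
  then show ?thesis
    using hcomplete N.mcomplete_iff by unfold_locales simp
qed

lemma pair: "nspace_pair (hnormed V) (hnormed V)"
  using banach.axioms(1)[OF hnormed_banach] by (simp add: nspace_pair_def)

lemma ops_sel:
  "carr (bounded_operators V) = carr (bl_maps (hnormed V) (hnormed V))"
  "vadd (bounded_operators V) = vadd (bl_maps (hnormed V) (hnormed V))"
  "vzero (bounded_operators V) = vzero (bl_maps (hnormed V) (hnormed V))"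
  "vscale (bounded_operators V) = vscale (bl_maps (hnormed V) (hnormed V))"
  "nrm (bounded_operators V) = nrm (bl_maps (hnormed V) (hnormed V))"
  "amult (bounded_operators V) = compose (carr V)"
  by (simp_all add: bounded_operators_def bl_maps_def fun_eq_iff)

lemma vsub_ops: "vsub (bounded_operators V) = vsub (bl_maps (hnormed V) (hnormed V))"
  by (intro ext) (simp add: vsub_def ops_sel)

lemma op_app [simp]:
  "x \<in> carr V \<Longrightarrow> vadd (bounded_operators V) S T x = S x \<oplus> T x"
  "x \<in> carr V \<Longrightarrow> vzero (bounded_operators V) x = \<zero>"
  "x \<in> carr V \<Longrightarrow> vscale (bounded_operators V) c T x = c \<odot> T x"
  "x \<in> carr V \<Longrightarrow> vsub (bounded_operators V) S T x = S x \<ominus> T x"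
  "x \<in> carr V \<Longrightarrow> amult (bounded_operators V) S T x = S (T x)"
  using nspace_pair.B_app[OF pair] by (simp_all add: ops_sel vsub_ops compose_eq)

lemma
  assumes "T \<in> carr (bounded_operators V)"
  shows op_closed [simp]: "x \<in> carr V \<Longrightarrow> T x \<in> carr V"
    and op_add: "\<lbrakk>x \<in> carr V; y \<in> carr V\<rbrakk> \<Longrightarrow> T (x \<oplus> y) = T x \<oplus> T y"
    and op_scale: "x \<in> carr V \<Longrightarrow> T (c \<odot> x) = c \<odot> T x"
    and op_bound: "x \<in> carr V \<Longrightarrow> hnorm V (T x) \<le> nrm (bounded_operators V) T * hnorm V x"
    and op_ge_0: "0 \<le> nrm (bounded_operators V) T"
proof -
  have T: "T \<in> carr (bl_maps (hnormed V) (hnormed V))"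
    using assms by (simp only: ops_sel)
  show "x \<in> carr V \<Longrightarrow> T x \<in> carr V"
    using nspace_pair.B_closed[OF pair T, of x] by simp
  show "\<lbrakk>x \<in> carr V; y \<in> carr V\<rbrakk> \<Longrightarrow> T (x \<oplus> y) = T x \<oplus> T y"
    using nspace_pair.B_add[OF pair T, of x y] by simp
  show "x \<in> carr V \<Longrightarrow> T (c \<odot> x) = c \<odot> T x"
    using nspace_pair.B_scale[OF pair T, of x c] by simp
  show "x \<in> carr V \<Longrightarrow> hnorm V (T x) \<le> nrm (bounded_operators V) T * hnorm V x"
    using nspace_pair.nrm_B_apply[OF pair T, of x] by (simp add: ops_sel)
  show "0 \<le> nrm (bounded_operators V) T"
    using nspace_pair.nrm_B_ge_0[OF pair T] by (simp only: ops_sel)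
qed

lemma opI:
  assumes "T \<in> extensional (carr V)" "\<And>x. x \<in> carr V \<Longrightarrow> T x \<in> carr V"
    "\<And>x y. \<lbrakk>x \<in> carr V; y \<in> carr V\<rbrakk> \<Longrightarrow> T (x \<oplus> y) = T x \<oplus> T y"
    "\<And>c x. x \<in> carr V \<Longrightarrow> T (c \<odot> x) = c \<odot> T x"
    "\<And>x. x \<in> carr V \<Longrightarrow> hnorm V (T x) \<le> K * hnorm V x"
  shows "T \<in> carr (bounded_operators V)"
  unfolding ops_sel by (rule nspace_pair.BI[OF pair, where K = K]) (use assms in simp_all)

lemma op_eqI:
  assumes "S \<in> carr (bounded_operators V)" "T \<in> carr (bounded_operators V)"
    "\<And>x. x \<in> carr V \<Longrightarrow> S x = T x"
  shows "S = T"
  by (rule nspace_pair.B_eqI[OF pair]) (use assms in \<open>simp_all add: ops_sel\<close>)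

lemma op_nrm_le:
  assumes "\<And>x. x \<in> carr V \<Longrightarrow> hnorm V (T x) \<le> K * hnorm V x" "K \<ge> 0"
  shows "nrm (bounded_operators V) T \<le> K"
  unfolding ops_sel by (rule nspace_pair.nrm_B_le[OF pair]) (use assms in simp_all)

lemma ops_algebra: "banach_algebra (bounded_operators V)"
proof -
  let ?B = "bounded_operators V"
  interpret B: banach ?B
    by (rule banach_cong[OF nspace_pair.B_banach[OF pair hnormed_banach]]) (simp_all add: ops_sel)
  have bd: "hnorm V (S (T x)) \<le> nrm ?B S * nrm ?B T * hnorm V x"
    if "S \<in> carr ?B" "T \<in> carr ?B" "x \<in> carr V" for S T x
  proof -
    have "hnorm V (S (T x)) \<le> nrm ?B S * hnorm V (T x)"
      using that by (intro op_bound) simp_all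
    also have "\<dots> \<le> nrm ?B S * (nrm ?B T * hnorm V x)"
      using that by (intro mult_left_mono op_bound op_ge_0)
    finally show ?thesis by (simp add: mult.assoc)
  qed
  have cl: "amult ?B S T \<in> carr ?B" if "S \<in> carr ?B" "T \<in> carr ?B" for S T
    by (rule opI[where K = "nrm ?B S * nrm ?B T"])
       (use that in \<open>simp_all add: op_add op_scale bd\<close>, simp add: ops_sel(6) compose_def)
  show ?thesis
  proof
    fix R S T assume R: "R \<in> carr ?B" and S: "S \<in> carr ?B"
    show "amult ?B R S \<in> carr ?B" using R S by (rule cl)
    show "amult ?B (vscale ?B c R) S = vscale ?B c (amult ?B R S)" for c
      using R S by (intro op_eqI) (simp_all add: cl)
    show "amult ?B R (vscale ?B c S) = vscale ?B c (amult ?B R S)" for c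
      using R S by (intro op_eqI) (simp_all add: cl op_scale)
    show "nrm ?B (amult ?B R S) \<le> nrm ?B R * nrm ?B S"
      using R S by (intro op_nrm_le) (simp_all add: bd op_ge_0)
    assume T: "T \<in> carr ?B"
    show "amult ?B (amult ?B R S) T = amult ?B R (amult ?B S T)"
      using R S T by (intro op_eqI) (simp_all add: cl)
    show "amult ?B R (vadd ?B S T) = vadd ?B (amult ?B R S) (amult ?B R T)"
      using R S T by (intro op_eqI) (simp_all add: cl op_add)
    show "amult ?B (vadd ?B R S) T = vadd ?B (amult ?B R T) (amult ?B S T)"
      using R S T by (intro op_eqI) (simp_all add: cl)
  qed
qed

text \<open>If \<open>T x\<close> is nonzero, the vector functional that pairs the image of
  \<open>x\<close> with \<open>y = T x\<close> takes the value \<open>cinner V y y\<close> at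
  \<open>T\<close>, which is nonzero. Cauchy--Schwarz bounds it.\<close>

lemma subalgebra_separated:
  assumes S: "subalgebra_of (bounded_operators V) S" and cl: "norm_closed (bounded_operators V) S"
  shows "nspace.separated ((bounded_operators V)\<lparr>carr := S\<rparr>)"
proof -
  let ?B = "bounded_operators V" and ?A = "(bounded_operators V)\<lparr>carr := S\<rparr>"
  interpret B: banach_algebra ?B by (rule ops_algebra)
  interpret A: banach_algebra ?A using S cl by (rule B.closed_subalgebra)
  have sub: "T \<in> S \<Longrightarrow> T \<in> carr ?B" for T
    using S unfolding subalgebra_of_def subspace_of_def by blast
  show ?thesis
    unfolding A.separated_def
  proof (intro ballI impI)
    fix T assume T: "T \<in> carr ?A" and nz: "T \<noteq> vzero ?A"
    have "\<exists>x\<in>carr V. T x \<noteq> \<zero>"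
    proof (rule ccontr)
      assume "\<not> (\<exists>x\<in>carr V. T x \<noteq> \<zero>)"
      then have "T = vzero ?B"
        using T sub by (intro op_eqI) simp_all
      then show False using nz by simp
    qed
    then obtain x where x: "x \<in> carr V" "T x \<noteq> \<zero>" by blast
    define y where "y = T x"
    have y: "y \<in> carr V" using T x sub by (simp add: y_def)
    define \<phi> where "\<phi> = (\<lambda>S'\<in>S. cinner V (S' x) y)"
    have "\<phi> \<in> carr (dual ?A)"
    proof (rule A.dualI[where K = "hnorm V x * hnorm V y"])
      fix R assume R: "R \<in> carr ?A"
      then have "cmod (cinner V (R x) y) \<le> hnorm V (R x) * hnorm V y"
        using x y sub by (intro cauchy_schwarz) simp_all
      also have "\<dots> \<le> nrm ?B R * hnorm V x * hnorm V y"
        using R x y sub by (intro mult_right_mono op_bound hnorm_ge_0) simp_all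
      finally show "cmod (\<phi> R) \<le> hnorm V x * hnorm V y * nrm ?A R"
        using R by (simp add: \<phi>_def mult_ac)
      show "\<phi> (vscale ?A c R) = c * \<phi> R" for c
        using A.scale_closed[OF R, of c] R sub[of R] x y by (simp add: \<phi>_def inner_scale_left)
      fix R' assume R': "R' \<in> carr ?A"
      show "\<phi> (vadd ?A R R') = \<phi> R + \<phi> R'"
        using A.add_closed[OF R R'] R R' sub[of R] sub[of R'] x y by (simp add: \<phi>_def inner_add_left)
    qed (simp add: \<phi>_def)
    moreover have "\<phi> T \<noteq> 0"
      using T x y inner_zeroD[of y] by (auto simp: \<phi>_def y_def)
    ultimately show "\<exists>\<phi>\<in>carr (dual ?A). \<phi> T \<noteq> 0" by blast
  qed
qed

end

lemma hilbert_iff: "complex_hilbert_space H \<longleftrightarrow> hilbert H"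
  unfolding complex_hilbert_space_def hilbert_def inner_space_def cvs_def inner_space_axioms_def
    hilbert_axioms_def by blast

lemma operator_algebra_banach:
  fixes A :: "('h \<Rightarrow> 'h) cnalg"
  assumes "operator_algebra A"
  shows "banach_algebra A" "nspace.separated A"
proof -
  obtain H :: "'h cinner_space" and S where H: "complex_hilbert_space H" and S: "subalgebra_of (bounded_operators H) S"
    "norm_closed (bounded_operators H) S" and A: "A = (bounded_operators H)\<lparr>carr := S\<rparr>"
    using assms unfolding operator_algebra_def by blast
  interpret hilbert H using H by (simp only: hilbert_iff)
  show "banach_algebra A" "nspace.separated A"
    using banach_algebra.closed_subalgebra[OF ops_algebra S] subalgebra_separated[OF S]
    unfolding A by blast+
qed

section \<open>Modular left ideals and the radical\<close>

context nalgebra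
begin

lemma
  assumes "left_ideal V L"
  shows ideal_sub: "x \<in> L \<Longrightarrow> x \<in> carr V"
    and ideal_zero: "\<zero> \<in> L"
    and ideal_add: "\<lbrakk>x \<in> L; y \<in> L\<rbrakk> \<Longrightarrow> x \<oplus> y \<in> L"
    and ideal_scale: "x \<in> L \<Longrightarrow> c \<odot> x \<in> L"
    and ideal_mult: "\<lbrakk>a \<in> carr V; x \<in> L\<rbrakk> \<Longrightarrow> a \<otimes> x \<in> L"
  using assms unfolding left_ideal_def subspace_of_def by blast+

lemma left_idealI:
  assumes "\<And>x. x \<in> L \<Longrightarrow> x \<in> carr V" "\<zero> \<in> L" "\<And>x y. \<lbrakk>x \<in> L; y \<in> L\<rbrakk> \<Longrightarrow> x \<oplus> y \<in> L"
    "\<And>c x. x \<in> L \<Longrightarrow> c \<odot> x \<in> L" "\<And>a x. \<lbrakk>a \<in> carr V; x \<in> L\<rbrakk> \<Longrightarrow> a \<otimes> x \<in> L"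
  shows "left_ideal V L"
  using assms unfolding left_ideal_def subspace_of_def by blast

text \<open>Every \<open>a\<close> is
  \<open>(a \<ominus> a \<otimes> e) \<oplus> a \<otimes> e\<close>. So properness of a modular left
  ideal amounts to missing the single element \<open>e\<close>, a condition that survives unions of
  chains.\<close>

lemma modular_unit_whole:
  assumes "left_ideal V L" "e \<in> L" "\<And>a. a \<in> carr V \<Longrightarrow> a \<ominus> a \<otimes> e \<in> L"
  shows "L = carr V"
proof
  show "carr V \<subseteq> L"
  proof
    fix a assume a: "a \<in> carr V"
    have "(a \<ominus> a \<otimes> e) \<oplus> a \<otimes> e \<in> L"
      using assms a by (intro ideal_add ideal_mult) auto
    then show "a \<in> L"
      using a ideal_sub[OF assms(1,2)] by simp
  qed
qed (use assms ideal_sub in blast)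

lemma maximalI:
  assumes "left_ideal V M" "e \<in> carr V" "\<And>a. a \<in> carr V \<Longrightarrow> a \<ominus> a \<otimes> e \<in> M" "e \<notin> M"
    "\<And>X. \<lbrakk>left_ideal V X; M \<subseteq> X\<rbrakk> \<Longrightarrow> X = M \<or> X = carr V"
  shows "maximal_modular_left_ideal V M"
  unfolding maximal_modular_left_ideal_def modular_left_ideal_def
proof (intro conjI allI impI bexI[of _ e] ballI)
  show "M \<noteq> carr V" using assms(2,4) by metis
  show "X = M \<or> X = carr V" if "left_ideal V X \<and> M \<subseteq> X" for X
    using that by (intro assms(5)) simp_all
qed (fact assms)+

lemma ex_maximal_modular:
  assumes L: "left_ideal V L" and e: "e \<in> carr V" "\<And>a. a \<in> carr V \<Longrightarrow> a \<ominus> a \<otimes> e \<in> L" "e \<notin> L"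
  obtains M where "maximal_modular_left_ideal V M" "L \<subseteq> M" "e \<notin> M"
proof -
  let ?F = "{M. left_ideal V M \<and> L \<subseteq> M \<and> e \<notin> M}"
  have "\<exists>M\<in>?F. \<forall>X\<in>?F. M \<subseteq> X \<longrightarrow> X = M"
  proof (rule subset_Zorn_nonempty)
    show "?F \<noteq> {}" using L e by blast
    fix C assume ne: "C \<noteq> {}" and C: "subset.chain ?F C"
    have CF: "\<And>M. M \<in> C \<Longrightarrow> left_ideal V M \<and> L \<subseteq> M \<and> e \<notin> M"
      using C by (auto simp: subset.chain_def)
    have "left_ideal V (\<Union>C)"
    proof (rule left_idealI)
      show "\<zero> \<in> \<Union>C" using ne CF ideal_zero by blast
      show "x \<oplus> y \<in> \<Union>C" if xy: "x \<in> \<Union>C" "y \<in> \<Union>C" for x y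
      proof -
        obtain X Y where "X \<in> C" "x \<in> X" "Y \<in> C" "y \<in> Y" using xy by blast
        moreover have "X \<subseteq> Y \<or> Y \<subseteq> X"
          using C \<open>X \<in> C\<close> \<open>Y \<in> C\<close> unfolding subset.chain_def by blast
        ultimately show ?thesis using CF ideal_add by blast
      qed
    qed (use CF ideal_sub ideal_scale ideal_mult in blast)+
    then show "\<Union>C \<in> ?F" using ne CF by blast
  qed
  then obtain M where MF: "M \<in> ?F" and mx0: "\<forall>X\<in>?F. M \<subseteq> X \<longrightarrow> X = M"
    by (elim bexE)
  have M: "left_ideal V M" "L \<subseteq> M" "e \<notin> M" using MF by simp_all
  have mx: "X = M" if "left_ideal V X" "e \<notin> X" "M \<subseteq> X" for X
  proof -
    have "X \<in> ?F" using that M(2) by simp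
    then show ?thesis using bspec[OF mx0] that(3) by blast
  qed
  \<comment> \<open>\<open>M\<close> is maximal only among ideals that miss \<open>e\<close>; a
    larger ideal containing \<open>e\<close> is the whole algebra, so \<open>M\<close> is maximal
    outright.\<close>
  have alt: "X = M \<or> X = carr V" if "left_ideal V X" "M \<subseteq> X" for X
  proof (cases "e \<in> X")
    case True
    then have "X = carr V"
      using that e(2) M(2) by (intro modular_unit_whole[of X e]) auto
    then show ?thesis ..
  next
    case False
    show ?thesis using mx[OF that(1) False that(2)] by simp
  qed
  have "maximal_modular_left_ideal V M"
  proof (rule maximalI[OF M(1) e(1) _ M(3) alt])
    show "a \<ominus> a \<otimes> e \<in> M" if "a \<in> carr V" for a
      using e(2)[OF that] M(2) by (rule rev_subsetD)
  qed
  then show thesis by (rule that[OF _ M(2,3)])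
qed

lemma maximal_unit:
  assumes "maximal_modular_left_ideal V L"
  obtains e where "e \<in> carr V" "\<And>a. a \<in> carr V \<Longrightarrow> a \<ominus> a \<otimes> e \<in> L" "e \<notin> L"
proof -
  have m: "modular_left_ideal V L" and ne: "L \<noteq> carr V"
    using assms unfolding maximal_modular_left_ideal_def by simp_all
  then obtain e where e: "e \<in> carr V" "\<And>a. a \<in> carr V \<Longrightarrow> a \<ominus> a \<otimes> e \<in> L" and L: "left_ideal V L"
    unfolding modular_left_ideal_def by blast
  have "e \<notin> L" using modular_unit_whole[OF L _ e(2)] ne by blast
  then show thesis using that[of e] e by blast
qed

lemma maximal_ideal: "maximal_modular_left_ideal V L \<Longrightarrow> left_ideal V L"
  unfolding maximal_modular_left_ideal_def modular_left_ideal_def by simp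

text \<open>\<open>?P\<close> is the left ideal generated by \<open>L\<close> and \<open>x\<close>.
  The scalar multiples of \<open>x\<close> appear separately because there may be no unit.\<close>

lemma maximal_decomp:
  assumes L: "maximal_modular_left_ideal V L" and x: "x \<in> carr V" "x \<notin> L" and z: "z \<in> carr V"
  obtains l a c where "l \<in> L" "a \<in> carr V" "z = l \<oplus> (a \<otimes> x \<oplus> c \<odot> x)"
proof -
  let ?P = "{l \<oplus> (a \<otimes> x \<oplus> c \<odot> x) | l a c. l \<in> L \<and> a \<in> carr V}"
  have Li: "left_ideal V L" by (rule maximal_ideal[OF L])
  note sub = ideal_sub[OF Li]
  have in_P: "y \<in> ?P" if "y = l \<oplus> (a \<otimes> x \<oplus> c \<odot> x)" "l \<in> L" "a \<in> carr V" for y l a c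
    using that by blast
  have P: "left_ideal V ?P"
  proof (rule left_idealI)
    show "\<zero> \<in> ?P"
      by (rule in_P[of _ \<zero> \<zero> 0]) (use x Li ideal_zero in simp_all)
  next
    fix y assume "y \<in> ?P"
    then obtain l a c where y: "y = l \<oplus> (a \<otimes> x \<oplus> c \<odot> x)" "l \<in> L" "a \<in> carr V" by blast
    show "y \<in> carr V" using y x sub by simp
    show "d \<odot> y \<in> ?P" for d
      by (rule in_P[of _ "d \<odot> l" "d \<odot> a" "d * c"])
         (use y x sub ideal_scale[OF Li] in \<open>simp_all add: scale_add_right\<close>)
    show "b \<otimes> y \<in> ?P" if "b \<in> carr V" for b
      by (rule in_P[of _ "b \<otimes> l" "b \<otimes> a \<oplus> c \<odot> b" 0])
         (use y x that sub ideal_mult[OF Li] in \<open>simp_all add: distrib_left distrib_right mult_assoc\<close>)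
    fix y' assume "y' \<in> ?P"
    then obtain l' a' c' where y': "y' = l' \<oplus> (a' \<otimes> x \<oplus> c' \<odot> x)" "l' \<in> L" "a' \<in> carr V" by blast
    show "y \<oplus> y' \<in> ?P"
      by (rule in_P[of _ "l \<oplus> l'" "a \<oplus> a'" "c + c'"])
         (use y y' x sub ideal_add[OF Li] in \<open>simp_all add: distrib_right scale_add_left add_ac\<close>)
  qed
  have "L \<subseteq> ?P"
  proof
    fix l assume "l \<in> L"
    then show "l \<in> ?P" by (intro in_P[of _ l \<zero> 0]) (use x sub in simp_all)
  qed
  moreover have "x \<in> ?P"
    by (rule in_P[of _ \<zero> \<zero> 1]) (use x Li ideal_zero in simp_all)
  ultimately have "?P = carr V"
    using L P x unfolding maximal_modular_left_ideal_def by blast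
  then have "z \<in> ?P" using z by simp
  then show thesis using that by blast
qed

text \<open>The elements \<open>a \<ominus> a \<otimes> x\<close> form a left ideal with modular
  unit \<open>x\<close>. If it misses \<open>x\<close>, it lies in a maximal modular left ideal that
  misses \<open>x\<close>, against \<open>x\<close> being in the radical.\<close>

lemma jacobson_quasi_inverse:
  assumes "x \<in> jacobson_radical V"
  shows "\<exists>a\<in>carr V. a \<ominus> a \<otimes> x = x"
proof (rule ccontr)
  assume no: "\<not> ?thesis"
  let ?L = "{a \<ominus> a \<otimes> x | a. a \<in> carr V}"
  have x: "x \<in> carr V" using assms by (simp add: jacobson_radical_def)
  have in_L: "y \<in> ?L" if "y = a \<ominus> a \<otimes> x" "a \<in> carr V" for y a using that by blast
  have "left_ideal V ?L"
  proof (rule left_idealI)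
    show "\<zero> \<in> ?L" by (rule in_L[of _ \<zero>]) (use x in simp_all)
  next
    fix y assume "y \<in> ?L"
    then obtain a where a: "y = a \<ominus> a \<otimes> x" "a \<in> carr V" by blast
    show "y \<in> carr V" using a x by simp
    show "c \<odot> y \<in> ?L" for c by (rule in_L[of _ "c \<odot> a"]) (use a x in \<open>simp_all add: scale_sub_right\<close>)
    show "b \<otimes> y \<in> ?L" if "b \<in> carr V" for b
      by (rule in_L[of _ "b \<otimes> a"]) (use a x that in \<open>simp_all add: mult_sub_right mult_assoc\<close>)
    fix y' assume "y' \<in> ?L"
    then obtain a' where a': "y' = a' \<ominus> a' \<otimes> x" "a' \<in> carr V" by blast
    show "y \<oplus> y' \<in> ?L"
      by (rule in_L[of _ "a \<oplus> a'"]) (use a a' x in \<open>simp_all add: distrib_right sub_add_sub\<close>)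
  qed
  moreover have "x \<notin> ?L" using no by clarify metis
  ultimately obtain M where "maximal_modular_left_ideal V M" "x \<notin> M"
    using x by (elim ex_maximal_modular[of ?L x]) blast+
  then show False using assms by (simp add: jacobson_radical_def)
qed

text \<open>A square-zero ideal lies in every maximal modular \<open>L\<close>: otherwise
  \<open>e = l \<oplus> u\<close> with \<open>u\<close> in the ideal, and
  \<open>u \<otimes> u = \<zero>\<close> gives \<open>u \<otimes> e = u \<otimes> l\<close>, which
  is in \<open>L\<close>. Then \<open>u\<close> is in \<open>L\<close>, and so is
  \<open>e\<close>.\<close>

lemma semisimple_imp_semiprime:
  assumes "semisimple V"
  shows "semiprime V"
  unfolding semiprime_def
proof (intro allI impI, elim conjE)
  fix J assume J: "two_sided_ideal V J" and sq: "{x \<otimes> y |x y. x \<in> J \<and> y \<in> J} = {\<zero>}"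
  have Ji: "left_ideal V J" and Jr: "\<And>a x. \<lbrakk>a \<in> carr V; x \<in> J\<rbrakk> \<Longrightarrow> x \<otimes> a \<in> J"
    using J unfolding two_sided_ideal_def by blast+
  have "x \<in> jacobson_radical V" if x: "x \<in> J" for x
    unfolding jacobson_radical_def
  proof (intro CollectI conjI allI impI)
    show xV: "x \<in> carr V" using ideal_sub[OF Ji x] .
    fix L assume L: "maximal_modular_left_ideal V L"
    have Li: "left_ideal V L" by (rule maximal_ideal[OF L])
    obtain e where e: "e \<in> carr V" "\<And>a. a \<in> carr V \<Longrightarrow> a \<ominus> a \<otimes> e \<in> L" "e \<notin> L"
      using L by (rule maximal_unit) blast
    show "x \<in> L"
    proof (rule ccontr)
      assume "x \<notin> L"
      then obtain l a c where d: "l \<in> L" "a \<in> carr V" "e = l \<oplus> (a \<otimes> x \<oplus> c \<odot> x)"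
        using L xV e(1) by (elim maximal_decomp)
      define u where "u = a \<otimes> x \<oplus> c \<odot> x"
      have u: "u \<in> J" unfolding u_def using d x by (intro ideal_add[OF Ji] ideal_mult[OF Ji] ideal_scale[OF Ji])
      have uV: "u \<in> carr V" using ideal_sub[OF Ji u] .
      have lV: "l \<in> carr V" using ideal_sub[OF Li d(1)] .
      have "u \<otimes> u \<in> {x \<otimes> y |x y. x \<in> J \<and> y \<in> J}" using u by blast
      then have uu: "u \<otimes> u = \<zero>" using sq by simp
      have "u \<otimes> e = u \<otimes> l"
        using d(3) uV lV uu by (simp add: distrib_left flip: u_def)
      then have "u \<otimes> e \<in> L" using ideal_mult[OF Li uV d(1)] by simp
      then have "(u \<ominus> u \<otimes> e) \<oplus> u \<otimes> e \<in> L" using e(2)[OF uV] by (intro ideal_add[OF Li])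
      then have "u \<in> L" using uV e by simp
      then show False using ideal_add[OF Li d(1)] d(3) e(3) by (simp flip: u_def)
    qed
  qed
  then show "J = {\<zero>}"
    using assms ideal_zero[OF Ji] unfolding semisimple_def by blast
qed

text \<open>The kernel of a character has codimension one: any element outside it, suitably scaled,
  differs from \<open>e\<close> by an element of the kernel.\<close>

lemma kernel_maximal:
  assumes add: "\<And>x y. \<lbrakk>x \<in> carr V; y \<in> carr V\<rbrakk> \<Longrightarrow> \<omega> (x \<oplus> y) = \<omega> x + \<omega> y"
    and sc: "\<And>c x. x \<in> carr V \<Longrightarrow> \<omega> (c \<odot> x) = c * \<omega> x"
    and mu: "\<And>x y. \<lbrakk>x \<in> carr V; y \<in> carr V\<rbrakk> \<Longrightarrow> \<omega> (x \<otimes> y) = \<omega> x * \<omega> y"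
    and e: "e \<in> carr V" "\<omega> e = (1::complex)"
  shows "maximal_modular_left_ideal V {x \<in> carr V. \<omega> x = 0}" (is "maximal_modular_left_ideal V ?K")
proof -
  have K: "left_ideal V ?K"
    by (rule left_idealI) (use add sc mu sc[of \<zero> 0] in simp_all)
  have mod: "a \<ominus> a \<otimes> e \<in> ?K" if "a \<in> carr V" for a
    using that e by (simp add: vsub_def add sc mu)
  have alt: "L = ?K \<or> L = carr V" if L: "left_ideal V L" "?K \<subseteq> L" for L
  proof (rule disjCI)
    assume "L \<noteq> carr V"
    show "L = ?K"
    proof (rule ccontr)
      assume "L \<noteq> ?K"
      then obtain x where x: "x \<in> L" "\<omega> x \<noteq> 0" using L ideal_sub[OF L(1)] by blast
      have xV: "x \<in> carr V" using ideal_sub[OF L(1) x(1)] .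
      have "e \<ominus> (1 / \<omega> x) \<odot> x \<in> ?K"
        using xV x e by (simp add: vsub_def add sc)
      then have "(e \<ominus> (1 / \<omega> x) \<odot> x) \<oplus> (1 / \<omega> x) \<odot> x \<in> L"
        using L x by (intro ideal_add[OF L(1)] ideal_scale[OF L(1)]) auto
      then have "e \<in> L" using e xV by simp
      then have "L = carr V" using mod L by (intro modular_unit_whole[of L e]) auto
      then show False using \<open>L \<noteq> carr V\<close> by simp
    qed
  qed
  show ?thesis
    by (rule maximalI[OF K e(1) mod _ alt]) (simp_all add: e)
qed

end

section \<open>Consequences of completeness: Neumann series, closed maximal ideals, quasinilpotent
  elements\<close>

lemma (in banach) geometric_convergent:
  assumes x: "\<And>n. x n \<in> carr V" and le: "\<And>n. nrm V (x (Suc n) \<ominus> x n) \<le> C * r ^ n" and r: "0 \<le> r" "r < 1"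
  shows "\<exists>l\<in>carr V. tendsto_nrm x l"
proof (rule complete)
  \<comment> \<open>Partial sums of the majorant; distances between terms of \<open>x\<close> are
    bounded by differences of \<open>g\<close>.\<close>
  define g where "g n = (\<Sum>i<n. C * r ^ i)" for n
  have "summable (\<lambda>i. C * r ^ i)"
    using r by (intro summable_mult summable_geometric) simp
  then have "Cauchy g"
    unfolding g_def summable_iff_convergent by (rule convergent_Cauchy)
  have le': "nrm V (x (n + k) \<ominus> x n) \<le> g (n + k) - g n" for n k
  proof (induction k)
    case (Suc k)
    have "nrm V (x (n + Suc k) \<ominus> x n) \<le> nrm V (x (Suc (n + k)) \<ominus> x (n + k)) + nrm V (x (n + k) \<ominus> x n)"
      using nrm_sub_triangle x by simp
    also have "\<dots> \<le> C * r ^ (n + k) + (g (n + k) - g n)"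
      using Suc le by (intro add_mono)
    finally show ?case by (simp add: g_def)
  qed (use x in simp)
  have "nrm V (x m \<ominus> x n) \<le> \<bar>g m - g n\<bar>" for m n
  proof (cases "n \<le> m")
    case True
    then show ?thesis using le'[of n "m - n"] by simp
  next
    case False
    then show ?thesis using le'[of m "n - m"] nrm_sub_commute[OF x x, of m n] by simp
  qed
  moreover have "\<exists>N. \<forall>m\<ge>N. \<forall>n\<ge>N. \<bar>g m - g n\<bar> < e" if "e > 0" for e
    using \<open>Cauchy g\<close> that by (simp add: Cauchy_def dist_real_def)
  ultimately show "cauchy_nrm x"
    using x unfolding cauchy_nrm_def by (meson le_less_trans)
qed

context banach_algebra
begin

lemma neumann:
  assumes u: "u \<in> carr V" and lt: "nrm V u < 1"
  shows "\<exists>v\<in>carr V. v \<ominus> v \<otimes> u = u"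
proof -
  \<comment> \<open>\<open>s n\<close> is the sum of the powers of \<open>u\<close> with exponents
    from \<open>1\<close> to \<open>Suc n\<close>. Its limit \<open>v\<close> stands for the inverse
    of \<open>1 - u\<close> minus \<open>1\<close>.\<close>
  define s where "s = rec_nat u (\<lambda>_ t. t \<otimes> u \<oplus> u)"
  have s: "s 0 = u" "s (Suc n) = s n \<otimes> u \<oplus> u" for n by (simp_all add: s_def)
  have sV: "s n \<in> carr V" for n by (induction n) (simp_all add: s u)
  have diff: "s (Suc (Suc n)) \<ominus> s (Suc n) = (s (Suc n) \<ominus> s n) \<otimes> u" for n
    using sV[of n] sV[of "Suc n"] u by (simp add: s(2) mult_sub_left sub_add_sub del: add_sub_cancel)
  have le: "nrm V (s (Suc n) \<ominus> s n) \<le> nrm V (s 1 \<ominus> s 0) * nrm V u ^ n" for n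
  proof (induction n)
    case (Suc n)
    have "nrm V (s (Suc (Suc n)) \<ominus> s (Suc n)) \<le> nrm V (s (Suc n) \<ominus> s n) * nrm V u"
      unfolding diff using sV u by (intro nrm_mult sub_closed)
    also have "\<dots> \<le> nrm V (s 1 \<ominus> s 0) * nrm V u ^ n * nrm V u"
      using Suc u by (intro mult_right_mono nrm_ge_0)
    finally show ?case by (simp add: mult_ac)
  qed simp
  obtain v where v: "v \<in> carr V" "tendsto_nrm s v"
    using geometric_convergent[OF sV le] lt u by auto
  have "tendsto_nrm (\<lambda>n. s (Suc n)) (v \<otimes> u \<oplus> u)"
  proof (rule tendsto_nrm_sandwich)
    show "nrm V (s (Suc n) \<ominus> (v \<otimes> u \<oplus> u)) \<le> nrm V (s n \<ominus> v) * nrm V u" for n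
      using nrm_mult[of "s n \<ominus> v" u] sV[of n] v u by (simp add: s(2) mult_sub_left sub_add_sub)
    show "(\<lambda>n. nrm V (s n \<ominus> v) * nrm V u) \<longlonglongrightarrow> 0"
      using tendsto_mult_right[OF v(2)[unfolded tendsto_nrm_def], of "nrm V u"] by simp
  qed (use sV v u in simp_all)
  moreover have "tendsto_nrm (\<lambda>n. s (Suc n)) v"
    using LIMSEQ_Suc[OF v(2)[unfolded tendsto_nrm_def]] by (simp add: tendsto_nrm_def)
  ultimately have "v = v \<otimes> u \<oplus> u"
    using tendsto_nrm_unique[of "\<lambda>n. s (Suc n)" v "v \<otimes> u \<oplus> u"] sV v u by simp
  then have "v \<ominus> v \<otimes> u = (v \<otimes> u \<oplus> u) \<ominus> v \<otimes> u" by simp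
  also have "\<dots> = u" using v u by (simp add: vsub_def add_ac)
  finally show ?thesis using v by blast
qed

text \<open>Were \<open>e \<ominus> x\<close> shorter than one, its quasi-inverse \<open>v\<close>
  would give \<open>e \<ominus> x = (v \<ominus> v \<otimes> e) \<oplus> v \<otimes> x\<close>, an
  element of \<open>L\<close>, and \<open>e\<close> would be in \<open>L\<close>.\<close>

lemma dist_unit_ge_1:
  assumes L: "left_ideal V L" and e: "e \<in> carr V" "\<And>a. a \<in> carr V \<Longrightarrow> a \<ominus> a \<otimes> e \<in> L" "e \<notin> L"
    and x: "x \<in> L"
  shows "1 \<le> nrm V (e \<ominus> x)"
proof (rule ccontr)
  have xV: "x \<in> carr V" using ideal_sub[OF L x] .
  assume "\<not> 1 \<le> nrm V (e \<ominus> x)"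
  then obtain v where v: "v \<in> carr V" "v \<ominus> v \<otimes> (e \<ominus> x) = e \<ominus> x"
    using neumann[of "e \<ominus> x"] e xV by auto
  have "v \<ominus> v \<otimes> (e \<ominus> x) = (v \<ominus> v \<otimes> e) \<oplus> v \<otimes> x"
    using v(1) e(1) xV by (simp add: vsub_def distrib_left scale_add_right add_ac)
  then have "e \<ominus> x \<in> L"
    using v ideal_add[OF L e(2)[OF v(1)] ideal_mult[OF L v(1) x]] by simp
  then have "(e \<ominus> x) \<oplus> x \<in> L" using ideal_add[OF L] x by blast
  then show False using e xV by simp
qed

text \<open>If the limit \<open>l\<close> were outside \<open>L\<close>, then
  \<open>e = k \<oplus> (a \<otimes> l \<oplus> c \<odot> l)\<close> with \<open>k\<close> in
  \<open>L\<close>. Replacing \<open>l\<close> by \<open>x n\<close> gives elements of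
  \<open>L\<close> that converge to \<open>e\<close>, while they stay at distance at least
  one.\<close>

lemma maximal_closed:
  assumes L: "maximal_modular_left_ideal V L" and x: "\<And>n. x n \<in> L" "tendsto_nrm x l" "l \<in> carr V"
  shows "l \<in> L"
proof (rule ccontr)
  assume l: "l \<notin> L"
  have Li: "left_ideal V L" by (rule maximal_ideal[OF L])
  obtain e where e: "e \<in> carr V" "\<And>a. a \<in> carr V \<Longrightarrow> a \<ominus> a \<otimes> e \<in> L" "e \<notin> L"
    using L by (rule maximal_unit) blast
  obtain k a c where d: "k \<in> L" "a \<in> carr V" "e = k \<oplus> (a \<otimes> l \<oplus> c \<odot> l)"
    using L x(3) l e(1) by (rule maximal_decomp)
  have xV: "x n \<in> carr V" for n using ideal_sub[OF Li x(1)] .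
  have kV: "k \<in> carr V" using ideal_sub[OF Li d(1)] .
  have "1 \<le> (nrm V a + cmod c) * nrm V (x n \<ominus> l)" for n
  proof -
    have "1 \<le> nrm V (e \<ominus> (k \<oplus> (a \<otimes> x n \<oplus> c \<odot> x n)))"
      using d x(1) by (intro dist_unit_ge_1[OF Li e] ideal_add[OF Li] ideal_mult[OF Li] ideal_scale[OF Li])
    also have "e \<ominus> (k \<oplus> (a \<otimes> x n \<oplus> c \<odot> x n)) = a \<otimes> (l \<ominus> x n) \<oplus> c \<odot> (l \<ominus> x n)"
      using d(2) kV x(3) xV by (simp add: d(3) sub_add_sub mult_sub_right scale_sub_right)
    also have "nrm V \<dots> \<le> nrm V (a \<otimes> (l \<ominus> x n)) + nrm V (c \<odot> (l \<ominus> x n))"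
      using d(2) x(3) xV by (intro nrm_triangle) auto
    also have "\<dots> \<le> nrm V a * nrm V (l \<ominus> x n) + cmod c * nrm V (l \<ominus> x n)"
      using d(2) x(3) xV by (intro add_mono nrm_mult) (auto simp: nrm_scale)
    finally show ?thesis using nrm_sub_commute[OF x(3) xV] by (simp add: algebra_simps)
  qed
  moreover have "(\<lambda>n. (nrm V a + cmod c) * nrm V (x n \<ominus> l)) \<longlonglongrightarrow> 0"
    using tendsto_mult_left[OF x(2)[unfolded tendsto_nrm_def], of "nrm V a + cmod c"] by simp
  ultimately have "(1::real) \<le> 0"
    by (intro LIMSEQ_le_const) auto
  then show False by simp
qed

lemma pw_mult_comm:
  assumes "commutative V" "x \<in> carr V" "y \<in> carr V"
  shows "pw (x \<otimes> y) n = pw x n \<otimes> pw y n"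
proof (induction n)
  case (Suc n)
  have c: "y' \<otimes> x = x \<otimes> y'" if "y' \<in> carr V" for y'
    using assms that by (simp add: commutative_def)
  have "pw (x \<otimes> y) (Suc n) = pw x n \<otimes> ((pw y n \<otimes> x) \<otimes> y)"
    using Suc assms by (simp add: mult_assoc)
  also have "\<dots> = pw x n \<otimes> ((x \<otimes> pw y n) \<otimes> y)"
    using assms by (simp only: c pw_closed)
  also have "\<dots> = pw x (Suc n) \<otimes> pw y (Suc n)"
    using assms by (simp add: mult_assoc)
  finally show ?case .
qed simp

text \<open>If \<open>x\<close> is outside \<open>L\<close>, then \<open>e\<close> is congruent
  modulo \<open>L\<close> to a multiple \<open>w = g \<otimes> x\<close>, hence to all powers of
  \<open>w\<close>, so these have norm at least one. Commutativity splits the powers of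
  \<open>w\<close> into those of \<open>g\<close> and \<open>x\<close>, and the latter decay faster
  than any geometric sequence.\<close>

lemma quasinilpotent_in_radical:
  assumes comm: "commutative V" and x: "x \<in> carr V"
    and qn: "\<And>K. K \<ge> 0 \<Longrightarrow> \<exists>n. K ^ Suc n * nrm V (pw x n) < 1"
  shows "x \<in> jacobson_radical V"
  unfolding jacobson_radical_def
proof (intro CollectI conjI allI impI x)
  fix L assume L: "maximal_modular_left_ideal V L"
  have Li: "left_ideal V L" by (rule maximal_ideal[OF L])
  obtain e where e: "e \<in> carr V" "\<And>a. a \<in> carr V \<Longrightarrow> a \<ominus> a \<otimes> e \<in> L" "e \<notin> L"
    using L by (rule maximal_unit) blast
  have c: "a \<otimes> b = b \<otimes> a" if "a \<in> carr V" "b \<in> carr V" for a b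
    using comm that unfolding commutative_def by blast
  show "x \<in> L"
  proof (rule ccontr)
    assume "x \<notin> L"
    then obtain l a d where d: "l \<in> L" "a \<in> carr V" "e = l \<oplus> (a \<otimes> x \<oplus> d \<odot> x)"
      using L x e(1) by (elim maximal_decomp)
    have lV: "l \<in> carr V" using ideal_sub[OF Li d(1)] .
    \<comment> \<open>Multiplying the decomposition of \<open>e\<close> by \<open>e\<close> absorbs
      the scalar \<open>d\<close> into an algebra element, so that \<open>x\<close> gets a genuine
      left factor.\<close>
    define g where "g = e \<otimes> a \<oplus> d \<odot> e"
    define w where "w = g \<otimes> x"
    have g: "g \<in> carr V" and w: "w \<in> carr V" using e d x by (simp_all add: g_def w_def)
    have "e \<otimes> e = e \<otimes> (l \<oplus> (a \<otimes> x \<oplus> d \<odot> x))" using d(3) by simp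
    also have "\<dots> = e \<otimes> l \<oplus> w"
      using e d(2) x lV by (simp add: w_def g_def distrib_left distrib_right mult_assoc)
    finally have ee: "e \<otimes> e = e \<otimes> l \<oplus> w" .
    have "e \<ominus> w = (e \<ominus> e \<otimes> e) \<oplus> e \<otimes> l"
      using e(1) w lV by (simp add: ee vsub_def scale_add_right add_assoc add_commute[of _ "e \<otimes> l"] add_left_commute[of "e \<otimes> l" e])
    then have ew: "e \<ominus> w \<in> L"
      using ideal_add[OF Li e(2)[OF e(1)] ideal_mult[OF Li e(1) d(1)]] by simp
    have "e \<ominus> pw w n \<in> L" for n
    proof (induction n)
      case (Suc n)
      have "w \<otimes> (e \<ominus> pw w n) = w \<otimes> e \<ominus> pw w (Suc n)"
        using w e(1) c[of "pw w n" w] by (simp add: mult_sub_right)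
      then have 1: "w \<otimes> e \<ominus> pw w (Suc n) \<in> L"
        using ideal_mult[OF Li w Suc] by simp
      have "e \<ominus> pw w (Suc n) = (e \<ominus> w) \<oplus> ((w \<ominus> w \<otimes> e) \<oplus> (w \<otimes> e \<ominus> pw w (Suc n)))"
        using w e(1) by (simp add: vsub_def add_assoc)
      then show ?case
        using 1 ew e(2)[OF w] ideal_add[OF Li] by simp
    qed (simp add: ew)
    then have "1 \<le> nrm V (e \<ominus> (e \<ominus> pw w n))" for n
      by (intro dist_unit_ge_1[OF Li e])
    moreover have "e \<ominus> (e \<ominus> pw w n) = pw w n" for n
      using e(1) w by (simp add: vsub_def scale_add_right)
    ultimately have ge: "1 \<le> nrm V (pw w n)" for n by simp
    obtain n where n: "nrm V g ^ Suc n * nrm V (pw x n) < 1"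
      using qn[of "nrm V g"] g by auto
    have "nrm V (pw w n) \<le> nrm V (pw g n) * nrm V (pw x n)"
      unfolding w_def pw_mult_comm[OF comm g x] using g x by (intro nrm_mult) auto
    also have "\<dots> \<le> nrm V g ^ Suc n * nrm V (pw x n)"
      using g x by (intro mult_right_mono nrm_pw_le nrm_ge_0) auto
    finally show False using n ge[of n] by simp
  qed
qed

end

section \<open>The Hahn--Banach theorem for cones\<close>

text \<open>A cone \<open>D\<close> plays the role of the epigraph of a sublinear functional. For a maximal cone,
  \<open>(x, r) \<notin> D\<close> forces \<open>(-x, s) \<in> D\<close> for some \<open>s < -r\<close>, which makes the infimum odd.\<close>

context cvs
begin

definition epi_cone :: "('a \<times> real) set \<Rightarrow> bool" where
  "epi_cone D \<longleftrightarrow> D \<subseteq> carr V \<times> UNIV \<and> (\<zero>, 0) \<in> D \<and> (\<forall>r. (\<zero>, r) \<in> D \<longrightarrow> 0 \<le> r) \<and>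
     (\<forall>x r y s. (x, r) \<in> D \<longrightarrow> (y, s) \<in> D \<longrightarrow> (x \<oplus> y, r + s) \<in> D) \<and>
     (\<forall>t x r. t > 0 \<longrightarrow> (x, r) \<in> D \<longrightarrow> (of_real t \<odot> x, t * r) \<in> D)"

lemma
  assumes "epi_cone D"
  shows cone_carr: "(x, r) \<in> D \<Longrightarrow> x \<in> carr V"
    and cone_zero: "(\<zero>, 0) \<in> D"
    and cone_nonneg: "(\<zero>, r) \<in> D \<Longrightarrow> 0 \<le> r"
    and cone_add: "\<lbrakk>(x, r) \<in> D; (y, s) \<in> D\<rbrakk> \<Longrightarrow> (x \<oplus> y, r + s) \<in> D"
    and cone_scale: "\<lbrakk>t > 0; (x, r) \<in> D\<rbrakk> \<Longrightarrow> (of_real t \<odot> x, t * r) \<in> D"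
  using assms unfolding epi_cone_def by blast+

lemma ex_maximal_cone:
  assumes "epi_cone D"
  obtains M where "epi_cone M" "D \<subseteq> M" "\<And>X. \<lbrakk>epi_cone X; M \<subseteq> X\<rbrakk> \<Longrightarrow> X = M"
proof -
  let ?F = "{M. epi_cone M \<and> D \<subseteq> M}"
  have "\<exists>M\<in>?F. \<forall>X\<in>?F. M \<subseteq> X \<longrightarrow> X = M"
  proof (rule subset_Zorn_nonempty)
    show "?F \<noteq> {}" using assms by blast
    fix C assume ne: "C \<noteq> {}" and C: "subset.chain ?F C"
    have CF: "epi_cone M" "D \<subseteq> M" if "M \<in> C" for M
      using C that by (auto simp: subset.chain_def)
    have "epi_cone (\<Union>C)"
      unfolding epi_cone_def
    proof (intro conjI allI impI)
      show "\<Union>C \<subseteq> carr V \<times> UNIV"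
        using cone_carr[OF CF(1)] by (auto elim!: UnionE)
      obtain X where X: "X \<in> C" using ne by blast
      show "(\<zero>, 0) \<in> \<Union>C" using X cone_zero[OF CF(1)[OF X]] by (rule UnionI)
    next
      fix r assume "(\<zero>, r) \<in> \<Union>C"
      then show "0 \<le> r" by (elim UnionE) (rule cone_nonneg[OF CF(1)])
    next
      fix t x r assume t: "(0::real) < t" and "(x, r) \<in> \<Union>C"
      then obtain X where X: "X \<in> C" "(x, r) \<in> X" by (elim UnionE)
      show "(of_real t \<odot> x, t * r) \<in> \<Union>C"
        using X(1) cone_scale[OF CF(1)[OF X(1)] t X(2)] by (rule UnionI)
    next
      fix x r y s assume "(x, r) \<in> \<Union>C" "(y, s) \<in> \<Union>C"
      then obtain X Y where XY: "X \<in> C" "(x, r) \<in> X" "Y \<in> C" "(y, s) \<in> Y" by (elim UnionE)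
      have "X \<subseteq> Y \<or> Y \<subseteq> X"
        using C XY(1,3) unfolding subset.chain_def by blast
      then obtain Z where Z: "Z \<in> C" "(x, r) \<in> Z" "(y, s) \<in> Z" using XY by blast
      show "(x \<oplus> y, r + s) \<in> \<Union>C"
        using Z(1) cone_add[OF CF(1)[OF Z(1)] Z(2,3)] by (rule UnionI)
    qed
    then show "\<Union>C \<in> ?F" using ne CF(2) by blast
  qed
  then obtain M where M: "M \<in> ?F" and mx: "\<forall>X\<in>?F. M \<subseteq> X \<longrightarrow> X = M" by (elim bexE)
  show thesis
  proof (rule that)
    show "epi_cone M" "D \<subseteq> M" using M by simp_all
    show "X = M" if "epi_cone X" "M \<subseteq> X" for X
      using bspec[OF mx, of X] that \<open>D \<subseteq> M\<close> by simp
  qed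
qed

lemma maximal_cone_dichotomy:
  assumes M: "epi_cone M" and mx: "\<And>X. \<lbrakk>epi_cone X; M \<subseteq> X\<rbrakk> \<Longrightarrow> X = M"
    and x: "x \<in> carr V" and no: "(x, r) \<notin> M"
  shows "\<exists>s. s < - r \<and> ((-1) \<odot> x, s) \<in> M"
proof (rule ccontr)
  assume *: "\<not> ?thesis"
  \<comment> \<open>The cone generated by \<open>M\<close> and \<open>(x, r)\<close>. Under the
    assumption its fibre over \<open>\<zero>\<close> is still nonnegative, which is the only axiom
    at risk; maximality then puts \<open>(x, r)\<close> into \<open>M\<close>.\<close>
  let ?X = "{(y \<oplus> of_real t \<odot> x, s + t * r) | y s t. (y, s) \<in> M \<and> t \<ge> 0}"
  have in_X: "(z, u) \<in> ?X" if "z = y \<oplus> of_real t \<odot> x" "u = s + t * r" "(y, s) \<in> M" "t \<ge> 0" for z u y s t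
    using that by blast
  have "epi_cone ?X"
    unfolding epi_cone_def
  proof (intro conjI allI impI)
    show "?X \<subseteq> carr V \<times> UNIV" using cone_carr[OF M] x by auto
    show "(\<zero>, 0) \<in> ?X" by (rule in_X[of _ \<zero> 0 _ 0]) (use x cone_zero[OF M] in simp_all)
  next
    fix q assume "(\<zero>, q) \<in> ?X"
    then obtain y s t where y: "\<zero> = y \<oplus> of_real t \<odot> x" "q = s + t * r" "(y, s) \<in> M" "t \<ge> 0" by blast
    have yV: "y \<in> carr V" using cone_carr[OF M y(3)] .
    show "0 \<le> q"
    proof (cases "t = 0")
      case True
      then have "y = \<zero>" using y(1) yV x by simp
      then show ?thesis using y True cone_nonneg[OF M] by simp
    next
      case False
      then have t: "t > 0" using y by simp
      have "of_real (1/t) \<odot> y \<oplus> x = of_real (1/t) \<odot> (y \<oplus> of_real t \<odot> x)"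
        using yV x t by (simp add: scale_add_right)
      then have "of_real (1/t) \<odot> y \<oplus> x = \<zero>" unfolding y(1)[symmetric] by simp
      then have "of_real (1/t) \<odot> y = (-1) \<odot> x"
        using yV x by (metis add_assoc add_neg add_zero scale_closed zero_add)
      then have "((-1) \<odot> x, (1/t) * s) \<in> M"
        using cone_scale[OF M, of "1/t"] y t by (metis zero_less_divide_1_iff)
      then have "-r \<le> (1/t) * s" using * not_le by blast
      then show ?thesis using t y(2) by (simp add: field_simps)
    qed
  next
    fix z u c assume c: "(0::real) < c" and "(z, u) \<in> ?X"
    then obtain y s t where y: "z = y \<oplus> of_real t \<odot> x" "u = s + t * r" "(y, s) \<in> M" "t \<ge> 0" by blast
    have yV: "y \<in> carr V" using cone_carr[OF M y(3)] .
    show "(of_real c \<odot> z, c * u) \<in> ?X"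
      by (rule in_X[of _ "of_real c \<odot> y" "c * t" _ "c * s"])
         (use y yV c x cone_scale[OF M c y(3)] in \<open>simp_all add: scale_add_right algebra_simps\<close>)
  next
    fix z u z' u' assume "(z, u) \<in> ?X" "(z', u') \<in> ?X"
    then obtain y s t y' s' t' where y: "z = y \<oplus> of_real t \<odot> x" "u = s + t * r" "(y, s) \<in> M" "t \<ge> 0"
      and y': "z' = y' \<oplus> of_real t' \<odot> x" "u' = s' + t' * r" "(y', s') \<in> M" "t' \<ge> 0" by blast
    have yV: "y \<in> carr V" "y' \<in> carr V" using cone_carr[OF M] y y' by blast+
    show "(z \<oplus> z', u + u') \<in> ?X"
      by (rule in_X[of _ "y \<oplus> y'" "t + t'" _ "s + s'"])
         (use y y' yV x cone_add[OF M y(3) y'(3)] in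
          \<open>simp_all add: scale_add_left add_ac algebra_simps\<close>)
  qed
  moreover have "M \<subseteq> ?X"
  proof
    fix p assume p: "p \<in> M"
    obtain y s where ys: "p = (y, s)" by (cases p)
    show "p \<in> ?X" unfolding ys
      by (rule in_X[of _ y 0 _ s]) (use p ys x cone_carr[OF M] in simp_all)
  qed
  ultimately have "?X = M" by (rule mx)
  moreover have "(x, r) \<in> ?X"
    by (rule in_X[of _ \<zero> 1 _ 0]) (use x cone_zero[OF M] in simp_all)
  ultimately show False using no by simp
qed

text \<open>The functional is the fibrewise infimum of a maximal cone. \<open>total\<close> makes
  the fibres nonempty, and each fibre is bounded below by the negative of any point of the opposite
  fibre.\<close>

theorem hahn_banach_cone:
  assumes D: "epi_cone D" and total: "\<And>x. x \<in> carr V \<Longrightarrow> \<exists>r. (x, r) \<in> D"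
  obtains f :: "'a \<Rightarrow> real" where "\<And>x y. \<lbrakk>x \<in> carr V; y \<in> carr V\<rbrakk> \<Longrightarrow> f (x \<oplus> y) = f x + f y"
    "\<And>t x. x \<in> carr V \<Longrightarrow> f (of_real t \<odot> x) = t * f x" "\<And>x r. (x, r) \<in> D \<Longrightarrow> f x \<le> r"
proof -
  obtain M where M: "epi_cone M" "D \<subseteq> M" and mx: "\<And>X. \<lbrakk>epi_cone X; M \<subseteq> X\<rbrakk> \<Longrightarrow> X = M"
    using ex_maximal_cone[OF D] by metis
  define S where "S x = {r. (x, r) \<in> M}" for x
  define f where "f x = Inf (S x)" for x
  have ne: "S x \<noteq> {}" if "x \<in> carr V" for x
    using total[OF that] M(2) by (auto simp: S_def)
  have bdd: "bdd_below (S x)" if x: "x \<in> carr V" for x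
  proof -
    obtain s where "((-1) \<odot> x, s) \<in> M" using ne[of "(-1) \<odot> x"] x by (auto simp: S_def)
    then have "-s \<le> r" if "r \<in> S x" for r
      using cone_nonneg[OF M(1), of "r + s"] cone_add[OF M(1), of x r "(-1) \<odot> x" s] that x by (simp add: S_def)
    then show ?thesis by (rule bdd_belowI)
  qed
  have le: "f x \<le> r" if "(x, r) \<in> M" for x r
    unfolding f_def using that cone_carr[OF M(1) that] by (intro cInf_lower bdd) (simp_all add: S_def)
  have ge: "k \<le> f x" if "x \<in> carr V" "\<And>r. (x, r) \<in> M \<Longrightarrow> k \<le> r" for k x
    unfolding f_def using that ne by (intro cInf_greatest) (auto simp: S_def)
  have sub: "f (x \<oplus> y) \<le> f x + f y" if xy: "x \<in> carr V" "y \<in> carr V" for x y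
  proof -
    have "f (x \<oplus> y) - r \<le> f y" if r: "(x, r) \<in> M" for r
    proof (rule ge[OF xy(2)])
      fix s assume "(y, s) \<in> M"
      then show "f (x \<oplus> y) - r \<le> s" using le[OF cone_add[OF M(1) r, of y s]] by simp
    qed
    then have "f (x \<oplus> y) - f y \<le> f x"
      by (intro ge[OF xy(1)]) (simp add: algebra_simps)
    then show ?thesis by simp
  qed
  \<comment> \<open>The one place that uses maximality. Together with subadditivity it makes
    \<open>f\<close> additive.\<close>
  have neg: "f ((-1) \<odot> x) \<le> - f x" if x: "x \<in> carr V" for x
  proof (rule ccontr)
    assume "\<not> ?thesis"
    then obtain r where r: "- f ((-1) \<odot> x) < r" "r < f x" using dense[of "- f ((-1) \<odot> x)" "f x"] by auto
    have "(x, r) \<notin> M" using le r by fastforce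
    then obtain s where "s < -r" "((-1) \<odot> x, s) \<in> M"
      using maximal_cone_dichotomy[OF M(1) mx x] by blast
    then show False using le[of "(-1) \<odot> x" s] r by simp
  qed
  have f0: "f \<zero> = 0"
    using le[OF cone_zero[OF M(1)]] ge[OF zero_closed cone_nonneg[OF M(1)]] by simp
  have add: "f (x \<oplus> y) = f x + f y" if xy: "x \<in> carr V" "y \<in> carr V" for x y
  proof -
    have "f x = f ((x \<oplus> y) \<oplus> (-1) \<odot> y)" using xy by (simp add: add_assoc)
    also have "\<dots> \<le> f (x \<oplus> y) + f ((-1) \<odot> y)" using xy by (intro sub) simp_all
    finally show ?thesis using sub[OF xy] neg[OF xy(2)] by simp
  qed
  have pos_le: "f (of_real t \<odot> x) \<le> t * f x" if t: "t > 0" and x: "x \<in> carr V" for t x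
  proof -
    have "f (of_real t \<odot> x) / t \<le> f x"
    proof (rule ge[OF x])
      fix r assume "(x, r) \<in> M"
      then have "f (of_real t \<odot> x) \<le> t * r" using le cone_scale[OF M(1) t] by blast
      then show "f (of_real t \<odot> x) / t \<le> r" using t by (simp add: field_simps)
    qed
    then show ?thesis using t by (simp add: field_simps)
  qed
  have pos: "f (of_real t \<odot> x) = t * f x" if t: "t > 0" and x: "x \<in> carr V" for t x
  proof (rule antisym[OF pos_le[OF t x]])
    have "f (of_real (1/t) \<odot> (of_real t \<odot> x)) \<le> (1/t) * f (of_real t \<odot> x)"
      using t x by (intro pos_le) simp_all
    then show "t * f x \<le> f (of_real t \<odot> x)"
      using t x by (simp add: field_simps)
  qed
  have "f (of_real t \<odot> x) = t * f x" if x: "x \<in> carr V" for t x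
  proof (cases t "0::real" rule: linorder_cases)
    case less
    have "f (of_real t \<odot> x) + f (of_real (-t) \<odot> x) = f ((of_real t + of_real (-t)) \<odot> x)"
      using x by (simp only: add scale_closed scale_add_left)
    also have "\<dots> = 0" using x f0 by simp
    finally show ?thesis using pos[of "-t" x] less x by simp
  next
    case equal
    then show ?thesis using x f0 by simp
  qed (use pos x in simp)
  then show thesis using that[of f] add le M(2) by blast
qed

lemma complexify:
  fixes f :: "'a \<Rightarrow> real"
  assumes add: "\<And>x y. \<lbrakk>x \<in> carr V; y \<in> carr V\<rbrakk> \<Longrightarrow> f (x \<oplus> y) = f x + f y"
    and sc: "\<And>t x. x \<in> carr V \<Longrightarrow> f (of_real t \<odot> x) = t * f x"
    and F: "\<And>x. F x = Complex (f x) (- f (\<i> \<odot> x))" and x: "x \<in> carr V"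
  shows "F (c \<odot> x) = c * F x" and "y \<in> carr V \<Longrightarrow> F (x \<oplus> y) = F x + F y"
proof -
  have 1: "f ((a + \<i> * b) \<odot> x) = a * f x + b * f (\<i> \<odot> x)" for a b :: real
  proof -
    have "(a + \<i> * b) \<odot> x = of_real a \<odot> x \<oplus> of_real b \<odot> (\<i> \<odot> x)"
      using x by (simp add: scale_add_left mult.commute)
    then show ?thesis using x by (simp only: add sc scale_closed)
  qed
  have c: "c = of_real (Re c) + \<i> * of_real (Im c)" by (rule complex_eq)
  have ic: "\<i> * c = of_real (- Im c) + \<i> * of_real (Re c)"
    by (simp add: complex_eq_iff)
  have "f (c \<odot> x) = Re c * f x + Im c * f (\<i> \<odot> x)"
    using 1[of "Re c" "Im c"] c by simp
  moreover have "f (\<i> \<odot> (c \<odot> x)) = - Im c * f x + Re c * f (\<i> \<odot> x)"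
    using 1[of "- Im c" "Re c"] ic x by simp
  ultimately show "F (c \<odot> x) = c * F x"
    by (simp add: F complex_eq_iff)
  show "F (x \<oplus> y) = F x + F y" if "y \<in> carr V"
    using that x by (simp add: F complex_eq_iff add scale_add_right)
qed

end

text \<open>\<open>D\<close> describes the sublinear functional whose value at \<open>x\<close> is
  the infimum of \<open>nrm V ((x \<oplus> of_real t \<odot> e) \<ominus> m) - t\<close> over
  \<open>m\<close> in \<open>M\<close> and \<open>t \<ge> 0\<close>. The distance hypothesis keeps
  it nonnegative at zero. It is at most zero on \<open>M\<close>, at most the norm everywhere, and
  at most \<open>-1\<close> at the negative of \<open>e\<close>.\<close>

lemma (in nspace) separating_functional:
  assumes M: "subspace_of V M" and e: "e \<in> carr V" and dist: "\<And>m. m \<in> M \<Longrightarrow> 1 \<le> nrm V (e \<ominus> m)"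
  obtains \<phi> where "\<phi> \<in> carr (dual V)" "\<And>m. m \<in> M \<Longrightarrow> \<phi> m = 0" "\<phi> e \<noteq> 0"
proof -
  have sub: "m \<in> carr V" if "m \<in> M" for m using M that unfolding subspace_of_def by blast
  have z: "\<zero> \<in> M" and Ma: "\<And>x y. \<lbrakk>x \<in> M; y \<in> M\<rbrakk> \<Longrightarrow> x \<oplus> y \<in> M" and Ms: "\<And>c x. x \<in> M \<Longrightarrow> c \<odot> x \<in> M"
    using M unfolding subspace_of_def by blast+
  define D where "D = {(x, r). x \<in> carr V \<and> (\<exists>m\<in>M. \<exists>t\<ge>0. nrm V ((x \<oplus> of_real t \<odot> e) \<ominus> m) - t \<le> r)}"
  have DI: "(x, r) \<in> D" if "x \<in> carr V" "m \<in> M" "t \<ge> 0" "nrm V ((x \<oplus> of_real t \<odot> e) \<ominus> m) - t \<le> r" for x r m t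
    using that unfolding D_def by blast
  have DE: "\<exists>m\<in>M. \<exists>t\<ge>0. nrm V ((x \<oplus> of_real t \<odot> e) \<ominus> m) - t \<le> r" "x \<in> carr V" if "(x, r) \<in> D" for x r
    using that unfolding D_def by blast+
  have "epi_cone D"
    unfolding epi_cone_def
  proof (intro conjI allI impI)
    show "D \<subseteq> carr V \<times> UNIV" unfolding D_def by blast
    show "(\<zero>, 0) \<in> D" by (rule DI[OF _ z, of _ 0]) (use e in simp_all)
  next
    fix r assume "(\<zero>, r) \<in> D"
    then obtain m t where m: "m \<in> M" "t \<ge> 0" "nrm V ((\<zero> \<oplus> of_real t \<odot> e) \<ominus> m) - t \<le> r" using DE by blast
    show "0 \<le> r"
    proof (cases "t = 0")
      case True
      have "0 \<le> nrm V ((\<zero> \<oplus> of_real t \<odot> e) \<ominus> m)" using e sub[OF m(1)] by simp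
      then show ?thesis using m(3) True by simp
    next
      case False
      then have t: "t > 0" using m by simp
      have "of_real t \<odot> e \<ominus> m = of_real t \<odot> (e \<ominus> of_real (1/t) \<odot> m)"
        using e sub[OF m(1)] t by (simp add: scale_sub_right)
      then have "nrm V (of_real t \<odot> e \<ominus> m) = t * nrm V (e \<ominus> of_real (1/t) \<odot> m)"
        using e sub[OF m(1)] t nrm_scale[of "e \<ominus> of_real (1/t) \<odot> m" "of_real t"] by simp
      moreover have "t * 1 \<le> t * nrm V (e \<ominus> of_real (1/t) \<odot> m)"
        using t dist[OF Ms[OF m(1)]] by (intro mult_left_mono) simp_all
      ultimately show ?thesis using m(3) e by simp
    qed
  next
    fix t x r assume t: "(0::real) < t" and "(x, r) \<in> D"
    then obtain m s where m: "m \<in> M" "s \<ge> 0" "nrm V ((x \<oplus> of_real s \<odot> e) \<ominus> m) - s \<le> r" and x: "x \<in> carr V"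
      using DE by blast
    have mV: "m \<in> carr V" using sub[OF m(1)] .
    show "(of_real t \<odot> x, t * r) \<in> D"
    proof (rule DI[OF _ Ms[OF m(1), of "of_real t"], of _ "t * s"])
      have eq: "(of_real t \<odot> x \<oplus> of_real (t * s) \<odot> e) \<ominus> of_real t \<odot> m = of_real t \<odot> ((x \<oplus> of_real s \<odot> e) \<ominus> m)"
        using x e mV by (simp add: scale_sub_right scale_add_right)
      have "nrm V ((of_real t \<odot> x \<oplus> of_real (t * s) \<odot> e) \<ominus> of_real t \<odot> m) - t * s
          = t * (nrm V ((x \<oplus> of_real s \<odot> e) \<ominus> m) - s)"
        unfolding eq using x e mV t by (simp add: nrm_scale right_diff_distrib)
      also have "\<dots> \<le> t * r" using m(3) t by (intro mult_left_mono) simp_all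
      finally show "nrm V ((of_real t \<odot> x \<oplus> of_real (t * s) \<odot> e) \<ominus> of_real t \<odot> m) - t * s \<le> t * r" .
    qed (use x t m in simp_all)
  next
    fix x r x' r' assume "(x, r) \<in> D" "(x', r') \<in> D"
    then obtain m s m' s' where m: "m \<in> M" "s \<ge> 0" "nrm V ((x \<oplus> of_real s \<odot> e) \<ominus> m) - s \<le> r" "x \<in> carr V"
      and m': "m' \<in> M" "s' \<ge> 0" "nrm V ((x' \<oplus> of_real s' \<odot> e) \<ominus> m') - s' \<le> r'" "x' \<in> carr V"
      using DE by meson
    have mV: "m \<in> carr V" "m' \<in> carr V" using sub m m' by blast+
    show "(x \<oplus> x', r + r') \<in> D"
    proof (rule DI[OF _ Ma[OF m(1) m'(1)], of _ "s + s'"])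
      have "(x \<oplus> x' \<oplus> of_real (s + s') \<odot> e) \<ominus> (m \<oplus> m') =
          ((x \<oplus> of_real s \<odot> e) \<oplus> (x' \<oplus> of_real s' \<odot> e)) \<ominus> (m \<oplus> m')"
        using m(4) m'(4) e by (simp add: scale_add_left add_ac)
      also have "\<dots> = ((x \<oplus> of_real s \<odot> e) \<ominus> m) \<oplus> ((x' \<oplus> of_real s' \<odot> e) \<ominus> m')"
        using m(4) m'(4) e mV by (simp add: sub_add_sub)
      finally have "nrm V ((x \<oplus> x' \<oplus> of_real (s + s') \<odot> e) \<ominus> (m \<oplus> m')) \<le>
          nrm V ((x \<oplus> of_real s \<odot> e) \<ominus> m) + nrm V ((x' \<oplus> of_real s' \<odot> e) \<ominus> m')"
        using m(4) m'(4) e mV by (simp add: nrm_triangle)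
      then show "nrm V ((x \<oplus> x' \<oplus> of_real (s + s') \<odot> e) \<ominus> (m \<oplus> m')) - (s + s') \<le> r + r'"
        using m(3) m'(3) by simp
    qed (use m m' in simp_all)
  qed
  moreover have nD: "(x, nrm V x) \<in> D" if "x \<in> carr V" for x
    by (rule DI[OF that z, of 0]) (use that e in simp_all)
  ultimately obtain f where f: "\<And>x y. \<lbrakk>x \<in> carr V; y \<in> carr V\<rbrakk> \<Longrightarrow> f (x \<oplus> y) = f x + f y"
    "\<And>t x. x \<in> carr V \<Longrightarrow> f (of_real t \<odot> x) = t * f x" and fD: "\<And>x r. (x, r) \<in> D \<Longrightarrow> f x \<le> r"
    using hahn_banach_cone[of D] by metis
  have fneg: "f ((-1) \<odot> x) = - f x" if "x \<in> carr V" for x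
    using f(2)[OF that, of "-1"] by simp
  have fle: "\<bar>f x\<bar> \<le> nrm V x" if "x \<in> carr V" for x
    using fD[OF nD[OF that]] fD[OF nD[of "(-1) \<odot> x"]] that fneg by (simp add: nrm_scale)
  have fm: "f m = 0" if m: "m \<in> M" for m
  proof -
    have "f x \<le> 0" if x: "x \<in> M" for x
      by (rule fD[OF DI[OF sub[OF x] x, of 0]]) (use sub[OF x] e in simp_all)
    from this[OF m] this[OF Ms[OF m, of "-1"]] show ?thesis using fneg[OF sub[OF m]] by simp
  qed
  have fe: "f e \<ge> 1"
  proof -
    \<comment> \<open>Here \<open>m\<close> is zero and \<open>t = 1\<close>, so that the norm term
      vanishes.\<close>
    have "f ((-1) \<odot> e) \<le> -1"
      by (rule fD[OF DI[OF _ z, of _ 1]]) (use e in simp_all)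
    then show ?thesis using fneg[OF e] by simp
  qed
  define F where "F x = Complex (f x) (- f (\<i> \<odot> x))" for x
  have F1: "F (c \<odot> x) = c * F x" if "x \<in> carr V" for c x
    by (rule complexify(1)[of f]) (fact f F_def that)+
  have F2: "F (x \<oplus> y) = F x + F y" if "x \<in> carr V" "y \<in> carr V" for x y
    by (rule complexify(2)[of f]) (fact f F_def that)+
  define \<phi> where "\<phi> = restrict F (carr V)"
  have "\<phi> \<in> carr (dual V)"
  proof (rule dualI[where K = 2])
    fix x assume x: "x \<in> carr V"
    have "cmod (F x) \<le> \<bar>f x\<bar> + \<bar>f (\<i> \<odot> x)\<bar>"
      unfolding F_def using cmod_le[of "Complex (f x) (- f (\<i> \<odot> x))"] by simp
    also have "\<dots> \<le> 2 * nrm V x" using fle[OF x] fle[of "\<i> \<odot> x"] x by (simp add: nrm_scale)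
    finally show "cmod (\<phi> x) \<le> 2 * nrm V x" using x by (simp add: \<phi>_def)
    show "\<phi> (c \<odot> x) = c * \<phi> x" for c using F1[OF x] x by (simp add: \<phi>_def)
    show "\<phi> (x \<oplus> y) = \<phi> x + \<phi> y" if "y \<in> carr V" for y using F2[OF x that] x that by (simp add: \<phi>_def)
  qed (simp add: \<phi>_def)
  moreover have "\<phi> m = 0" if "m \<in> M" for m
    using fm[OF that] fm[OF Ms[OF that]] sub[OF that] by (simp add: \<phi>_def F_def complex_eq_iff)
  moreover have "\<phi> e \<noteq> 0" using fe e by (simp add: \<phi>_def F_def complex_eq_iff)
  ultimately show thesis using that[of \<phi>] by blast
qed

section \<open>Passing from the bidual to the algebra\<close>

text \<open>For a subspace \<open>S\<close> this bipolar is the weak* closure of its image in the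
  bidual, expressed without the weak* topology.\<close>

definition perp2 :: "('a, 'm) cnormed_scheme \<Rightarrow> 'a set \<Rightarrow> (('a \<Rightarrow> complex) \<Rightarrow> complex) set" where
  "perp2 V S = {F \<in> carr (dual (dual V)). \<forall>\<phi>\<in>carr (dual V). (\<forall>x\<in>S. \<phi> x = 0) \<longrightarrow> F \<phi> = 0}"

context nspace
begin

lemma perp2I:
  assumes "F \<in> carr (dual (dual V))"
    "\<And>\<phi>. \<lbrakk>\<phi> \<in> carr (dual V); \<And>x. x \<in> S \<Longrightarrow> \<phi> x = 0\<rbrakk> \<Longrightarrow> F \<phi> = 0"
  shows "F \<in> perp2 V S"
  using assms unfolding perp2_def by simp

lemma perp2D: "\<lbrakk>F \<in> perp2 V S; \<phi> \<in> carr (dual V); \<And>x. x \<in> S \<Longrightarrow> \<phi> x = 0\<rbrakk> \<Longrightarrow> F \<phi> = 0"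
  unfolding perp2_def by simp

lemma perp2_carr: "F \<in> perp2 V S \<Longrightarrow> F \<in> carr (dual (dual V))"
  unfolding perp2_def by simp

lemma emb_perp2: "\<lbrakk>x \<in> S; S \<subseteq> carr V\<rbrakk> \<Longrightarrow> emb V x \<in> perp2 V S"
  by (rule perp2I) auto

end

context nalgebra
begin

lemma bidual_tendsto_app:
  assumes "nspace.tendsto_nrm (bidual V) F G" "\<And>n. F n \<in> carr (dual (dual V))" "G \<in> carr (dual (dual V))"
    "\<phi> \<in> carr (dual V)"
  shows "(\<lambda>n. F n \<phi>) \<longlonglongrightarrow> G \<phi>"
proof -
  interpret B: banach_algebra "bidual V" by (rule bidual_algebra)
  have "(\<lambda>n. nrm (dual (dual V)) (vsub (dual (dual V)) (F n) G) * nrm (dual V) \<phi>) \<longlonglongrightarrow> 0 * nrm (dual V) \<phi>"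
    using assms(1) unfolding B.tendsto_nrm_def by (intro tendsto_mult_right) simp
  then have lim: "(\<lambda>n. nrm (dual (dual V)) (vsub (dual (dual V)) (F n) G) * nrm (dual V) \<phi>) \<longlonglongrightarrow> 0"
    by simp
  have "(\<lambda>n. F n \<phi> - G \<phi>) \<longlonglongrightarrow> 0"
  proof (rule Lim_null_comparison[OF always_eventually lim], intro allI)
    fix n
    have "vsub (dual (dual V)) (F n) G \<in> carr (dual (dual V))"
      using B.sub_closed[of "F n" G] assms by simp
    from bidual_bound[OF this assms(4)]
    show "norm (F n \<phi> - G \<phi>) \<le> nrm (dual (dual V)) (vsub (dual (dual V)) (F n) G) * nrm (dual V) \<phi>"
      using assms by simp
  qed
  then show ?thesis by (rule LIM_zero_cancel)
qed

text \<open>A functional that vanishes on a left ideal still does so after \<open>rmul\<close> by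
  any \<open>a\<close>, so \<open>F\<close> kills all these translates. As \<open>G F\<close> is
  evaluated at \<open>\<phi>\<close> by applying \<open>G\<close> to \<open>lact V F \<phi>\<close>,
  \<open>perp2 V L\<close> is a left ideal.\<close>

lemma lact_perp2:
  assumes "left_ideal V L" "F \<in> perp2 V L" "\<phi> \<in> carr (dual V)" "\<And>x. x \<in> L \<Longrightarrow> \<phi> x = 0"
  shows "lact V F \<phi> = vzero (dual V)"
proof (rule dual_eqI)
  show "lact V F \<phi> \<in> carr (dual V)" using assms perp2_carr by simp
  fix a assume a: "a \<in> carr V"
  have "F (rmul V \<phi> a) = 0"
    using assms a by (intro perp2D[OF assms(2)]) (simp_all add: ideal_sub ideal_mult)
  then show "lact V F \<phi> a = vzero (dual V) a" using a by simp
qed simp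

lemma perp2_left_ideal:
  assumes L: "left_ideal V L"
  shows "left_ideal (bidual V) (perp2 V L)"
proof -
  interpret B: banach_algebra "bidual V" by (rule bidual_algebra)
  show ?thesis
  proof (rule B.left_idealI)
    show "vzero (bidual V) \<in> perp2 V L" by (auto intro!: perp2I)
    fix F assume F: "F \<in> perp2 V L"
    show "F \<in> carr (bidual V)" using perp2_carr[OF F] by simp
    show "vscale (bidual V) c F \<in> perp2 V L" for c
      by (rule perp2I) (use perp2_carr[OF F] perp2D[OF F] in simp_all)
    show "vadd (bidual V) F G \<in> perp2 V L" if G: "G \<in> perp2 V L" for G
      by (rule perp2I) (use perp2_carr[OF F] perp2D[OF F] perp2_carr[OF G] perp2D[OF G] in simp_all)
    show "amult (bidual V) G F \<in> perp2 V L" if G: "G \<in> carr (bidual V)" for G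
    proof (rule perp2I)
      show "amult (bidual V) G F \<in> carr (dual (dual V))" using G perp2_carr[OF F] by simp
      fix \<phi> assume \<phi>: "\<phi> \<in> carr (dual V)" "\<And>x. x \<in> L \<Longrightarrow> \<phi> x = 0"
      show "amult (bidual V) G F \<phi> = 0"
        using lact_perp2[OF L F \<phi>] \<phi>(1) G bidual_zero[of G] by simp
    qed
  qed
qed

lemma perp2_norm_closed: "norm_closed (bidual V) (perp2 V S)"
proof -
  interpret B: banach_algebra "bidual V" by (rule bidual_algebra)
  show ?thesis
    unfolding B.norm_closed_iff
  proof (intro conjI allI impI)
    show "perp2 V S \<subseteq> carr (bidual V)" by (auto simp: perp2_def)
    fix F G assume "(\<forall>n. F n \<in> perp2 V S) \<and> G \<in> carr (bidual V) \<and> B.tendsto_nrm F G"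
    then have F: "\<forall>n. F n \<in> perp2 V S" and G: "G \<in> carr (bidual V)" and lim: "B.tendsto_nrm F G"
      by simp_all
    show "G \<in> perp2 V S"
    proof (rule perp2I)
      show "G \<in> carr (dual (dual V))" using G by simp
      fix \<phi> assume \<phi>: "\<phi> \<in> carr (dual V)" "\<And>x. x \<in> S \<Longrightarrow> \<phi> x = 0"
      have "(\<lambda>n. F n \<phi>) \<longlonglongrightarrow> G \<phi>"
        by (rule bidual_tendsto_app[OF lim _ _ \<phi>(1)]) (use perp2_carr[OF spec[OF F]] G in simp_all)
      moreover have "F n \<phi> = 0" for n using F \<phi> by (intro perp2D[of "F n" S]) simp_all
      ultimately show "G \<phi> = 0" by (simp add: LIMSEQ_const_iff)
    qed
  qed
qed

lemma semiprime_of_bidual: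
  assumes sep: separated and sp: "semiprime (bidual V)"
  shows "semiprime V"
  unfolding semiprime_def
proof (intro allI impI, elim conjE)
  interpret B: banach_algebra "bidual V" by (rule bidual_algebra)
  fix J assume J: "two_sided_ideal V J" and sq: "{x \<otimes> y |x y. x \<in> J \<and> y \<in> J} = {\<zero>}"
  have Ji: "left_ideal V J" and Jr: "\<And>a x. \<lbrakk>a \<in> carr V; x \<in> J\<rbrakk> \<Longrightarrow> x \<otimes> a \<in> J"
    using J unfolding two_sided_ideal_def by blast+
  have sub: "x \<in> J \<Longrightarrow> x \<in> carr V" for x using ideal_sub[OF Ji] .
  have sq0: "x \<otimes> y = \<zero>" if "x \<in> J" "y \<in> J" for x y
  proof -
    have "x \<otimes> y \<in> {x \<otimes> y |x y. x \<in> J \<and> y \<in> J}" using that by blast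
    then show ?thesis using sq by simp
  qed
  have ts: "two_sided_ideal (bidual V) (perp2 V J)"
    unfolding two_sided_ideal_def
  proof (intro conjI perp2_left_ideal[OF Ji] ballI)
    fix G F assume G: "G \<in> carr (bidual V)" and F: "F \<in> perp2 V J"
    show "amult (bidual V) F G \<in> perp2 V J"
    proof (rule perp2I)
      show "amult (bidual V) F G \<in> carr (dual (dual V))" using G perp2_carr[OF F] by simp
      fix \<phi> assume \<phi>: "\<phi> \<in> carr (dual V)" "\<And>x. x \<in> J \<Longrightarrow> \<phi> x = 0"
      \<comment> \<open>For \<open>x\<close> in \<open>J\<close> all products of \<open>x\<close>
        with algebra elements stay in \<open>J\<close>, where \<open>\<phi>\<close> vanishes. This
        is where \<open>J\<close> is used as a right ideal.\<close>
      have "lact V G \<phi> x = 0" if x: "x \<in> J" for x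
      proof -
        have "rmul V \<phi> x = vzero (dual V)"
          using \<phi>(1) sub[OF x] by (intro dual_eqI) (simp_all add: \<phi>(2) Jr x)
        then show ?thesis using sub[OF x] bidual_zero[of G] G by simp
      qed
      then have "F (lact V G \<phi>) = 0"
        using \<phi>(1) G by (intro perp2D[OF F]) simp_all
      then show "amult (bidual V) F G \<phi> = 0" using \<phi>(1) by simp
    qed
  qed
  \<comment> \<open>As products in \<open>J\<close> are zero, \<open>rmul V \<phi> x\<close>
    vanishes on \<open>J\<close> for \<open>x\<close> in \<open>J\<close>, so \<open>G\<close> kills
    it. Hence \<open>lact V G \<phi>\<close> vanishes on \<open>J\<close>, and \<open>F\<close>
    kills that.\<close>
  have prod0: "amult (bidual V) F G = vzero (bidual V)" if F: "F \<in> perp2 V J" and G: "G \<in> perp2 V J" for F G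
  proof -
    have "arens V F G \<phi> = 0" if \<phi>: "\<phi> \<in> carr (dual V)" for \<phi>
    proof -
      have "lact V G \<phi> x = 0" if x: "x \<in> J" for x
        using perp2D[OF G, of "rmul V \<phi> x"] \<phi> sub[OF x] sub by (simp add: sq0 x dual_zero)
      then have "F (lact V G \<phi>) = 0"
        using \<phi> perp2_carr[OF G] by (intro perp2D[OF F]) simp_all
      then show ?thesis using \<phi> by simp
    qed
    then have "arens V F G = vzero (dual (dual V))"
      using perp2_carr[OF F] perp2_carr[OF G] by (intro bidual_eqI) (simp_all del: arens_app)
    then show ?thesis by simp
  qed
  have z: "vzero (bidual V) \<in> perp2 V J" using B.ideal_zero[OF perp2_left_ideal[OF Ji]] .
  have sq2: "{amult (bidual V) F G |F G. F \<in> perp2 V J \<and> G \<in> perp2 V J} = {vzero (bidual V)}"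
  proof (intro equalityI subsetI)
    fix H assume "H \<in> {vzero (bidual V)}"
    then have "H = amult (bidual V) (vzero (bidual V)) (vzero (bidual V))"
      using prod0[OF z z] by simp
    then show "H \<in> {amult (bidual V) F G |F G. F \<in> perp2 V J \<and> G \<in> perp2 V J}" using z by blast
  qed (use prod0 in auto)
  have eq: "perp2 V J = {vzero (bidual V)}"
    by (rule mp[OF spec[OF sp[unfolded semiprime_def]]]) (intro conjI ts perp2_norm_closed sq2)
  have "x = \<zero>" if x: "x \<in> J" for x
  proof (rule emb_eq_zeroD[OF sep sub[OF x]])
    have "emb V x \<in> perp2 V J" using x by (rule emb_perp2) (use sub in blast)
    then show "emb V x = vzero (dual (dual V))" unfolding eq by simp
  qed
  then show "J = {\<zero>}" using ideal_zero[OF Ji] by blast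
qed

end

text \<open>Contrapositive: a maximal modular left ideal \<open>L\<close> yields
  \<open>perp2 V L\<close> with modular unit \<open>emb V e\<close>. A functional that separates
  \<open>e\<close> from \<open>L\<close> shows that it is proper, so \<open>emb V e\<close> is
  outside the radical.\<close>

lemma (in banach_algebra) radical_of_bidual:
  assumes rad: "radical_algebra (bidual V)"
  shows "radical_algebra V"
proof (rule ccontr)
  interpret B: banach_algebra "bidual V" by (rule bidual_algebra)
  assume "\<not> radical_algebra V"
  then obtain L where L: "maximal_modular_left_ideal V L"
    unfolding radical_algebra_def jacobson_radical_def by blast
  have Li: "left_ideal V L" by (rule maximal_ideal[OF L])
  obtain e where e: "e \<in> carr V" "\<And>a. a \<in> carr V \<Longrightarrow> a \<ominus> a \<otimes> e \<in> L" "e \<notin> L"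
    using L by (rule maximal_unit) blast
  have "subspace_of V L" using Li by (simp add: left_ideal_def)
  then obtain \<phi> where \<phi>: "\<phi> \<in> carr (dual V)" "\<And>m. m \<in> L \<Longrightarrow> \<phi> m = 0" "\<phi> e \<noteq> 0"
    using separating_functional[OF _ e(1), of L] dist_unit_ge_1[OF Li e] by metis
  have n1: "emb V e \<notin> perp2 V L"
    using perp2D[of "emb V e" L \<phi>] \<phi> by auto
  have n2: "vsub (bidual V) G (amult (bidual V) G (emb V e)) \<in> perp2 V L" if G: "G \<in> carr (bidual V)" for G
  proof (rule perp2I)
    show "vsub (bidual V) G (amult (bidual V) G (emb V e)) \<in> carr (dual (dual V))"
      using B.sub_closed[of G "amult (bidual V) G (emb V e)"] G e(1) by simp
    fix \<psi> assume \<psi>: "\<psi> \<in> carr (dual V)" "\<And>x. x \<in> L \<Longrightarrow> \<psi> x = 0"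
    \<comment> \<open>A functional that kills all \<open>a \<ominus> a \<otimes> e\<close> does not
      distinguish \<open>a\<close> from \<open>a \<otimes> e\<close>.\<close>
    have "lact V (emb V e) \<psi> = \<psi>"
    proof (rule dual_eqI)
      fix a assume a: "a \<in> carr V"
      have "\<psi> (a \<ominus> a \<otimes> e) = 0" using \<psi>(2) e(2)[OF a] .
      then show "lact V (emb V e) \<psi> a = \<psi> a"
        using \<psi>(1) a e(1) by (simp add: dual_sub)
    qed (use \<psi> e in simp_all)
    then show "vsub (bidual V) G (amult (bidual V) G (emb V e)) \<psi> = 0"
      using \<psi>(1) by simp
  qed
  obtain M where M: "maximal_modular_left_ideal (bidual V) M" "emb V e \<notin> M"
    using B.ex_maximal_modular[OF perp2_left_ideal[OF Li] _ n2 n1] e(1) by auto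
  have "emb V e \<in> jacobson_radical (bidual V)"
    using rad e(1) unfolding radical_algebra_def by simp
  then show False using M unfolding jacobson_radical_def by blast
qed

section \<open>The resolvent of an element of the radical\<close>

locale comm_radical_element = banach_algebra V for V :: "('a, 'm) cnalg_scheme" +
  fixes x :: 'a
  assumes comm: "commutative V" and x_rad: "x \<in> jacobson_radical V"
begin

lemma xV [simp]: "x \<in> carr V"
  using x_rad by (simp add: jacobson_radical_def)

lemma comm': "\<lbrakk>a \<in> carr V; b \<in> carr V\<rbrakk> \<Longrightarrow> a \<otimes> b = b \<otimes> a"
  using comm unfolding commutative_def by blast

text \<open>The radical gives a quasi-inverse \<open>q\<close> of \<open>l \<odot> x\<close>; then
  \<open>x \<oplus> q \<otimes> x\<close> solves the equation. No division by \<open>l\<close>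
  occurs, so \<open>l = 0\<close> is covered.\<close>

lemma ex_resolvent: "\<exists>p\<in>carr V. p = x \<oplus> l \<odot> (p \<otimes> x)"
proof -
  have "l \<odot> x \<in> jacobson_radical V"
    using x_rad maximal_ideal ideal_scale unfolding jacobson_radical_def by simp
  then obtain q where q: "q \<in> carr V" "q \<ominus> q \<otimes> (l \<odot> x) = l \<odot> x"
    using jacobson_quasi_inverse by blast
  have "q = (q \<ominus> q \<otimes> (l \<odot> x)) \<oplus> q \<otimes> (l \<odot> x)" using q(1) by simp
  also have "\<dots> = l \<odot> (x \<oplus> q \<otimes> x)" using q by (simp add: scale_add_right)
  finally have "q = l \<odot> (x \<oplus> q \<otimes> x)" .
  then have "x \<oplus> q \<otimes> x = x \<oplus> l \<odot> ((x \<oplus> q \<otimes> x) \<otimes> x)"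
    using q(1) by (metis add_closed mult_closed mult_scale_left xV)
  then show ?thesis using q(1) by (intro bexI[of _ "x \<oplus> q \<otimes> x"]) simp_all
qed

text \<open>This is \<open>x\<close> times the inverse of \<open>1 - l x\<close>, with power series
  coefficients \<open>pw x k\<close>, characterised by an equation that makes sense without a
  unit.\<close>

definition p :: "complex \<Rightarrow> 'a" where
  "p l = (SOME p. p \<in> carr V \<and> p = x \<oplus> l \<odot> (p \<otimes> x))"

lemma p_props: "p l \<in> carr V \<and> p l = x \<oplus> l \<odot> (p l \<otimes> x)"
  unfolding p_def by (rule someI_ex) (use ex_resolvent[of l] in blast)

lemma p_closed [simp]: "p l \<in> carr V"
  using p_props by blast

lemma p_eq: "p l = x \<oplus> l \<odot> (p l \<otimes> x)"
  using p_props by blast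

text \<open>The product \<open>?Q\<close> is expanded once through the equation of
  \<open>p l\<close> and once, by commutativity, through that of \<open>p m\<close>. Scaled by
  \<open>m\<close> and \<open>l\<close>, the expansions share the term with coefficient
  \<open>m * l\<close>, which cancels.\<close>

lemma resolvent_identity: "p m \<ominus> p l = (m - l) \<odot> (p m \<otimes> p l)"
proof -
  let ?Q = "p m \<otimes> p l"
  have "?Q = p m \<otimes> (x \<oplus> l \<odot> (p l \<otimes> x))" using p_eq[of l] by simp
  also have "\<dots> = p m \<otimes> x \<oplus> l \<odot> (?Q \<otimes> x)" by (simp add: distrib_left mult_assoc)
  finally have 1: "?Q = p m \<otimes> x \<oplus> l \<odot> (?Q \<otimes> x)" .
  have "p l \<otimes> p m = p l \<otimes> (x \<oplus> m \<odot> (p m \<otimes> x))" using p_eq[of m] by simp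
  also have "\<dots> = p l \<otimes> x \<oplus> m \<odot> ((p l \<otimes> p m) \<otimes> x)" by (simp add: distrib_left mult_assoc)
  finally have 2: "?Q = p l \<otimes> x \<oplus> m \<odot> (?Q \<otimes> x)"
    unfolding comm'[OF p_closed[of l] p_closed[of m]] .
  have m1: "m \<odot> ?Q = m \<odot> (p m \<otimes> x) \<oplus> (m * l) \<odot> (?Q \<otimes> x)"
    by (subst 1) (simp add: scale_add_right)
  have l2: "l \<odot> ?Q = l \<odot> (p l \<otimes> x) \<oplus> (m * l) \<odot> (?Q \<otimes> x)"
    by (subst 2) (simp add: scale_add_right mult.commute)
  have "p m \<ominus> p l = (x \<oplus> m \<odot> (p m \<otimes> x)) \<ominus> (x \<oplus> l \<odot> (p l \<otimes> x))"
    using p_eq[of m] p_eq[of l] by simp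
  also have "\<dots> = m \<odot> (p m \<otimes> x) \<ominus> l \<odot> (p l \<otimes> x)"
    by (simp add: sub_add_sub)
  also have "\<dots> = m \<odot> ?Q \<ominus> l \<odot> ?Q"
    by (simp add: m1 l2 sub_add_sub del: mult_scale_left mult_scale_right)
  also have "\<dots> = (m - l) \<odot> ?Q"
    using scale_add_left[of ?Q m "-l"] by (simp add: vsub_def)
  finally show ?thesis .
qed

lemma p_diff_le: "nrm V (p m \<ominus> p l) \<le> cmod (m - l) * (nrm V (p m) * nrm V (p l))"
  unfolding resolvent_identity by (simp add: nrm_scale mult_left_mono nrm_mult)

text \<open>The resolvent identity bounds \<open>nrm V (p m)\<close> by \<open>nrm V (p l)\<close>
  plus half of itself, and that half is absorbed.\<close>

lemma p_locally_bounded: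
  assumes "cmod (m - l) * nrm V (p l) \<le> 1/2"
  shows "nrm V (p m) \<le> 2 * nrm V (p l)"
proof -
  have "nrm V (p m) \<le> nrm V (p l) + nrm V (p m \<ominus> p l)" by (rule nrm_le_sub) simp_all
  also have "nrm V (p m \<ominus> p l) \<le> (cmod (m - l) * nrm V (p l)) * nrm V (p m)"
    using p_diff_le[of m l] by (simp add: mult_ac)
  also have "\<dots> \<le> 1/2 * nrm V (p m)" using assms by (intro mult_right_mono) simp_all
  finally show ?thesis by simp
qed

lemma p_continuous: "((\<lambda>m. nrm V (p m \<ominus> p l)) \<longlongrightarrow> 0) (at l)"
proof (rule tendsto_sandwich[OF _ _ tendsto_const])
  show "\<forall>\<^sub>F m in at l. 0 \<le> nrm V (p m \<ominus> p l)" by simp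
  have "((\<lambda>m. cmod (m - l) * nrm V (p l)) \<longlongrightarrow> cmod (l - l) * nrm V (p l)) (at l)"
    by (intro tendsto_intros)
  then have "\<forall>\<^sub>F m in at l. cmod (m - l) * nrm V (p l) < 1/2"
    by (rule order_tendstoD) simp
  then show "\<forall>\<^sub>F m in at l. nrm V (p m \<ominus> p l) \<le> cmod (m - l) * (2 * nrm V (p l) * nrm V (p l))"
  proof eventually_elim
    case (elim m)
    have "nrm V (p m \<ominus> p l) \<le> cmod (m - l) * (nrm V (p m) * nrm V (p l))" by (rule p_diff_le)
    also have "\<dots> \<le> cmod (m - l) * (2 * nrm V (p l) * nrm V (p l))"
      using p_locally_bounded[of m l] elim by (intro mult_left_mono mult_right_mono) simp_all
    finally show ?case .
  qed
  have "((\<lambda>m. cmod (m - l) * (2 * nrm V (p l) * nrm V (p l))) \<longlongrightarrow> cmod (l - l) * (2 * nrm V (p l) * nrm V (p l))) (at l)"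
    by (intro tendsto_intros)
  then show "((\<lambda>m. cmod (m - l) * (2 * nrm V (p l) * nrm V (p l))) \<longlongrightarrow> 0) (at l)" by simp
qed

lemma nrm_p_continuous: "continuous_on S (\<lambda>l. nrm V (p l))"
proof (rule continuous_at_imp_continuous_on, intro ballI)
  fix l
  have "((\<lambda>m. nrm V (p m) - nrm V (p l)) \<longlongrightarrow> 0) (at l)"
  proof (rule Lim_null_comparison[OF always_eventually p_continuous[of l]], intro allI)
    fix m
    show "norm (nrm V (p m) - nrm V (p l)) \<le> nrm V (p m \<ominus> p l)"
      using nrm_le_sub[of "p m" "p l"] nrm_le_sub[of "p l" "p m"] nrm_sub_commute[of "p l" "p m"]
      by (simp add: abs_le_iff)
  qed
  then show "isCont (\<lambda>l. nrm V (p l)) l"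
    unfolding isCont_def by (rule LIM_zero_cancel)
qed

text \<open>The difference quotient is \<open>\<phi> (p m \<otimes> p l)\<close> by the resolvent
  identity, and \<open>p\<close> is continuous. So \<open>\<phi>\<close> composed with
  \<open>p\<close> is entire.\<close>

lemma p_derivative:
  assumes \<phi>: "\<phi> \<in> carr (dual V)"
  shows "((\<lambda>l. \<phi> (p l)) has_field_derivative \<phi> (p l \<otimes> p l)) (at l)"
  unfolding has_field_derivative_iff
proof (rule Lim_transform_eventually)
  show "\<forall>\<^sub>F m in at l. \<phi> (p m \<otimes> p l) = (\<phi> (p m) - \<phi> (p l)) / (m - l)"
  proof (rule eventually_mono[OF eventually_neq_at_within[of l l]])
    fix m assume "m \<noteq> l"
    have "\<phi> (p m) - \<phi> (p l) = (m - l) * \<phi> (p m \<otimes> p l)"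
      using \<phi> by (simp add: resolvent_identity dual_scale flip: dual_sub)
    then show "\<phi> (p m \<otimes> p l) = (\<phi> (p m) - \<phi> (p l)) / (m - l)"
      using \<open>m \<noteq> l\<close> by simp
  qed
  have "((\<lambda>m. nrm (dual V) \<phi> * (nrm V (p m \<ominus> p l) * nrm V (p l))) \<longlongrightarrow> nrm (dual V) \<phi> * (0 * nrm V (p l))) (at l)"
    by (intro tendsto_intros p_continuous)
  then have lim: "((\<lambda>m. nrm (dual V) \<phi> * (nrm V (p m \<ominus> p l) * nrm V (p l))) \<longlongrightarrow> 0) (at l)"
    by simp
  have "((\<lambda>m. \<phi> (p m \<otimes> p l) - \<phi> (p l \<otimes> p l)) \<longlongrightarrow> 0) (at l)"
  proof (rule Lim_null_comparison[OF always_eventually lim], intro allI)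
    fix m
    have "\<phi> (p m \<otimes> p l) - \<phi> (p l \<otimes> p l) = \<phi> ((p m \<ominus> p l) \<otimes> p l)"
      using \<phi> by (simp add: mult_sub_left dual_sub)
    also have "norm \<dots> \<le> nrm (dual V) \<phi> * nrm V ((p m \<ominus> p l) \<otimes> p l)"
      using \<phi> by (intro dual_bound) simp_all
    also have "\<dots> \<le> nrm (dual V) \<phi> * (nrm V (p m \<ominus> p l) * nrm V (p l))"
      using \<phi> by (intro mult_left_mono nrm_mult dual_ge_0) simp_all
    finally show "norm (\<phi> (p m \<otimes> p l) - \<phi> (p l \<otimes> p l)) \<le> nrm (dual V) \<phi> * (nrm V (p m \<ominus> p l) * nrm V (p l))" .
  qed
  then show "((\<lambda>m. \<phi> (p m \<otimes> p l)) \<longlongrightarrow> \<phi> (p l \<otimes> p l)) (at l)"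
    by (rule LIM_zero_cancel)
qed

lemma x_pw: "x \<otimes> pw x n = pw x (Suc n)"
  using comm'[of x "pw x n"] by simp

text \<open>Substituting the equation of \<open>p l\<close> into its own remainder; this finite form
  holds for all \<open>l\<close>.\<close>

lemma p_expansion:
  assumes \<phi>: "\<phi> \<in> carr (dual V)"
  shows "\<phi> (p l) = (\<Sum>k\<le>n. \<phi> (pw x k) * l ^ k) + l ^ Suc n * \<phi> (p l \<otimes> pw x n)"
proof (induction n)
  case 0
  have "\<phi> (p l) = \<phi> (x \<oplus> l \<odot> (p l \<otimes> x))" using p_eq[of l] by simp
  then show ?case using \<phi> by (simp add: dual_add dual_scale)
next
  case (Suc n)
  have "p l \<otimes> pw x n = (x \<oplus> l \<odot> (p l \<otimes> x)) \<otimes> pw x n" using p_eq[of l] by simp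
  also have "\<dots> = pw x (Suc n) \<oplus> l \<odot> (p l \<otimes> pw x (Suc n))"
    by (simp add: distrib_right mult_assoc x_pw del: pw.simps)
  finally have "\<phi> (p l \<otimes> pw x n) = \<phi> (pw x (Suc n)) + l * \<phi> (p l \<otimes> pw x (Suc n))"
    using \<phi> by (simp add: dual_add dual_scale del: pw.simps)
  then show ?case
    unfolding Suc.IH by (simp add: algebra_simps del: pw.simps)
qed

lemma p_sums:
  assumes \<phi>: "\<phi> \<in> carr (dual V)" and l: "cmod l * nrm V x < 1"
  shows "(\<lambda>k. \<phi> (pw x k) * l ^ k) sums \<phi> (p l)"
proof -
  let ?r = "cmod l * nrm V x"
  have "(\<lambda>n. nrm (dual V) \<phi> * nrm V (p l) * ?r ^ Suc n) \<longlonglongrightarrow> nrm (dual V) \<phi> * nrm V (p l) * 0"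
    using l by (intro tendsto_mult_left LIMSEQ_Suc LIMSEQ_power_zero) simp
  then have lim: "(\<lambda>n. nrm (dual V) \<phi> * nrm V (p l) * ?r ^ Suc n) \<longlonglongrightarrow> 0" by simp
  have "(\<lambda>n. l ^ Suc n * \<phi> (p l \<otimes> pw x n)) \<longlonglongrightarrow> 0"
  proof (rule Lim_null_comparison[OF always_eventually lim], intro allI)
    fix n
    have "cmod (\<phi> (p l \<otimes> pw x n)) \<le> nrm (dual V) \<phi> * nrm V (p l \<otimes> pw x n)"
      using \<phi> by (intro dual_bound) simp_all
    also have "\<dots> \<le> nrm (dual V) \<phi> * (nrm V (p l) * nrm V (pw x n))"
      using \<phi> by (intro mult_left_mono nrm_mult dual_ge_0) simp_all
    also have "\<dots> \<le> nrm (dual V) \<phi> * (nrm V (p l) * nrm V x ^ Suc n)"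
      using \<phi> by (intro mult_left_mono nrm_pw_le dual_ge_0 nrm_ge_0) simp_all
    finally have "cmod l ^ Suc n * cmod (\<phi> (p l \<otimes> pw x n)) \<le>
        cmod l ^ Suc n * (nrm (dual V) \<phi> * (nrm V (p l) * nrm V x ^ Suc n))"
      by (rule mult_left_mono) simp
    then show "norm (l ^ Suc n * \<phi> (p l \<otimes> pw x n)) \<le> nrm (dual V) \<phi> * nrm V (p l) * ?r ^ Suc n"
      by (simp add: norm_mult norm_power power_mult_distrib mult_ac)
  qed
  then have "(\<lambda>n. \<phi> (p l) - l ^ Suc n * \<phi> (p l \<otimes> pw x n)) \<longlonglongrightarrow> \<phi> (p l) - 0"
    by (intro tendsto_diff tendsto_const)
  moreover have "\<phi> (p l) - l ^ Suc n * \<phi> (p l \<otimes> pw x n) = (\<Sum>k\<le>n. \<phi> (pw x k) * l ^ k)" for n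
    using p_expansion[OF \<phi>, of l n] by (simp add: algebra_simps)
  ultimately show ?thesis
    by (simp add: sums_def_le)
qed

text \<open>The power series is known to represent \<open>\<phi> (p l)\<close> only for small
  \<open>l\<close>. That determines the Taylor coefficients at zero, and since the function is
  entire, Cauchy's inequality bounds them on a circle of any radius.\<close>

lemma coefficient_bound:
  assumes \<phi>: "\<phi> \<in> carr (dual V)" and R: "R > 0" and C: "\<And>l. cmod l = R \<Longrightarrow> nrm V (p l) \<le> C"
  shows "cmod (\<phi> (pw x n)) \<le> nrm (dual V) \<phi> * C / R ^ n"
proof -
  define g where "g l = \<phi> (p l)" for l
  define F where "F = Abs_fps (\<lambda>n. \<phi> (pw x n))"
  have hol: "g holomorphic_on S" for S
    unfolding g_def by (intro holomorphic_onI) (use p_derivative[OF \<phi>] has_field_derivative_at_within field_differentiable_def in blast)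
  \<comment> \<open>The summand \<open>1\<close> keeps the radius well defined when \<open>x\<close>
    has norm zero.\<close>
  define \<rho> where "\<rho> = 1 / (nrm V x + 1)"
  have \<rho>: "\<rho> > 0" using nrm_ge_0[OF xV] by (simp add: \<rho>_def add_nonneg_pos)
  have small: "cmod l * nrm V x < 1" if "cmod l < \<rho>" for l
  proof -
    have "cmod l * nrm V x \<le> cmod l * (nrm V x + 1)" by (simp add: mult_left_mono)
    also have "\<dots> < 1" using that nrm_ge_0[OF xV] by (simp add: \<rho>_def pos_less_divide_eq add_nonneg_pos)
    finally show ?thesis .
  qed
  have sums: "(\<lambda>k. fps_nth F k * l ^ k) sums g l" if "cmod l < \<rho>" for l
    using p_sums[OF \<phi> small[OF that]] by (simp add: F_def g_def)
  have "g has_fps_expansion F"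
    unfolding has_fps_expansion_def
  proof
    have "conv_radius (fps_nth F) \<ge> norm (of_real (\<rho>/2) :: complex)"
      using sums[of "of_real (\<rho>/2)"] \<rho> by (intro conv_radius_geI) (simp add: sums_iff)
    moreover have "norm (of_real (\<rho>/2) :: complex) > 0" using \<rho> by simp
    ultimately show "fps_conv_radius F > 0"
      unfolding fps_conv_radius_def by (metis ereal_less(2) less_le_trans)
    have "\<forall>\<^sub>F l in nhds 0. l \<in> ball 0 \<rho>" using \<rho> by (intro eventually_nhds_in_open) simp_all
    then show "\<forall>\<^sub>F z in nhds 0. eval_fps F z = g z"
      by (rule eventually_mono) (use sums in \<open>simp add: eval_fps_def sums_iff\<close>)
  qed
  then have "fps_expansion g 0 = F" by (rule fps_expansion_eqI)
  then have coeff: "(deriv ^^ n) g 0 / fact n = \<phi> (pw x n)"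
    by (metis F_def fps_expansion_def fps_nth_Abs_fps)
  have "norm ((deriv ^^ n) g 0) \<le> fact n * (nrm (dual V) \<phi> * C) / R ^ n"
  proof (rule Cauchy_inequality[OF hol holomorphic_on_imp_continuous_on[OF hol] R])
    fix l assume "cmod (0 - l) = R"
    then have "nrm V (p l) \<le> C" using C by simp
    then have "nrm (dual V) \<phi> * nrm V (p l) \<le> nrm (dual V) \<phi> * C"
      using dual_ge_0[OF \<phi>] by (intro mult_left_mono)
    then show "norm (g l) \<le> nrm (dual V) \<phi> * C"
      using dual_bound[OF \<phi>, of "p l"] by (simp add: g_def)
  qed
  then show ?thesis
    unfolding coeff[symmetric] by (simp add: norm_divide field_simps)
qed

text \<open>\<open>C\<close> bounds the resolvent on a circle and does not depend on
  \<open>\<phi>\<close>, so the coefficient bounds combine to a bound on the bidual norm of the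
  embedded powers.\<close>

lemma emb_in_bidual_radical:
  assumes "commutative (bidual V)"
  shows "emb V x \<in> jacobson_radical (bidual V)"
proof -
  interpret B: banach_algebra "bidual V" by (rule bidual_algebra)
  show ?thesis
  proof (rule B.quasinilpotent_in_radical[OF assms])
    show "emb V x \<in> carr (bidual V)" by simp
    fix K :: real assume K: "K \<ge> 0"
    \<comment> \<open>Any radius larger than \<open>K\<close> will do, as it makes
      \<open>K / R\<close> smaller than one.\<close>
    define R where "R = K + 1"
    have R: "R > 0" using K by (simp add: R_def)
    have "compact ((\<lambda>l. nrm V (p l)) ` sphere 0 R)"
      by (intro compact_continuous_image nrm_p_continuous) simp
    then have "bounded ((\<lambda>l. nrm V (p l)) ` sphere 0 R)" by (rule compact_imp_bounded)
    then obtain C where "\<forall>y\<in>(\<lambda>l. nrm V (p l)) ` sphere 0 R. norm y \<le> C"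
      unfolding bounded_iff by blast
    then have C: "\<bar>nrm V (p l)\<bar> \<le> C" if "cmod l = R" for l
      using that by simp
    have C': "nrm V (p l) \<le> C" if "cmod l = R" for l using C[OF that] by simp
    have C0: "C \<ge> 0" using order_trans[OF abs_ge_zero C[of "of_real R"]] R by simp
    have le: "nrm (bidual V) (emb V (pw x n)) \<le> C / R ^ n" for n
    proof -
      have "cmod (emb V (pw x n) \<phi>) \<le> C / R ^ n * nrm (dual V) \<phi>" if "\<phi> \<in> carr (dual V)" for \<phi>
        using coefficient_bound[OF that R C', of n] that by (simp add: mult.commute)
      then show ?thesis using C0 R by (simp add: bidual_nrm_le)
    qed
    have "(\<lambda>n. K * C * (K / R) ^ n) \<longlonglongrightarrow> K * C * 0"
      using K R by (intro tendsto_mult_left LIMSEQ_power_zero) (simp add: R_def)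
    then have "\<forall>\<^sub>F n in sequentially. K * C * (K / R) ^ n < 1"
      by (rule order_tendstoD) simp
    then obtain n where n: "K * C * (K / R) ^ n < 1"
      by (meson eventually_sequentially order.refl)
    have "K ^ Suc n * nrm (bidual V) (B.pw (emb V x) n) \<le> K ^ Suc n * (C / R ^ n)"
      using K le[of n] by (intro mult_left_mono) (simp_all add: pw_emb)
    also have "\<dots> = K * C * (K / R) ^ n" by (simp add: power_divide)
    finally show "\<exists>n. K ^ Suc n * nrm (bidual V) (B.pw (emb V x) n) < 1"
      using n by (intro exI[of _ n]) simp
  qed
qed

end

lemma (in banach_algebra) semisimple_of_bidual:
  assumes sep: separated and ss: "semisimple (bidual V)" and comm: "commutative (bidual V)"
  shows "semisimple V"
proof -
  interpret B: banach_algebra "bidual V" by (rule bidual_algebra)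
  have "commutative V"
    unfolding commutative_def
  proof (intro ballI)
    fix a b assume ab: "a \<in> carr V" "b \<in> carr V"
    have "emb V (a \<otimes> b) = emb V (b \<otimes> a)"
      using comm ab by (simp add: commutative_def flip: emb_mult)
    then have "\<phi> (a \<otimes> b) = \<phi> (b \<otimes> a)" if "\<phi> \<in> carr (dual V)" for \<phi>
      using that by (metis emb_app)
    then have "\<phi> (a \<otimes> b \<ominus> b \<otimes> a) = 0" if "\<phi> \<in> carr (dual V)" for \<phi>
      using that ab by (simp add: dual_sub)
    then have "a \<otimes> b \<ominus> b \<otimes> a = \<zero>"
      using bspec[OF sep[unfolded separated_def], of "a \<otimes> b \<ominus> b \<otimes> a"] ab by auto
    then show "a \<otimes> b = b \<otimes> a" by (rule sub_eq_zeroD) (use ab in simp_all)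
  qed
  have "x = \<zero>" if x: "x \<in> jacobson_radical V" for x
  proof -
    interpret R: comm_radical_element V x
      by unfold_locales (fact \<open>commutative V\<close> x)+
    have "emb V x = vzero (dual (dual V))"
      using R.emb_in_bidual_radical[OF comm] ss by (simp add: semisimple_def)
    then show ?thesis by (rule emb_eq_zeroD[OF sep R.xV])
  qed
  moreover have "\<zero> \<in> jacobson_radical V"
    using ideal_zero[OF maximal_ideal] by (simp add: jacobson_radical_def)
  ultimately show ?thesis unfolding semisimple_def by blast
qed

section \<open>Approximate identities and the bidual\<close>

text \<open>A weak* cluster point of a bounded right approximate identity is a right identity of the
  bidual. Here it is a Hahn--Banach limit.\<close>

lemma (in nalgebra) bidual_not_radical:
  assumes sep: separated and e: "\<And>n. e n \<in> carr V" "\<And>n. nrm V (e n) \<le> 1"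
    and lim: "\<And>a. a \<in> carr V \<Longrightarrow> tendsto_nrm (\<lambda>n. a \<otimes> e n) a" and x: "x \<in> carr V" "x \<noteq> \<zero>"
  shows "\<not> radical_algebra (bidual V)"
proof
  assume rad: "radical_algebra (bidual V)"
  interpret B: banach_algebra "bidual V" by (rule bidual_algebra)
  interpret D: banach "dual V" by (rule dual_banach)
  \<comment> \<open>Up to boundary points, the epigraph of the upper limit of
    \<open>Re (\<phi> (e n))\<close>, a sublinear functional on the dual.\<close>
  define C where "C = {(\<phi>, r). \<phi> \<in> carr (dual V) \<and> (\<forall>\<^sub>F n in sequentially. Re (\<phi> (e n)) \<le> r)}"
  have CI: "(\<phi>, r) \<in> C" if "\<phi> \<in> carr (dual V)" "\<forall>\<^sub>F n in sequentially. Re (\<phi> (e n)) \<le> r" for \<phi> r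
    using that by (simp add: C_def)
  have CD: "\<phi> \<in> carr (dual V)" "\<forall>\<^sub>F n in sequentially. Re (\<phi> (e n)) \<le> r" if "(\<phi>, r) \<in> C" for \<phi> r
    using that by (simp_all add: C_def)
  have cone: "D.epi_cone C"
    unfolding D.epi_cone_def
  proof (intro conjI allI impI)
    show "C \<subseteq> carr (dual V) \<times> UNIV" using CD(1) by auto
    show "(vzero (dual V), 0) \<in> C" by (rule CI) (use e in simp_all)
    show "0 \<le> r" if "(vzero (dual V), r) \<in> C" for r
      using CD(2)[OF that] e(1) by simp
    show "(vadd (dual V) \<phi> \<psi>, r + s) \<in> C" if "(\<phi>, r) \<in> C" "(\<psi>, s) \<in> C" for \<phi> r \<psi> s
    proof (rule CI)
      show "\<forall>\<^sub>F n in sequentially. Re (vadd (dual V) \<phi> \<psi> (e n)) \<le> r + s"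
        using CD(2)[OF that(1)] CD(2)[OF that(2)] by eventually_elim (use e(1) in simp)
    qed (use that CD(1) in simp)
    show "(vscale (dual V) (of_real t) \<phi>, t * r) \<in> C" if "0 < t" "(\<phi>, r) \<in> C" for t \<phi> r
    proof (rule CI)
      show "\<forall>\<^sub>F n in sequentially. Re (vscale (dual V) (of_real t) \<phi> (e n)) \<le> t * r"
        using CD(2)[OF that(2)] by eventually_elim (use e(1) that(1) in simp)
    qed (use that CD(1) in simp)
  qed
  have nC: "(\<phi>, nrm (dual V) \<phi>) \<in> C" if \<phi>: "\<phi> \<in> carr (dual V)" for \<phi>
  proof (rule CI[OF \<phi>], intro always_eventually allI)
    fix n
    have "Re (\<phi> (e n)) \<le> cmod (\<phi> (e n))" by (rule complex_Re_le_cmod)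
    also have "\<dots> \<le> nrm (dual V) \<phi> * nrm V (e n)" using \<phi> e(1) by (rule dual_bound)
    also have "\<dots> \<le> nrm (dual V) \<phi> * 1" using dual_ge_0[OF \<phi>] e(2) by (intro mult_left_mono)
    finally show "Re (\<phi> (e n)) \<le> nrm (dual V) \<phi>" by simp
  qed
  obtain f where f: "\<And>x y. \<lbrakk>x \<in> carr (dual V); y \<in> carr (dual V)\<rbrakk> \<Longrightarrow> f (vadd (dual V) x y) = f x + f y"
    "\<And>t x. x \<in> carr (dual V) \<Longrightarrow> f (vscale (dual V) (of_real t) x) = t * f x"
    and fC: "\<And>x r. (x, r) \<in> C \<Longrightarrow> f x \<le> r"
    using D.hahn_banach_cone[OF cone] nC by metis
  have fneg: "f (vscale (dual V) (-1) \<phi>) = - f \<phi>" if "\<phi> \<in> carr (dual V)" for \<phi>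
    using f(2)[OF that, of "-1"] by simp
  have fle: "\<bar>f \<phi>\<bar> \<le> nrm (dual V) \<phi>" if "\<phi> \<in> carr (dual V)" for \<phi>
    using fC[OF nC[OF that]] fC[OF nC[OF dual_scale_closed[OF that, of "-1"]]] fneg[OF that] D.nrm_scale[OF that, of "-1"]
    by simp
  define F where "F \<phi> = Complex (f \<phi>) (- f (vscale (dual V) \<i> \<phi>))" for \<phi>
  have F1: "F (vscale (dual V) c \<phi>) = c * F \<phi>" if "\<phi> \<in> carr (dual V)" for c \<phi>
    by (rule D.complexify(1)[of f]) (fact f F_def that)+
  have F2: "F (vadd (dual V) \<phi> \<psi>) = F \<phi> + F \<psi>" if "\<phi> \<in> carr (dual V)" "\<psi> \<in> carr (dual V)" for \<phi> \<psi>
    by (rule D.complexify(2)[of f]) (fact f F_def that)+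
  define E where "E = restrict F (carr (dual V))"
  have E: "E \<in> carr (dual (dual V))"
  proof (rule bidualI[where K = 2])
    fix \<phi> assume \<phi>: "\<phi> \<in> carr (dual V)"
    have "cmod (F \<phi>) \<le> \<bar>f \<phi>\<bar> + \<bar>f (vscale (dual V) \<i> \<phi>)\<bar>"
      unfolding F_def using cmod_le[of "Complex (f \<phi>) (- f (vscale (dual V) \<i> \<phi>))"] by simp
    also have "\<dots> \<le> 2 * nrm (dual V) \<phi>"
      using fle[OF \<phi>] fle[OF dual_scale_closed[OF \<phi>, of \<i>]] D.nrm_scale[OF \<phi>, of \<i>] by simp
    finally show "cmod (E \<phi>) \<le> 2 * nrm (dual V) \<phi>" using \<phi> by (simp add: E_def)
    show "E (vscale (dual V) c \<phi>) = c * E \<phi>" for c using F1[OF \<phi>] \<phi> by (simp add: E_def)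
    show "E (vadd (dual V) \<phi> \<psi>) = E \<phi> + E \<psi>" if "\<psi> \<in> carr (dual V)" for \<psi>
      using F2[OF \<phi> that] \<phi> that by (simp add: E_def)
  qed (simp add: E_def)
  \<comment> \<open>A functional below the upper limit also lies above the lower limit, by oddness,
    so it agrees with the limit wherever that exists.\<close>
  have f_lim_le: "f \<phi> \<le> Re c" if \<phi>: "\<phi> \<in> carr (dual V)" and l: "(\<lambda>n. \<phi> (e n)) \<longlonglongrightarrow> c" for \<phi> c
  proof (rule field_le_epsilon)
    fix d :: real assume "d > 0"
    then have "\<forall>\<^sub>F n in sequentially. Re (\<phi> (e n)) < Re c + d"
      by (intro order_tendstoD(2)[OF tendsto_Re[OF l]]) simp
    then have "\<forall>\<^sub>F n in sequentially. Re (\<phi> (e n)) \<le> Re c + d"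
      by (rule eventually_mono) simp
    then show "f \<phi> \<le> Re c + d" by (intro fC CI \<phi>)
  qed
  have f_lim: "f \<phi> = Re c" if \<phi>: "\<phi> \<in> carr (dual V)" and l: "(\<lambda>n. \<phi> (e n)) \<longlonglongrightarrow> c" for \<phi> c
  proof -
    have "(\<lambda>n. vscale (dual V) (-1) \<phi> (e n)) \<longlonglongrightarrow> - c"
      using tendsto_minus[OF l] e(1) by simp
    then show ?thesis
      using f_lim_le[OF \<phi> l] f_lim_le[OF dual_scale_closed[OF \<phi>, of "-1"]] fneg[OF \<phi>] by fastforce
  qed
  have E_lim: "E \<phi> = c" if \<phi>: "\<phi> \<in> carr (dual V)" and l: "(\<lambda>n. \<phi> (e n)) \<longlonglongrightarrow> c" for \<phi> c
  proof -
    have "(\<lambda>n. vscale (dual V) \<i> \<phi> (e n)) \<longlonglongrightarrow> \<i> * c"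
      using tendsto_mult_left[OF l, of \<i>] e(1) by simp
    then have "f (vscale (dual V) \<i> \<phi>) = - Im c"
      using f_lim[OF dual_scale_closed[OF \<phi>, of \<i>]] by simp
    then show ?thesis
      using f_lim[OF \<phi> l] \<phi> by (simp add: E_def F_def complex_eq_iff)
  qed
  \<comment> \<open>Here \<open>rmul V \<phi> a\<close> is evaluated along \<open>e n\<close>, and
    \<open>a \<otimes> e n\<close> tends to \<open>a\<close>. It makes
    \<open>lact V E \<phi> = \<phi>\<close>, whence \<open>E\<close> is a right identity.\<close>
  have E_rmul: "E (rmul V \<phi> a) = \<phi> a" if "\<phi> \<in> carr (dual V)" "a \<in> carr V" for \<phi> a
    using that e(1) dual_tendsto[OF that(1) lim[OF that(2)]] by (intro E_lim) simp_all
  have right: "arens V G E = G" if G: "G \<in> carr (dual (dual V))" for G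
  proof (rule bidual_eqI)
    fix \<phi> assume \<phi>: "\<phi> \<in> carr (dual V)"
    have "lact V E \<phi> = \<phi>"
      using \<phi> E E_rmul by (intro dual_eqI) simp_all
    then show "arens V G E \<phi> = G \<phi>" using \<phi> by simp
  qed (use G E in simp_all)
  \<comment> \<open>With a right identity even the zero ideal is modular, and it is proper because
    \<open>E\<close> is nonzero.\<close>
  have z: "left_ideal (bidual V) {vzero (bidual V)}"
    by (rule B.left_idealI) (simp_all add: B.zero_add[simplified] B.scale_zero_right[simplified] B.mult_zero_right[simplified] B.zero_closed[simplified])
  obtain \<phi> where \<phi>: "\<phi> \<in> carr (dual V)" "\<phi> x \<noteq> 0"
    using sep x unfolding separated_def by blast
  have n1: "E \<notin> {vzero (bidual V)}"
    using E_rmul[OF \<phi>(1) x(1)] \<phi> x(1) by auto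
  have n2: "vsub (bidual V) G (amult (bidual V) G E) \<in> {vzero (bidual V)}" if "G \<in> carr (bidual V)" for G
    using right[of G] B.sub_self[OF that] that by simp
  obtain M where M: "maximal_modular_left_ideal (bidual V) M" "E \<notin> M"
    using B.ex_maximal_modular[OF z _ n2 n1] E by auto
  have "E \<in> jacobson_radical (bidual V)"
    using rad E unfolding radical_algebra_def by simp
  then show False using M unfolding jacobson_radical_def by blast
qed

section \<open>The sequence space as a space of functions on the reals\<close>

definition l2 :: "(nat \<Rightarrow> complex) \<Rightarrow> bool" where
  "l2 c \<longleftrightarrow> summable (\<lambda>n. (cmod (c n))\<^sup>2)"

definition nrm2 :: "(nat \<Rightarrow> complex) \<Rightarrow> real" where
  "nrm2 c = sqrt (\<Sum>n. (cmod (c n))\<^sup>2)"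

definition seq_of :: "(real \<Rightarrow> complex) \<Rightarrow> nat \<Rightarrow> complex" where
  "seq_of f n = f (real n)"

definition fun_of :: "(nat \<Rightarrow> complex) \<Rightarrow> real \<Rightarrow> complex" where
  "fun_of c x = (if x \<in> \<nat> then c (nat \<lfloor>x\<rfloor>) else 0)"

text \<open>Sequences are encoded as functions that vanish off \<open>\<nat>\<close>, to fit the
  vector type fixed in the existence statements; the vanishing makes the encoding unique.\<close>

definition ell2 :: "(real \<Rightarrow> complex) cinner_space" where
  "ell2 = \<lparr>carr = {f. (\<forall>x. x \<notin> \<nat> \<longrightarrow> f x = 0) \<and> l2 (seq_of f)},
     vadd = (\<lambda>f g x. f x + g x), vzero = (\<lambda>x. 0), vscale = (\<lambda>c f x. c * f x),
     cinner = (\<lambda>f g. \<Sum>n. f (real n) * cnj (g (real n)))\<rparr>"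

lemma seq_of_fun_of [simp]: "seq_of (fun_of c) = c"
  by (intro ext) (simp add: seq_of_def fun_of_def)

lemma fun_of_nat [simp]: "fun_of c (real n) = c n"
  by (simp add: fun_of_def)

lemma ell2_sel:
  "f \<in> carr ell2 \<longleftrightarrow> (\<forall>x. x \<notin> \<nat> \<longrightarrow> f x = 0) \<and> l2 (seq_of f)"
  "vadd ell2 f g = (\<lambda>x. f x + g x)" "vzero ell2 = (\<lambda>x. 0)" "vscale ell2 c f = (\<lambda>x. c * f x)"
  "cinner ell2 f g = (\<Sum>n. f (real n) * cnj (g (real n)))"
  by (simp_all add: ell2_def)

lemma ell2_D: "f \<in> carr ell2 \<Longrightarrow> l2 (seq_of f)"
  by (simp add: ell2_sel)

lemma vsub_ell2: "vsub ell2 f g = (\<lambda>x. f x - g x)"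
  by (simp add: vsub_def ell2_sel)

lemma fun_of_ell2 [simp]: "fun_of c \<in> carr ell2 \<longleftrightarrow> l2 c"
  by (auto simp: ell2_sel fun_of_def)

lemma fun_of_seq_of: "f \<in> carr ell2 \<Longrightarrow> fun_of (seq_of f) = f"
  by (intro ext) (auto simp: ell2_sel fun_of_def seq_of_def elim!: Nats_cases)

lemma ell2_eqI:
  assumes "f \<in> carr ell2" "g \<in> carr ell2" "\<And>n. f (real n) = g (real n)"
  shows "f = g"
proof -
  have "seq_of f = seq_of g" using assms(3) by (intro ext) (simp add: seq_of_def)
  then show ?thesis using fun_of_seq_of assms(1,2) by metis
qed

lemma l2_add:
  assumes "l2 c" "l2 d"
  shows "l2 (\<lambda>n. c n + d n)"
proof -
  have le: "(cmod (c n + d n))\<^sup>2 \<le> 2 * (cmod (c n))\<^sup>2 + 2 * (cmod (d n))\<^sup>2" for n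
  proof -
    have "(cmod (c n + d n))\<^sup>2 \<le> (cmod (c n) + cmod (d n))\<^sup>2"
      by (intro power_mono norm_triangle_ineq) simp
    also have "\<dots> \<le> 2 * (cmod (c n))\<^sup>2 + 2 * (cmod (d n))\<^sup>2"
      using sum_squares_bound[of "cmod (c n)" "cmod (d n)"] by (simp add: power2_sum)
    finally show ?thesis .
  qed
  have sm: "summable (\<lambda>n. 2 * (cmod (c n))\<^sup>2 + 2 * (cmod (d n))\<^sup>2)"
    using assms unfolding l2_def by (intro summable_add summable_mult)
  show ?thesis
    unfolding l2_def by (rule summable_comparison_test'[OF sm, of 0]) (use le in simp)
qed

lemma l2_scale: "l2 c \<Longrightarrow> l2 (\<lambda>n. a * c n)"
  unfolding l2_def by (simp add: norm_mult power_mult_distrib summable_mult)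

lemma l2_diff: "\<lbrakk>l2 c; l2 d\<rbrakk> \<Longrightarrow> l2 (\<lambda>n. c n - d n)"
  using l2_add[of c "\<lambda>n. (-1) * d n"] l2_scale[of d "-1"] by simp

lemma l2_inner_summable:
  assumes "l2 c" "l2 d"
  shows "summable (\<lambda>n. c n * cnj (d n))"
proof (rule summable_comparison_test')
  show "summable (\<lambda>n. (cmod (c n))\<^sup>2 + (cmod (d n))\<^sup>2)"
    using assms unfolding l2_def by (intro summable_add)
  show "norm (c n * cnj (d n)) \<le> (cmod (c n))\<^sup>2 + (cmod (d n))\<^sup>2" if "n \<ge> 0" for n
    using sum_squares_bound[of "cmod (c n)" "cmod (d n)", unfolded mult.assoc]
      mult_nonneg_nonneg[OF norm_ge_zero norm_ge_zero, of "c n" "d n"]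
    unfolding norm_mult complex_mod_cnj by linarith
qed

lemma nrm2_ge_0: "l2 c \<Longrightarrow> 0 \<le> nrm2 c"
  by (simp add: nrm2_def l2_def suminf_nonneg)

lemma nrm2_sq: "l2 c \<Longrightarrow> (nrm2 c)\<^sup>2 = (\<Sum>n. (cmod (c n))\<^sup>2)"
  unfolding nrm2_def l2_def by (simp add: suminf_nonneg)

lemma cmod_le_nrm2:
  assumes "l2 c"
  shows "cmod (c n) \<le> nrm2 c"
proof -
  have "(cmod (c n))\<^sup>2 \<le> (\<Sum>n. (cmod (c n))\<^sup>2)"
    using sum_le_suminf[of "\<lambda>n. (cmod (c n))\<^sup>2" "{n}"] assms by (simp add: l2_def)
  then show ?thesis unfolding nrm2_def by (rule real_le_rsqrt)
qed

lemma ell2_inner_self: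
  assumes "f \<in> carr ell2"
  shows "cinner ell2 f f = of_real (\<Sum>n. (cmod (seq_of f n))\<^sup>2)"
proof -
  have "(\<lambda>n. (cmod (seq_of f n))\<^sup>2) sums (\<Sum>n. (cmod (seq_of f n))\<^sup>2)"
    using ell2_D[OF assms] by (simp add: l2_def summable_sums)
  then have "(\<lambda>n. complex_of_real ((cmod (seq_of f n))\<^sup>2)) sums of_real (\<Sum>n. (cmod (seq_of f n))\<^sup>2)"
    by (rule sums_of_real)
  then have "(\<lambda>n. f (real n) * cnj (f (real n))) sums of_real (\<Sum>n. (cmod (seq_of f n))\<^sup>2)"
    unfolding complex_norm_square seq_of_def .
  then show ?thesis by (simp add: ell2_sel sums_iff)
qed

lemma hnorm_ell2: "f \<in> carr ell2 \<Longrightarrow> hnorm ell2 f = nrm2 (seq_of f)"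
  by (simp add: hnorm_def ell2_inner_self nrm2_def)

interpretation ell2: inner_space ell2
proof
  show "complex_vector_space ell2"
    unfolding complex_vector_space_def
  proof (intro conjI ballI allI)
    show "vzero ell2 \<in> carr ell2" by (simp add: ell2_sel l2_def seq_of_def[abs_def])
  next
    fix f g assume "f \<in> carr ell2" "g \<in> carr ell2"
    then show "vadd ell2 f g \<in> carr ell2"
      using l2_add[of "seq_of f" "seq_of g"] by (simp add: ell2_sel seq_of_def[abs_def])
  next
    fix f c assume "f \<in> carr ell2"
    then show "vscale ell2 c f \<in> carr ell2"
      using l2_scale[of "seq_of f" c] by (simp add: ell2_sel seq_of_def[abs_def])
  next
    fix f assume "f \<in> carr ell2"
    then show "\<exists>g\<in>carr ell2. vadd ell2 f g = vzero ell2"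
      using l2_scale[of "seq_of f" "-1"]
      by (intro bexI[of _ "\<lambda>x. - f x"]) (simp_all add: ell2_sel seq_of_def[abs_def])
  qed (simp_all add: ell2_sel algebra_simps)
next
  fix f g h assume "f \<in> carr ell2" "g \<in> carr ell2" "h \<in> carr ell2"
  then show "cinner ell2 (vadd ell2 f g) h = cinner ell2 f h + cinner ell2 g h"
    using suminf_add[OF l2_inner_summable[of "seq_of f" "seq_of h"] l2_inner_summable[of "seq_of g" "seq_of h"]]
    by (simp add: ell2_sel seq_of_def distrib_right)
next
  fix f g c assume "f \<in> carr ell2" "g \<in> carr ell2"
  then show "cinner ell2 (vscale ell2 c f) g = c * cinner ell2 f g"
    using suminf_mult[OF l2_inner_summable[of "seq_of f" "seq_of g"], of c]
    by (simp add: ell2_sel seq_of_def mult.assoc)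
next
  fix f g assume "f \<in> carr ell2" "g \<in> carr ell2"
  then have "(\<lambda>n. f (real n) * cnj (g (real n))) sums cinner ell2 f g"
    using l2_inner_summable[of "seq_of f" "seq_of g"] by (simp add: ell2_sel seq_of_def summable_sums)
  then have "(\<lambda>n. cnj (f (real n) * cnj (g (real n)))) sums cnj (cinner ell2 f g)"
    by (simp only: sums_cnj)
  then show "cinner ell2 g f = cnj (cinner ell2 f g)"
    by (simp add: ell2_sel(5) sums_iff mult.commute)
next
  fix f assume f: "f \<in> carr ell2"
  then show "0 \<le> Re (cinner ell2 f f)"
    using ell2_D[OF f] by (simp add: ell2_inner_self l2_def suminf_nonneg)
  assume "cinner ell2 f f = 0"
  then have "(\<Sum>n. (cmod (seq_of f n))\<^sup>2) = 0"
    using f by (simp add: ell2_inner_self)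
  then have "seq_of f n = 0" for n
    using ell2_D[OF f] by (simp add: l2_def suminf_eq_zero_iff)
  then show "f = vzero ell2"
    using f by (intro ell2_eqI) (simp_all add: ell2_sel seq_of_def[abs_def] l2_def)
qed

interpretation ell2: hilbert ell2
proof
  interpret N: nspace "hnormed ell2" by (rule ell2.hnormed_nspace)
  have "\<exists>l\<in>carr ell2. N.tendsto_nrm f l" if "N.cauchy_nrm f" for f
  proof -
    have f: "f n \<in> carr ell2" for n
      using that by (simp add: N.cauchy_nrm_def)
    have C: "\<exists>N. \<forall>m\<ge>N. \<forall>n\<ge>N. hnorm ell2 (vsub ell2 (f m) (f n)) < e" if "e > 0" for e
      using \<open>N.cauchy_nrm f\<close> that by (simp add: N.cauchy_nrm_def)
    define c where "c k = seq_of (f k)" for k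
    have l2c: "l2 (c k)" for k using ell2_D[OF f] by (simp add: c_def)
    have hn: "hnorm ell2 (vsub ell2 (f k) (f m)) = nrm2 (\<lambda>n. c k n - c m n)" for k m
      using hnorm_ell2[OF ell2.sub_closed[OF f f], of k m] by (simp add: vsub_ell2 c_def seq_of_def[abs_def])
    have "Cauchy (\<lambda>k. c k n)" for n
    proof (rule metric_CauchyI)
      fix e :: real assume "e > 0"
      then obtain N where N: "\<forall>m\<ge>N. \<forall>n\<ge>N. hnorm ell2 (vsub ell2 (f m) (f n)) < e" using C by blast
      have "dist (c k n) (c m n) < e" if "k \<ge> N" "m \<ge> N" for k m
      proof -
        have "cmod (c k n - c m n) \<le> nrm2 (\<lambda>n. c k n - c m n)"
          by (rule cmod_le_nrm2[OF l2_diff[OF l2c l2c]])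
        also have "\<dots> < e" using N that hn by metis
        finally show ?thesis by (simp add: dist_norm)
      qed
      then show "\<exists>N. \<forall>k\<ge>N. \<forall>m\<ge>N. dist (c k n) (c m n) < e" by blast
    qed
    then have "\<exists>l. (\<lambda>k. c k n) \<longlonglongrightarrow> l" for n
      using Cauchy_convergent convergent_def by blast
    then obtain d where d: "\<And>n. (\<lambda>k. c k n) \<longlonglongrightarrow> d n" by metis
    have near: "l2 (\<lambda>n. c k n - d n) \<and> nrm2 (\<lambda>n. c k n - d n) \<le> e"
      if N: "\<forall>m\<ge>N. \<forall>n\<ge>N. hnorm ell2 (vsub ell2 (f m) (f n)) < e" and k: "k \<ge> N" and e: "e > 0" for N k e
    proof -
      \<comment> \<open>The limit in \<open>m\<close> is taken in finite partial sums, where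
        coordinatewise convergence is enough; the bound is uniform in \<open>M\<close> and so passes
        to the series.\<close>
      have part: "(\<Sum>n<M. (cmod (c k n - d n))\<^sup>2) \<le> e\<^sup>2" for M
      proof (rule LIMSEQ_le_const2)
        show "(\<lambda>m. \<Sum>n<M. (cmod (c k n - c m n))\<^sup>2) \<longlonglongrightarrow> (\<Sum>n<M. (cmod (c k n - d n))\<^sup>2)"
          by (intro tendsto_sum tendsto_power tendsto_norm tendsto_diff tendsto_const d)
        have "(\<Sum>n<M. (cmod (c k n - c m n))\<^sup>2) \<le> e\<^sup>2" if "m \<ge> N" for m
        proof -
          have "(\<Sum>n<M. (cmod (c k n - c m n))\<^sup>2) \<le> (\<Sum>n. (cmod (c k n - c m n))\<^sup>2)"
            using l2_diff[OF l2c l2c, of k m] by (intro sum_le_suminf) (simp_all add: l2_def)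
          also have "\<dots> = (nrm2 (\<lambda>n. c k n - c m n))\<^sup>2"
            by (rule nrm2_sq[symmetric, OF l2_diff[OF l2c l2c]])
          also have "\<dots> \<le> e\<^sup>2"
          proof (rule power_mono)
            show "nrm2 (\<lambda>n. c k n - c m n) \<le> e" using N that k hn[of k m] by (metis less_imp_le)
            show "0 \<le> nrm2 (\<lambda>n. c k n - c m n)" by (rule nrm2_ge_0[OF l2_diff[OF l2c l2c]])
          qed
          finally show ?thesis .
        qed
        then show "\<exists>N. \<forall>m\<ge>N. (\<Sum>n<M. (cmod (c k n - c m n))\<^sup>2) \<le> e\<^sup>2" by blast
      qed
      have l: "l2 (\<lambda>n. c k n - d n)"
        unfolding l2_def by (rule summableI_nonneg_bounded[OF _ part]) simp
      moreover have "nrm2 (\<lambda>n. c k n - d n) \<le> e"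
        unfolding nrm2_def using e suminf_le_const[OF l[unfolded l2_def] part]
        by (intro real_le_lsqrt) simp_all
      ultimately show ?thesis by blast
    qed
    obtain N1 where "\<forall>m\<ge>N1. \<forall>n\<ge>N1. hnorm ell2 (vsub ell2 (f m) (f n)) < 1" using C[of 1] by auto
    then have "l2 (\<lambda>n. c N1 n - d n)" using near[of N1 1 N1] by simp
    then have "l2 (\<lambda>n. c N1 n - (c N1 n - d n))" by (rule l2_diff[OF l2c])
    then have l2d: "l2 d" by simp
    have "N.tendsto_nrm f (fun_of d)"
      unfolding N.tendsto_nrm_def lim_sequentially
    proof (intro allI impI)
      fix e :: real assume e: "e > 0"
      then obtain N where N: "\<forall>m\<ge>N. \<forall>n\<ge>N. hnorm ell2 (vsub ell2 (f m) (f n)) < e/2"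
        using C[of "e/2"] by auto
      have "hnorm ell2 (vsub ell2 (f k) (fun_of d)) \<le> e/2" if "k \<ge> N" for k
        using near[OF N that] e hnorm_ell2[of "vsub ell2 (f k) (fun_of d)"] ell2.sub_closed[OF f, of "fun_of d" k] l2d
        by (simp add: vsub_ell2 c_def seq_of_def[abs_def])
      then show "\<exists>N. \<forall>k\<ge>N. dist (nrm (hnormed ell2) (vsub (hnormed ell2) (f k) (fun_of d))) 0 < e"
        using e ell2.hnorm_ge_0[OF ell2.sub_closed[OF f, of "fun_of d"]] l2d
        by (intro exI[of _ N]) (force simp: dist_real_def)
    qed
    then show ?thesis using l2d by (intro bexI[of _ "fun_of d"]) simp_all
  qed
  then have "Metric_space.mcomplete (carr (hnormed ell2)) (norm_dist (hnormed ell2) (nrm (hnormed ell2)))"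
    unfolding N.mcomplete_iff by simp
  moreover have "norm_dist (hnormed ell2) (nrm (hnormed ell2)) = norm_dist ell2 (hnorm ell2)"
    by (intro ext) (simp add: norm_dist_def)
  ultimately show "Metric_space.mcomplete (carr ell2) (norm_dist ell2 (hnorm ell2))" by simp
qed

section \<open>Operators on the sequence space given by banded matrices\<close>

abbreviation BL :: "((real \<Rightarrow> complex) \<Rightarrow> real \<Rightarrow> complex) cnalg" where
  "BL \<equiv> bounded_operators ell2"

interpretation BL: banach_algebra BL
  by (rule ell2.ops_algebra)

definition op_of :: "((nat \<Rightarrow> complex) \<Rightarrow> nat \<Rightarrow> complex) \<Rightarrow> (real \<Rightarrow> complex) \<Rightarrow> real \<Rightarrow> complex" where
  "op_of t = (\<lambda>f\<in>carr ell2. fun_of (t (seq_of f)))"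

lemma op_of_app: "f \<in> carr ell2 \<Longrightarrow> op_of t f = fun_of (t (seq_of f))"
  by (simp add: op_of_def)

lemma
  assumes add: "\<And>c d n. t (\<lambda>n. c n + d n) n = t c n + t d n"
    and sc: "\<And>a c n. t (\<lambda>n. a * c n) n = a * t c n"
    and bd: "\<And>c. l2 c \<Longrightarrow> l2 (t c) \<and> nrm2 (t c) \<le> K * nrm2 c"
  shows op_of_closed: "op_of t \<in> carr BL"
    and op_of_nrm: "K \<ge> 0 \<Longrightarrow> nrm BL (op_of t) \<le> K"
proof -
  have h: "hnorm ell2 (op_of t f) \<le> K * hnorm ell2 f" if f: "f \<in> carr ell2" for f
    using bd[OF ell2_D[OF f]] f by (simp add: op_of_app hnorm_ell2)
  show "op_of t \<in> carr BL"
  proof (rule ell2.opI[where K = K])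
    fix f assume f: "f \<in> carr ell2"
    show cl: "op_of t f \<in> carr ell2" using bd[OF ell2_D[OF f]] f by (simp add: op_of_app)
    show "op_of t (vscale ell2 c f) = vscale ell2 c (op_of t f)" for c
      using f cl ell2.scale_closed[OF f, of c] ell2.scale_closed[OF cl, of c] bd[OF ell2_D[OF ell2.scale_closed[OF f, of c]]]
        sc[of c "seq_of f"]
      by (intro ell2_eqI) (simp_all add: op_of_app, simp add: ell2_sel seq_of_def[abs_def])
    fix g assume g: "g \<in> carr ell2"
    have clg: "op_of t g \<in> carr ell2" using bd[OF ell2_D[OF g]] g by (simp add: op_of_app)
    show "op_of t (vadd ell2 f g) = vadd ell2 (op_of t f) (op_of t g)"
      using f g cl clg ell2.add_closed[OF f g] ell2.add_closed[OF cl clg] bd[OF ell2_D[OF ell2.add_closed[OF f g]]]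
        add[of "seq_of f" "seq_of g"]
      by (intro ell2_eqI) (simp_all add: op_of_app, simp add: ell2_sel seq_of_def[abs_def])
  qed (simp_all add: h, simp add: op_of_def)
  show "nrm BL (op_of t) \<le> K" if "K \<ge> 0"
    by (rule ell2.op_nrm_le[OF h that])
qed

text \<open>Each entry of \<open>d\<close> is controlled by three neighbouring entries of
  \<open>c\<close>, so shifting sums bounds the norm. Only the order of magnitude of the constant
  matters.\<close>

lemma banded_bound:
  assumes c: "l2 c" and le: "\<And>n. cmod (d n) \<le> K * (cmod (c (n - 1)) + cmod (c n) + cmod (c (Suc n)))"
    and K: "K \<ge> 0"
  shows "l2 d \<and> nrm2 d \<le> 4 * K * nrm2 c"
proof -
  let ?s = "\<lambda>n. (cmod (c n))\<^sup>2"
  have sm: "summable ?s" using c by (simp add: l2_def)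
  have sm1: "summable (\<lambda>n. ?s (Suc n))" using sm by (subst summable_Suc_iff)
  have sm0: "summable (\<lambda>n. ?s (n - 1))"
    by (subst summable_Suc_iff[symmetric]) (use sm in simp)
  let ?S = "\<Sum>n. ?s n"
  have S1: "(\<Sum>n. ?s (Suc n)) \<le> ?S" using suminf_split_head[OF sm] by simp
  have s0: "?s 0 \<le> ?S" using sum_le_suminf[OF sm, of "{0}"] by simp
  \<comment> \<open>Natural subtraction repeats \<open>c 0\<close> at \<open>n = 0\<close>, so the
    shifted sum exceeds \<open>?S\<close> by one term; hence the factor two.\<close>
  have S0: "(\<Sum>n. ?s (n - 1)) \<le> 2 * ?S" using suminf_split_head[OF sm0] s0 by simp
  have sq: "(cmod (d n))\<^sup>2 \<le> 3 * K\<^sup>2 * (?s (n - 1) + ?s n + ?s (Suc n))" for n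
  proof -
    have ab: "(u + v + w)\<^sup>2 \<le> 3 * (u\<^sup>2 + v\<^sup>2 + w\<^sup>2)" for u v w :: real
      using sum_squares_bound[of u v] sum_squares_bound[of u w] sum_squares_bound[of v w]
      by (simp add: power2_eq_square algebra_simps)
    have "(cmod (d n))\<^sup>2 \<le> (K * (cmod (c (n - 1)) + cmod (c n) + cmod (c (Suc n))))\<^sup>2"
      by (rule power_mono[OF le]) simp
    also have "\<dots> = K\<^sup>2 * (cmod (c (n - 1)) + cmod (c n) + cmod (c (Suc n)))\<^sup>2"
      by (rule power_mult_distrib)
    also have "\<dots> \<le> K\<^sup>2 * (3 * (?s (n - 1) + ?s n + ?s (Suc n)))"
      by (intro mult_left_mono ab) simp
    finally show ?thesis by (simp only: mult_ac)
  qed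
  have sm3: "summable (\<lambda>n. 3 * K\<^sup>2 * (?s (n - 1) + ?s n + ?s (Suc n)))"
    by (intro summable_mult summable_add sm sm0 sm1)
  have l: "l2 d"
    unfolding l2_def by (rule summable_comparison_test'[OF sm3, of 0]) (use sq in simp)
  have "(\<Sum>n. (cmod (d n))\<^sup>2) \<le> (\<Sum>n. 3 * K\<^sup>2 * (?s (n - 1) + ?s n + ?s (Suc n)))"
    by (rule suminf_le[OF sq l[unfolded l2_def] sm3])
  also have "\<dots> = 3 * K\<^sup>2 * ((\<Sum>n. ?s (n - 1)) + ?S + (\<Sum>n. ?s (Suc n)))"
    using sm sm0 sm1 by (simp add: suminf_mult suminf_add summable_add)
  also have "\<dots> \<le> 3 * K\<^sup>2 * (2 * ?S + ?S + ?S)"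
    using S0 S1 by (intro mult_left_mono add_mono) simp_all
  \<comment> \<open>The factor is really \<open>3 * 4 = 12\<close>; raising it to \<open>16\<close>
    makes it a perfect square.\<close>
  also have "\<dots> \<le> 16 * K\<^sup>2 * ?S"
    using suminf_nonneg[OF sm] by (simp add: mult_right_mono)
  also have "\<dots> = (4 * K * nrm2 c)\<^sup>2"
    using nrm2_sq[OF c] by (simp add: power_mult_distrib)
  finally have "nrm2 d \<le> 4 * K * nrm2 c"
    unfolding nrm2_def[of d] using K nrm2_ge_0[OF c] by (intro real_le_lsqrt) simp_all
  with l show ?thesis ..
qed

lemma entry_bound:
  assumes T: "T \<in> carr BL" and f: "f \<in> carr ell2"
  shows "cmod (T f (real n)) \<le> nrm BL T * hnorm ell2 f"
proof -
  have "cmod (T f (real n)) \<le> hnorm ell2 (T f)"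
    using cmod_le_nrm2[OF ell2_D[of "T f"], of n] T f by (simp add: hnorm_ell2 seq_of_def)
  also have "\<dots> \<le> nrm BL T * hnorm ell2 f" using T f by (rule ell2.op_bound)
  finally show ?thesis .
qed

lemma entry_tendsto:
  assumes T: "\<And>k. T k \<in> carr BL" "U \<in> carr BL" "BL.tendsto_nrm T U" and f: "f \<in> carr ell2"
  shows "(\<lambda>k. T k f (real n)) \<longlonglongrightarrow> U f (real n)"
proof -
  have lim: "(\<lambda>k. nrm BL (vsub BL (T k) U) * hnorm ell2 f) \<longlonglongrightarrow> 0"
    using tendsto_mult_right[OF T(3)[unfolded BL.tendsto_nrm_def], of "hnorm ell2 f"] by simp
  have "(\<lambda>k. T k f (real n) - U f (real n)) \<longlonglongrightarrow> 0"
  proof (rule Lim_null_comparison[OF always_eventually lim], intro allI)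
    fix k
    show "norm (T k f (real n) - U f (real n)) \<le> nrm BL (vsub BL (T k) U) * hnorm ell2 f"
      using entry_bound[OF BL.sub_closed[OF T(1)[of k] T(2)] f, of n] f by (simp add: vsub_ell2)
  qed
  then show ?thesis by (rule LIM_zero_cancel)
qed

definition unit_vec :: "nat \<Rightarrow> real \<Rightarrow> complex" where
  "unit_vec k = fun_of (\<lambda>n. if n = k then 1 else 0)"

lemma unit_vec [simp]: "unit_vec k \<in> carr ell2" "hnorm ell2 (unit_vec k) = 1"
proof -
  have "(\<lambda>n. (cmod (if n = k then 1 else 0))\<^sup>2) = (\<lambda>n. if n = k then 1 else 0)" by auto
  then have s: "(\<lambda>n. (cmod (if n = k then 1 else 0))\<^sup>2) sums 1"
    using sums_single[of k "\<lambda>_. 1::real"] by simp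
  then have l: "l2 (\<lambda>n. if n = k then 1 else 0)" by (simp add: l2_def sums_iff)
  then show 1: "unit_vec k \<in> carr ell2" by (simp add: unit_vec_def)
  show "hnorm ell2 (unit_vec k) = 1"
    using s unfolding hnorm_ell2[OF 1] by (simp add: unit_vec_def nrm2_def sums_iff)
qed

lemma seq_of_unit_vec [simp]: "seq_of (unit_vec k) = (\<lambda>n. if n = k then 1 else 0)"
  by (simp add: unit_vec_def)

section \<open>A unital semisimple operator algebra whose bidual is not semiprime\<close>

text \<open>\<open>F\<close> is an eigenvector of left and of right multiplication by any
  \<open>G\<close>, with eigenvalue \<open>G \<omega>\<close>. So its multiples form an ideal, and
  \<open>F \<omega> = 0\<close> makes the square zero. The functional \<open>\<psi>\<close>
  certifies that \<open>F\<close> is nonzero and reads off coefficients when limits are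
  taken.\<close>

lemma (in nalgebra) bidual_not_semiprime:
  assumes F: "F \<in> carr (dual (dual V))" and \<omega>: "\<omega> \<in> carr (dual V)" "F \<omega> = 0"
    and \<psi>: "\<psi> \<in> carr (dual V)" "F \<psi> \<noteq> 0"
    and GF: "\<And>G \<phi>. \<lbrakk>G \<in> carr (dual (dual V)); \<phi> \<in> carr (dual V)\<rbrakk> \<Longrightarrow> arens V G F \<phi> = G \<omega> * F \<phi>"
    and FG: "\<And>G \<phi>. \<lbrakk>G \<in> carr (dual (dual V)); \<phi> \<in> carr (dual V)\<rbrakk> \<Longrightarrow> arens V F G \<phi> = G \<omega> * F \<phi>"
  shows "\<not> semiprime (bidual V)"
proof
  assume sp: "semiprime (bidual V)"
  interpret B: banach_algebra "bidual V" by (rule bidual_algebra)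
  define J where "J = {vscale (dual (dual V)) c F | c. True}"
  have JI: "G \<in> J" if "G \<in> carr (dual (dual V))" "\<And>\<phi>. \<phi> \<in> carr (dual V) \<Longrightarrow> G \<phi> = c * F \<phi>" for G c
  proof -
    have "G = vscale (dual (dual V)) c F" using that F by (intro bidual_eqI) simp_all
    then show ?thesis unfolding J_def by blast
  qed
  have JE: "\<exists>c. G = vscale (dual (dual V)) c F" if "G \<in> J" for G using that unfolding J_def by blast
  have mul: "arens V G (vscale (dual (dual V)) c F) \<phi> = c * G \<omega> * F \<phi>"
    "arens V (vscale (dual (dual V)) c F) G \<phi> = c * G \<omega> * F \<phi>"
    if "G \<in> carr (dual (dual V))" "\<phi> \<in> carr (dual V)" for G c \<phi>
    using that F GF[OF that] FG[OF that]
    by (simp_all add: lact_scale_left bidual_scale)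
  have ideal: "two_sided_ideal (bidual V) J"
    unfolding two_sided_ideal_def
  proof (intro conjI B.left_idealI ballI)
    show "vzero (bidual V) \<in> J" by (rule JI[of _ 0]) simp_all
  next
    fix G assume "G \<in> J"
    then obtain c where c: "G = vscale (dual (dual V)) c F" using JE by blast
    show "G \<in> carr (bidual V)" using F c by simp
    show "vscale (bidual V) d G \<in> J" for d by (rule JI[of _ "d * c"]) (use F c in simp_all)
    show "amult (bidual V) H G \<in> J" if "H \<in> carr (bidual V)" for H
      by (rule JI[of _ "c * H \<omega>"]) (use that F mul in \<open>simp_all add: c del: arens_app\<close>)
    fix G' assume "G' \<in> J"
    then obtain c' where c': "G' = vscale (dual (dual V)) c' F" using JE by blast
    show "vadd (bidual V) G G' \<in> J"
      by (rule JI[of _ "c + c'"]) (use F c c' in \<open>simp_all add: algebra_simps\<close>)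
  next
    fix H G assume H: "H \<in> carr (bidual V)" and "G \<in> J"
    then obtain c where c: "G = vscale (dual (dual V)) c F" using JE by blast
    show "amult (bidual V) G H \<in> J"
      by (rule JI[of _ "c * H \<omega>"]) (use H F mul in \<open>simp_all add: c del: arens_app\<close>)
  qed
  have cl: "norm_closed (bidual V) J"
    unfolding B.norm_closed_iff
  proof (intro conjI allI impI)
    show "J \<subseteq> carr (bidual V)" unfolding J_def using F by auto
    fix X G assume "(\<forall>n. X n \<in> J) \<and> G \<in> carr (bidual V) \<and> B.tendsto_nrm X G"
    then have X: "\<And>n. X n \<in> J" and G: "G \<in> carr (dual (dual V))" and lim: "B.tendsto_nrm X G" by simp_all
    have XV: "X n \<in> carr (dual (dual V))" for n using JE[OF X[of n]] F by auto
    \<comment> \<open>The coefficient of \<open>X n\<close> is its value at \<open>\<psi>\<close>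
      divided by \<open>F \<psi>\<close>, so it converges along with \<open>X\<close>.\<close>
    have eq: "X n \<phi> = X n \<psi> / F \<psi> * F \<phi>" if "\<phi> \<in> carr (dual V)" for n \<phi>
      using JE[OF X[of n]] that \<psi> by auto
    show "G \<in> J"
    proof (rule JI[OF G, of "G \<psi> / F \<psi>"])
      fix \<phi> assume \<phi>: "\<phi> \<in> carr (dual V)"
      have "(\<lambda>n. X n \<psi> / F \<psi> * F \<phi>) \<longlonglongrightarrow> G \<psi> / F \<psi> * F \<phi>"
        using \<psi> by (intro tendsto_intros bidual_tendsto_app[OF lim XV G]) simp_all
      moreover have "(\<lambda>n. X n \<phi>) \<longlonglongrightarrow> G \<phi>"
        by (rule bidual_tendsto_app[OF lim XV G \<phi>])
      ultimately show "G \<phi> = G \<psi> / F \<psi> * F \<phi>"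
        unfolding eq[OF \<phi>] by (simp add: LIMSEQ_unique)
    qed
  qed
  have prod0: "amult (bidual V) G H = vzero (bidual V)" if GJ: "G \<in> J" and HJ: "H \<in> J" for G H
  proof -
    obtain c d where c: "G = vscale (dual (dual V)) c F" "H = vscale (dual (dual V)) d F"
      using JE[OF GJ] JE[OF HJ] by blast
    have "arens V G H = vzero (dual (dual V))"
    proof (rule bidual_eqI)
      fix \<phi> assume \<phi>: "\<phi> \<in> carr (dual V)"
      have "arens V G H \<phi> = d * G \<omega> * F \<phi>"
        unfolding c(2) by (rule mul(1)) (use c F \<phi> in simp_all)
      also have "G \<omega> = 0" using c \<omega> by simp
      finally show "arens V G H \<phi> = vzero (dual (dual V)) \<phi>" using \<phi> by (simp del: arens_app)
    qed (use c F in simp_all)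
    then show ?thesis by simp
  qed
  have FJ: "F \<in> J" by (rule JI[of _ 1]) (use F in simp_all)
  have sq: "{amult (bidual V) x y |x y. x \<in> J \<and> y \<in> J} = {vzero (bidual V)}"
  proof (intro equalityI subsetI)
    fix H assume "H \<in> {vzero (bidual V)}"
    then have "H = amult (bidual V) F F" using prod0[OF FJ FJ] by simp
    then show "H \<in> {amult (bidual V) x y |x y. x \<in> J \<and> y \<in> J}" using FJ by blast
  qed (use prod0 in auto)
  have "J = {vzero (bidual V)}"
    by (rule mp[OF spec[OF sp[unfolded semiprime_def]]]) (intro conjI ideal cl sq)
  then have "F = vzero (dual (dual V))" using FJ by simp
  then show False using \<psi> by simp
qed

text \<open>Here \<open>tau a \<beta>\<close> is \<open>a + (\<Sum>j. \<beta> j X j)\<close>, where \<open>X j\<close> is the matrix with rows \<open>(0, 1)\<close> and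
  \<open>(0, w j)\<close> on the coordinates \<open>2 j\<close> and \<open>2 j + 1\<close>.\<close>

definition w :: "nat \<Rightarrow> complex" where
  "w j = 1 / of_nat (Suc j)"

definition tau :: "complex \<Rightarrow> (nat \<Rightarrow> complex) \<Rightarrow> (nat \<Rightarrow> complex) \<Rightarrow> nat \<Rightarrow> complex" where
  "tau a \<beta> c n = a * c n + (if even n then \<beta> (n div 2) * c (Suc n) else w (n div 2) * \<beta> (n div 2) * c n)"

definition el :: "complex \<Rightarrow> (nat \<Rightarrow> complex) \<Rightarrow> (real \<Rightarrow> complex) \<Rightarrow> real \<Rightarrow> complex" where
  "el a \<beta> = op_of (tau a \<beta>)"

definition S2 :: "((real \<Rightarrow> complex) \<Rightarrow> real \<Rightarrow> complex) set" where
  "S2 = {el a \<beta> | a \<beta>. convergent \<beta>}"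

definition A2 :: "((real \<Rightarrow> complex) \<Rightarrow> real \<Rightarrow> complex) cnalg" where
  "A2 = BL\<lparr>carr := S2\<rparr>"

lemma cmod_w: "cmod (w j) \<le> 1"
  by (simp add: w_def norm_divide del: of_nat_Suc)

lemma w_nz: "w j \<noteq> 0"
  by (simp add: w_def del: of_nat_Suc)

lemma w_lim: "w \<longlonglongrightarrow> 0"
proof -
  have "w = (\<lambda>j. of_real (1 / real (Suc j)))"
    by (simp add: w_def fun_eq_iff del: of_nat_Suc)
  then show ?thesis
    using tendsto_of_real[OF LIMSEQ_Suc[OF lim_inverse_n'], where 'a = complex] by simp
qed

lemma tau_bound:
  assumes "\<And>j. cmod (\<beta> j) \<le> B" "l2 c"
  shows "l2 (tau a \<beta> c) \<and> nrm2 (tau a \<beta> c) \<le> 4 * (cmod a + B) * nrm2 c"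
proof (rule banded_bound[OF assms(2)])
  have B: "B \<ge> 0" using order_trans[OF norm_ge_zero assms(1)] .
  then show "cmod a + B \<ge> 0" by simp
  fix n
  have "cmod (tau a \<beta> c n) \<le> cmod a * cmod (c n) + B * (cmod (c n) + cmod (c (Suc n)))"
  proof (cases "even n")
    case True
    have "cmod (tau a \<beta> c n) \<le> cmod (a * c n) + cmod (\<beta> (n div 2) * c (Suc n))"
      using True by (simp add: tau_def norm_triangle_ineq)
    also have "\<dots> \<le> cmod a * cmod (c n) + B * cmod (c (Suc n))"
      using assms(1) by (simp add: norm_mult mult_right_mono)
    finally show ?thesis
      using mult_nonneg_nonneg[OF B norm_ge_zero[of "c n"]] unfolding distrib_left by linarith
  next
    case False
    have "cmod (tau a \<beta> c n) \<le> cmod (a * c n) + cmod (w (n div 2) * \<beta> (n div 2) * c n)"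
      using False by (simp add: tau_def norm_triangle_ineq)
    also have "cmod (w (n div 2) * \<beta> (n div 2) * c n) \<le> 1 * B * cmod (c n)"
      unfolding norm_mult using assms(1) cmod_w B by (intro mult_right_mono mult_mono) simp_all
    finally show ?thesis
      using mult_nonneg_nonneg[OF B norm_ge_zero[of "c (Suc n)"]] unfolding norm_mult[of a] distrib_left by linarith
  qed
  also have "\<dots> \<le> (cmod a + B) * (cmod (c n) + cmod (c (Suc n)))"
    by (simp add: algebra_simps)
  also have "\<dots> \<le> (cmod a + B) * (cmod (c (n - 1)) + cmod (c n) + cmod (c (Suc n)))"
    using B by (intro mult_left_mono) simp_all
  finally show "cmod (tau a \<beta> c n) \<le> (cmod a + B) * (cmod (c (n - 1)) + cmod (c n) + cmod (c (Suc n)))" .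
qed

lemma
  assumes "\<And>j. cmod (\<beta> j) \<le> B"
  shows el_closed: "el a \<beta> \<in> carr BL" and el_nrm: "nrm BL (el a \<beta>) \<le> 4 * (cmod a + B)"
proof -
  have B: "B \<ge> 0" using order_trans[OF norm_ge_zero assms] .
  have K: "0 \<le> 4 * (cmod a + B)" using B by simp
  have lin: "tau a \<beta> (\<lambda>n. c n + d n) n = tau a \<beta> c n + tau a \<beta> d n"
    "tau a \<beta> (\<lambda>n. x * c n) n = x * tau a \<beta> c n" for c d n x
    by (simp_all add: tau_def algebra_simps)
  show "el a \<beta> \<in> carr BL"
    unfolding el_def by (rule op_of_closed[OF lin tau_bound[OF assms]])
  show "nrm BL (el a \<beta>) \<le> 4 * (cmod a + B)"
    unfolding el_def by (rule op_of_nrm[OF lin tau_bound[OF assms] K])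
qed

lemma convergent_bound:
  assumes "convergent \<beta>"
  obtains B where "\<And>j. cmod (\<beta> j) \<le> B"
  using convergent_imp_Bseq[OF assms] unfolding Bseq_def by blast

lemma el_app: "f \<in> carr ell2 \<Longrightarrow> el a \<beta> f = fun_of (tau a \<beta> (seq_of f))"
  by (simp add: el_def op_of_app)

lemma el_add: "vadd BL (el a \<beta>) (el a' \<beta>') = el (a + a') (\<lambda>j. \<beta> j + \<beta>' j)"
  by (rule ext, rename_tac f, case_tac "f \<in> carr ell2")
     (simp_all add: bounded_operators_def el_def op_of_def ell2_sel(2,4) fun_of_def tau_def algebra_simps fun_eq_iff)

lemma el_scale: "vscale BL c (el a \<beta>) = el (c * a) (\<lambda>j. c * \<beta> j)"
  by (rule ext, rename_tac f, case_tac "f \<in> carr ell2")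
     (simp_all add: bounded_operators_def el_def op_of_def ell2_sel(2,4) fun_of_def tau_def algebra_simps fun_eq_iff)

text \<open>On the same plane \<open>X j X j = w j X j\<close>, and on different planes the products
  vanish. In particular the coefficients multiply symmetrically, so the algebra is
  commutative.\<close>

lemma el_mult:
  assumes "convergent \<beta>'"
  shows "amult BL (el a \<beta>) (el a' \<beta>') = el (a * a') (\<lambda>j. a * \<beta>' j + a' * \<beta> j + w j * \<beta> j * \<beta>' j)"
proof (rule ext)
  \<comment> \<open>A bound on \<open>\<beta>'\<close> keeps the inner image in \<open>ell2\<close>,
    where the outer operator acts by its formula.\<close>
  obtain B where B: "\<And>j. cmod (\<beta>' j) \<le> B" by (rule convergent_bound[OF assms]) blast
  fix f
  show "amult BL (el a \<beta>) (el a' \<beta>') f = el (a * a') (\<lambda>j. a * \<beta>' j + a' * \<beta> j + w j * \<beta> j * \<beta>' j) f"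
  proof (cases "f \<in> carr ell2")
    case True
    have "tau a \<beta> (tau a' \<beta>' c) n = tau (a * a') (\<lambda>j. a * \<beta>' j + a' * \<beta> j + w j * \<beta> j * \<beta>' j) c n" for c n
      by (simp add: tau_def algebra_simps)
    then have "tau a \<beta> (tau a' \<beta>' c) = tau (a * a') (\<lambda>j. a * \<beta>' j + a' * \<beta> j + w j * \<beta> j * \<beta>' j) c" for c
      by (rule ext)
    moreover have "el a' \<beta>' f \<in> carr ell2" using ell2.op_closed[OF el_closed[OF B] True] .
    ultimately show ?thesis using True by (simp add: el_app)
  next
    case False
    then show ?thesis by (simp add: bounded_operators_def compose_def el_def op_of_def)
  qed
qed

text \<open>Matrix entries that recover the coefficients: \<open>X 0\<close> has a zero in its upper
  left corner, so the first diagonal entry is \<open>a\<close> alone, and \<open>\<beta> j\<close>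
  stands alone above the diagonal of plane \<open>j\<close>.\<close>

definition aco :: "((real \<Rightarrow> complex) \<Rightarrow> real \<Rightarrow> complex) \<Rightarrow> complex" where
  "aco T = T (unit_vec 0) (real 0)"

definition bco :: "((real \<Rightarrow> complex) \<Rightarrow> real \<Rightarrow> complex) \<Rightarrow> nat \<Rightarrow> complex" where
  "bco T j = T (unit_vec (Suc (2 * j))) (real (2 * j))"

lemma aco_el [simp]: "aco (el a \<beta>) = a"
  unfolding aco_def el_app[OF unit_vec(1)] fun_of_nat by (simp add: tau_def)

lemma bco_el [simp]: "bco (el a \<beta>) = \<beta>"
  by (rule ext, unfold bco_def el_app[OF unit_vec(1)] fun_of_nat) (simp add: tau_def)

lemma aco_bound: "T \<in> carr BL \<Longrightarrow> cmod (aco T) \<le> nrm BL T"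
  using entry_bound[of T "unit_vec 0" 0] by (simp add: aco_def)

lemma bco_bound: "T \<in> carr BL \<Longrightarrow> cmod (bco T j) \<le> nrm BL T"
  using entry_bound[of T "unit_vec (Suc (2 * j))" "2 * j"] by (simp add: bco_def)

lemma S2_I: "convergent \<beta> \<Longrightarrow> el a \<beta> \<in> S2"
  unfolding S2_def by blast

lemma S2_E:
  assumes "T \<in> S2"
  obtains a \<beta> where "T = el a \<beta>" "convergent \<beta>"
  using assms unfolding S2_def by blast

lemma S2_sub: "T \<in> S2 \<Longrightarrow> T \<in> carr BL"
  by (metis S2_E convergent_bound el_closed)

lemma S2_subalgebra: "subalgebra_of BL S2"
  unfolding subalgebra_of_def subspace_of_def
proof (intro conjI ballI allI)
  show "S2 \<subseteq> carr BL" using S2_sub by blast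
  have "vzero BL = vscale BL 0 (el 0 (\<lambda>_. 0))"
    using S2_sub[OF S2_I[OF convergent_const]] by simp
  also have "\<dots> \<in> S2" unfolding el_scale by (intro S2_I) (simp add: convergent_const)
  finally show "vzero BL \<in> S2" .
next
  fix T U assume "T \<in> S2" "U \<in> S2"
  then obtain a \<beta> a' \<beta>' where T: "T = el a \<beta>" "convergent \<beta>" and U: "U = el a' \<beta>'" "convergent \<beta>'"
    by (metis S2_E)
  show "vadd BL T U \<in> S2"
    unfolding T(1) U(1) el_add using T U by (intro S2_I convergent_add)
  have "convergent w" using w_lim convergent_def by blast
  then show "amult BL T U \<in> S2"
    unfolding T(1) U(1) el_mult[OF U(2)] using T U
    by (intro S2_I convergent_add convergent_mult convergent_const)
next
  fix c T assume "T \<in> S2"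
  then obtain a \<beta> where T: "T = el a \<beta>" "convergent \<beta>" by (rule S2_E)
  show "vscale BL c T \<in> S2"
    unfolding T(1) el_scale using T by (intro S2_I convergent_mult convergent_const)
qed

text \<open>Matrix entries are bounded by the operator norm, uniformly in \<open>j\<close>. So the
  coefficient sequences converge uniformly, and a uniform limit of convergent sequences is Cauchy.
  Entrywise limits then identify the operator.\<close>

lemma S2_closed: "norm_closed BL S2"
  unfolding BL.norm_closed_iff
proof (intro conjI allI impI)
  show "S2 \<subseteq> carr BL" using S2_sub by blast
  fix T U assume "(\<forall>n. T n \<in> S2) \<and> U \<in> carr BL \<and> BL.tendsto_nrm T U"
  then have T: "\<And>n. T n \<in> S2" and U: "U \<in> carr BL" and lim: "BL.tendsto_nrm T U" by simp_all
  have TB: "T k \<in> carr BL" for k using S2_sub[OF T] .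
  have Tel: "T k = el (aco (T k)) (bco (T k))" "convergent (bco (T k))" for k
    using S2_E[OF T[of k]] by (metis aco_el bco_el)+
  have b_unif: "cmod (bco (T k) j - bco U j) \<le> nrm BL (vsub BL (T k) U)" for k j
    using bco_bound[OF BL.sub_closed[OF TB[of k] U], of j] by (simp add: bco_def vsub_ell2)
  have a_lim: "(\<lambda>k. aco (T k)) \<longlonglongrightarrow> aco U"
    unfolding aco_def by (rule entry_tendsto[OF TB U lim unit_vec(1)])
  have b_lim: "(\<lambda>k. bco (T k) j) \<longlonglongrightarrow> bco U j" for j
    unfolding bco_def by (rule entry_tendsto[OF TB U lim unit_vec(1)])
  have "Cauchy (bco U)"
  proof (rule metric_CauchyI)
    fix e :: real assume e: "e > 0"
    then have "\<forall>\<^sub>F k in sequentially. nrm BL (vsub BL (T k) U) < e / 3"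
      using order_tendstoD(2)[OF lim[unfolded BL.tendsto_nrm_def], of "e / 3"] by simp
    then obtain k where k: "nrm BL (vsub BL (T k) U) < e / 3"
      by (meson eventually_sequentially order.refl)
    have "Cauchy (bco (T k))" using Tel(2) by (rule convergent_Cauchy)
    then obtain M where M: "\<And>i j. \<lbrakk>i \<ge> M; j \<ge> M\<rbrakk> \<Longrightarrow> dist (bco (T k) i) (bco (T k) j) < e / 3"
      using metric_CauchyD[of _ "e/3"] e by (metis divide_pos_pos zero_less_numeral)
    have "dist (bco U i) (bco U j) < e" if "i \<ge> M" "j \<ge> M" for i j
    proof -
      have "dist (bco U i) (bco U j) \<le> dist (bco U i) (bco (T k) i) + (dist (bco (T k) i) (bco (T k) j) + dist (bco (T k) j) (bco U j))"
        by (meson add_left_mono dist_triangle order_trans)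
      also have "dist (bco U i) (bco (T k) i) < e / 3"
        using b_unif[of k i] k by (simp add: dist_norm norm_minus_commute)
      also have "dist (bco (T k) i) (bco (T k) j) < e / 3" by (rule M[OF that])
      also have "dist (bco (T k) j) (bco U j) < e / 3"
        using b_unif[of k j] k by (simp add: dist_norm)
      finally show ?thesis by simp
    qed
    then show "\<exists>M. \<forall>i\<ge>M. \<forall>j\<ge>M. dist (bco U i) (bco U j) < e" by blast
  qed
  then have conv: "convergent (bco U)" by (rule Cauchy_convergent)
  have "U = el (aco U) (bco U)"
  proof (rule ell2.op_eqI[OF U S2_sub[OF S2_I[OF conv]]])
    fix f assume f: "f \<in> carr ell2"
    show "U f = el (aco U) (bco U) f"
    proof (rule ell2_eqI)
      show "U f \<in> carr ell2" "el (aco U) (bco U) f \<in> carr ell2"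
        using U f S2_sub[OF S2_I[OF conv]] by simp_all
      fix n
      have "(\<lambda>k. T k f (real n)) \<longlonglongrightarrow> U f (real n)" by (rule entry_tendsto[OF TB U lim f])
      moreover have "T k f (real n) = tau (aco (T k)) (bco (T k)) (seq_of f) n" for k
        by (subst Tel(1)) (simp add: el_app f)
      moreover have "(\<lambda>k. tau (aco (T k)) (bco (T k)) (seq_of f) n) \<longlonglongrightarrow> tau (aco U) (bco U) (seq_of f) n"
        unfolding tau_def
        by (cases "even n") (simp_all, (intro tendsto_intros a_lim b_lim)+)
      ultimately show "U f (real n) = el (aco U) (bco U) f (real n)"
        using LIMSEQ_unique by (simp add: el_app f)
    qed
  qed
  then show "U \<in> S2" using S2_I[OF conv] by metis
qed

interpretation A2: banach_algebra A2
  unfolding A2_def by (rule BL.closed_subalgebra[OF S2_subalgebra S2_closed])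

lemma A2_sel [simp]: "carr A2 = S2" "vadd A2 = vadd BL" "vscale A2 = vscale BL" "vzero A2 = vzero BL"
  "amult A2 = amult BL" "nrm A2 = nrm BL"
  by (simp_all add: A2_def)

lemma A2_operator_algebra: "operator_algebra A2"
  unfolding operator_algebra_def
  by (intro exI[of _ ell2] exI[of _ S2] conjI S2_subalgebra S2_closed A2_def)
     (simp add: hilbert_iff ell2.hilbert_axioms)

lemma A2_unital: "unital A2"
proof -
  let ?e = "el 1 (\<lambda>_. 0)"
  have e: "?e \<in> S2" by (rule S2_I[OF convergent_const])
  have app: "?e f = f" if "f \<in> carr ell2" for f
  proof -
    have "tau 1 (\<lambda>_. 0) c = c" for c by (rule ext) (simp add: tau_def)
    then show ?thesis using that by (simp add: el_app fun_of_seq_of)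
  qed
  have "nrm BL ?e \<le> 1"
    by (rule ell2.op_nrm_le) (simp_all add: app)
  moreover have "1 \<le> nrm BL ?e"
    using ell2.op_bound[OF S2_sub[OF e] unit_vec(1), of 0] by (simp add: app)
  moreover have "amult A2 ?e T = T \<and> amult A2 T ?e = T" if TA: "T \<in> carr A2" for T
  proof -
    obtain a \<beta> where T: "T = el a \<beta>" "convergent \<beta>" using S2_E[of T] TA by auto
    show ?thesis
      using T el_mult[OF T(2), of 1 "\<lambda>_. 0" a] el_mult[OF convergent_const, of a \<beta> 1 0] by simp
  qed
  ultimately show ?thesis unfolding unital_def using e by (intro bexI[of _ ?e]) simp_all
qed

text \<open>The number \<open>a + w j * \<beta> j\<close> is the lower diagonal entry of plane
  \<open>j\<close> and depends multiplicatively on the operator, so its kernel is a maximal ideal.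
  If all these numbers vanish, the limit gives \<open>a = 0\<close>, and then every
  \<open>\<beta> j\<close> is zero since \<open>w j\<close> is not.\<close>

lemma A2_semisimple: "semisimple A2"
proof -
  have "T = vzero A2" if T: "T \<in> jacobson_radical A2" for T
  proof -
    have "T \<in> S2" using T by (simp add: jacobson_radical_def)
    then obtain a \<beta> where el: "T = el a \<beta>" "convergent \<beta>" by (rule S2_E)
    have z: "a + w j * \<beta> j = 0" for j
    proof -
      let ?f = "\<lambda>T. aco T + w j * bco T j"
      have "maximal_modular_left_ideal A2 {T \<in> carr A2. ?f T = 0}"
      proof (rule A2.kernel_maximal[where e = "el 1 (\<lambda>_. 0)"])
        fix T assume "T \<in> carr A2"
        then obtain a \<beta> where T: "T = el a \<beta>" "convergent \<beta>" using S2_E[of T] by auto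
        show "?f (vscale A2 c T) = c * ?f T" for c
          by (simp add: T el_scale algebra_simps)
        fix U assume "U \<in> carr A2"
        then obtain a' \<beta>' where U: "U = el a' \<beta>'" "convergent \<beta>'" using S2_E[of U] by auto
        show "?f (vadd A2 T U) = ?f T + ?f U"
          by (simp add: T U el_add algebra_simps)
        show "?f (amult A2 T U) = ?f T * ?f U"
          by (simp add: T U el_mult[OF U(2)] algebra_simps)
      qed (simp_all add: S2_I convergent_const)
      then have "?f T = 0" using T unfolding jacobson_radical_def by blast
      then show ?thesis using el by simp
    qed
    obtain b where "\<beta> \<longlonglongrightarrow> b" using el(2) convergent_def by blast
    then have "(\<lambda>j. a + w j * \<beta> j) \<longlonglongrightarrow> a + 0 * b"
      by (intro tendsto_intros w_lim)
    then have a: "a = 0" using z by (simp add: LIMSEQ_const_iff)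
    then have "\<beta> = (\<lambda>_. 0)" using z w_nz by (intro ext) simp
    then have "T = vscale BL 0 T" using el a by (simp add: el_scale)
    also have "\<dots> = vzero BL" using S2_sub[OF \<open>T \<in> S2\<close>] by simp
    finally show ?thesis by simp
  qed
  moreover have "vzero A2 \<in> jacobson_radical A2"
    using A2.ideal_zero[OF A2.maximal_ideal] A2.zero_closed unfolding jacobson_radical_def by blast
  ultimately show ?thesis unfolding semisimple_def by blast
qed

text \<open>\<open>N2\<close> is the sum of all \<open>X j\<close>, and \<open>E2 j\<close> is a
  single \<open>X j\<close>.\<close>

definition N2 :: "(real \<Rightarrow> complex) \<Rightarrow> real \<Rightarrow> complex" where
  "N2 = el 0 (\<lambda>_. 1)"

definition E2 :: "nat \<Rightarrow> (real \<Rightarrow> complex) \<Rightarrow> real \<Rightarrow> complex" where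
  "E2 j = el 0 (\<lambda>i. if i = j then 1 else 0)"

lemma convergent_finite: "convergent (\<lambda>i. if i < n then c i else (0::complex))"
  unfolding convergent_def
  by (intro exI[of _ 0] tendsto_eventually) (auto simp: eventually_sequentially intro!: exI[of _ n])

lemma N2_S2 [simp]: "N2 \<in> S2"
  unfolding N2_def by (rule S2_I[OF convergent_const])

lemma E2_S2 [simp]: "E2 j \<in> S2"
proof -
  have "(\<lambda>i. if i = j then 1 else 0) = (\<lambda>i. if i < Suc j then (if i = j then 1 else 0) else (0::complex))" by auto
  then show ?thesis unfolding E2_def using convergent_finite[of "Suc j" "\<lambda>i. if i = j then 1 else 0"] S2_I by metis
qed

section \<open>Functionals on the algebra: a summable part and a mass at infinity\<close>

context
  fixes \<phi> assumes \<phi>: "\<phi> \<in> carr (dual A2)"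
begin

lemma \<phi>_el_bound:
  assumes "convergent \<beta>" "\<And>j. cmod (\<beta> j) \<le> B"
  shows "cmod (\<phi> (el 0 \<beta>)) \<le> 4 * nrm (dual A2) \<phi> * B"
proof -
  have "cmod (\<phi> (el 0 \<beta>)) \<le> nrm (dual A2) \<phi> * nrm BL (el 0 \<beta>)"
    using A2.dual_bound[OF \<phi>, of "el 0 \<beta>"] S2_I[OF assms(1)] by simp
  also have "\<dots> \<le> nrm (dual A2) \<phi> * (4 * (cmod 0 + B))"
    using A2.dual_ge_0[OF \<phi>] by (intro mult_left_mono el_nrm assms(2))
  finally show ?thesis by (simp add: mult_ac)
qed

lemma \<phi>_trunc: "\<phi> (el 0 (\<lambda>i. if i < n then c i else 0)) = (\<Sum>j<n. c j * \<phi> (E2 j))"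
proof (induction n)
  case 0
  have "el 0 (\<lambda>i. 0) = vscale BL 0 N2" by (simp add: N2_def el_scale)
  then show ?case using A2.dual_scale[OF \<phi>, of N2 0] by simp
next
  case (Suc n)
  have "el 0 (\<lambda>i. if i < Suc n then c i else 0) =
      vadd BL (el 0 (\<lambda>i. if i < n then c i else 0)) (vscale BL (c n) (E2 n))"
    unfolding E2_def el_scale el_add by (rule arg_cong2[of _ _ _ _ el]) (auto simp: fun_eq_iff less_Suc_eq)
  then show ?case
    using Suc A2.dual_add[OF \<phi>, of "el 0 (\<lambda>i. if i < n then c i else 0)" "vscale BL (c n) (E2 n)"]
      A2.dual_scale[OF \<phi>, of "E2 n" "c n"] A2.scale_closed[of "E2 n" "c n"] S2_I[OF convergent_finite]
    by simp
qed

lemma \<phi>_E2_sum_bound: "(\<Sum>j<n. cmod (\<phi> (E2 j))) \<le> 4 * nrm (dual A2) \<phi>"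
proof -
  \<comment> \<open>Phases that make all terms nonnegative, as in identifying the dual of the null
    sequences with the summable ones. Where \<open>\<phi> (E2 j)\<close> is zero, the quotient is
    zero as well.\<close>
  define c where "c j = cnj (\<phi> (E2 j)) / of_real (cmod (\<phi> (E2 j)))" for j
  have c1: "cmod (c j) \<le> 1" for j by (simp add: c_def norm_divide)
  have cc: "c j * \<phi> (E2 j) = of_real (cmod (\<phi> (E2 j)))" for j
  proof -
    have "cnj z * z = of_real (cmod z) * of_real (cmod z)" for z
      using complex_norm_square[of z] by (simp add: power2_eq_square mult.commute)
    then show ?thesis by (simp add: c_def)
  qed
  have eq: "of_real (\<Sum>j<n. cmod (\<phi> (E2 j))) = \<phi> (el 0 (\<lambda>i. if i < n then c i else 0))"
    unfolding \<phi>_trunc cc by simp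
  have "(\<Sum>j<n. cmod (\<phi> (E2 j))) = cmod (\<phi> (el 0 (\<lambda>i. if i < n then c i else 0)))"
    using arg_cong[OF eq, of cmod] unfolding norm_of_real by (simp add: sum_nonneg)
  also have "\<dots> \<le> 4 * nrm (dual A2) \<phi> * 1"
    using c1 by (intro \<phi>_el_bound convergent_finite) simp
  finally show ?thesis by simp
qed

lemma \<phi>_E2_summable: "summable (\<lambda>j. cmod (\<phi> (E2 j)))"
  by (rule summableI_nonneg_bounded[OF _ \<phi>_E2_sum_bound]) simp

lemma \<phi>_E2_suminf: "cmod (\<Sum>j. \<phi> (E2 j)) \<le> 4 * nrm (dual A2) \<phi>"
  using summable_norm[OF \<phi>_E2_summable] suminf_le_const[OF \<phi>_E2_summable \<phi>_E2_sum_bound] by linarith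

text \<open>The error of truncation is controlled by the supremum of the tail of
  \<open>\<gamma>\<close>, which tends to zero for null sequences. For the constant coefficients of
  \<open>N2\<close> this argument fails, and the defect is \<open>F2\<close>.\<close>

lemma \<phi>_c0_sums:
  assumes g: "\<gamma> \<longlonglongrightarrow> 0"
  shows "(\<lambda>j. \<gamma> j * \<phi> (E2 j)) sums \<phi> (el 0 \<gamma>)"
  unfolding sums_def lim_sequentially
proof (intro allI impI)
  fix e :: real assume e: "e > 0"
  define K where "K = 4 * nrm (dual A2) \<phi> + 1"
  have K: "K > 0" using A2.dual_ge_0[OF \<phi>] by (simp add: K_def add_nonneg_pos)
  obtain M where M: "\<And>j. j \<ge> M \<Longrightarrow> cmod (\<gamma> j) < e / K"
    using LIMSEQ_D[OF g, of "e / K"] e K by auto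
  have conv: "convergent \<gamma>" using g convergent_def by blast
  have "dist (\<Sum>j<n. \<gamma> j * \<phi> (E2 j)) (\<phi> (el 0 \<gamma>)) < e" if n: "n \<ge> M" for n
  proof -
    let ?t = "\<lambda>i. if i < n then \<gamma> i else 0" and ?r = "\<lambda>i. if i < n then 0 else \<gamma> i"
    have r: "convergent ?r"
    proof -
      have "?r = (\<lambda>i. \<gamma> i - ?t i)" by auto
      then show ?thesis using convergent_diff[OF conv convergent_finite[of n \<gamma>]] by simp
    qed
    have "el 0 \<gamma> = vadd BL (el 0 ?t) (el 0 ?r)"
      unfolding el_add by (rule arg_cong2[of _ _ _ _ el]) auto
    then have "\<phi> (el 0 \<gamma>) = \<phi> (el 0 ?t) + \<phi> (el 0 ?r)"
      using A2.dual_add[OF \<phi>, of "el 0 ?t" "el 0 ?r"] S2_I[OF convergent_finite] S2_I[OF r] by simp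
    then have "dist (\<Sum>j<n. \<gamma> j * \<phi> (E2 j)) (\<phi> (el 0 \<gamma>)) = cmod (\<phi> (el 0 ?r))"
      by (simp add: \<phi>_trunc dist_norm)
    also have "\<dots> \<le> 4 * nrm (dual A2) \<phi> * (e / K)"
      by (rule \<phi>_el_bound[OF r]) (use M n e K in \<open>auto intro: less_imp_le\<close>)
    also have "\<dots> < K * (e / K)"
      using e K by (intro mult_strict_right_mono) (simp_all add: K_def)
    finally show ?thesis using K by simp
  qed
  then show "\<exists>M. \<forall>n\<ge>M. dist (\<Sum>j<n. \<gamma> j * \<phi> (E2 j)) (\<phi> (el 0 \<gamma>)) < e" by blast
qed

end

text \<open>The weak* limit of the tails of the series of all \<open>X j\<close>: the part of
  \<open>\<phi> N2\<close> that the single \<open>X j\<close> do not account for.\<close>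

definition F2 :: "(((real \<Rightarrow> complex) \<Rightarrow> real \<Rightarrow> complex) \<Rightarrow> complex) \<Rightarrow> complex" where
  "F2 = (\<lambda>\<phi>\<in>carr (dual A2). \<phi> N2 - (\<Sum>j. \<phi> (E2 j)))"

text \<open>\<open>omj j\<close> is the character attached to plane \<open>j\<close>, and
  \<open>om\<close> is the pointwise limit of these characters, because
  \<open>w j * \<beta> j\<close> tends to zero.\<close>

definition om :: "((real \<Rightarrow> complex) \<Rightarrow> real \<Rightarrow> complex) \<Rightarrow> complex" where
  "om = (\<lambda>T\<in>S2. aco T)"

definition omj :: "nat \<Rightarrow> ((real \<Rightarrow> complex) \<Rightarrow> real \<Rightarrow> complex) \<Rightarrow> complex" where
  "omj j = (\<lambda>T\<in>S2. aco T + w j * bco T j)"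

lemma \<phi>_E2_summable': "\<phi> \<in> carr (dual A2) \<Longrightarrow> summable (\<lambda>j. \<phi> (E2 j))"
  using \<phi>_E2_summable by (rule summable_norm_cancel)

lemma F2_closed: "F2 \<in> carr (dual (dual A2))"
proof (rule A2.bidualI[where K = "nrm BL N2 + 4"])
  fix \<phi> assume \<phi>: "\<phi> \<in> carr (dual A2)"
  show "F2 (vscale (dual A2) c \<phi>) = c * F2 \<phi>" for c
    using \<phi> suminf_mult[OF \<phi>_E2_summable'[OF \<phi>], of c] by (simp add: F2_def algebra_simps)
  have "cmod (F2 \<phi>) \<le> cmod (\<phi> N2) + cmod (\<Sum>j. \<phi> (E2 j))"
    using \<phi> by (simp add: F2_def norm_triangle_ineq4)
  also have "\<dots> \<le> nrm (dual A2) \<phi> * nrm BL N2 + 4 * nrm (dual A2) \<phi>"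
    using A2.dual_bound[OF \<phi>, of N2] \<phi>_E2_suminf[OF \<phi>] by simp
  finally show "cmod (F2 \<phi>) \<le> (nrm BL N2 + 4) * nrm (dual A2) \<phi>" by (simp add: algebra_simps)
  fix \<psi> assume \<psi>: "\<psi> \<in> carr (dual A2)"
  show "F2 (vadd (dual A2) \<phi> \<psi>) = F2 \<phi> + F2 \<psi>"
    using \<phi> \<psi> suminf_add[OF \<phi>_E2_summable'[OF \<phi>] \<phi>_E2_summable'[OF \<psi>], symmetric] by (simp add: F2_def)
qed (simp add: F2_def)

lemma om_closed: "om \<in> carr (dual A2)"
proof (rule A2.dualI[where K = 1])
  fix T assume T: "T \<in> carr A2"
  then show "cmod (om T) \<le> 1 * nrm A2 T" using aco_bound[OF S2_sub, of T] by (simp add: om_def)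
  obtain a \<beta> where el: "T = el a \<beta>" "convergent \<beta>" using T S2_E[of T] by auto
  show "om (vscale A2 c T) = c * om T" for c
    using T el A2.scale_closed[OF T, of c] by (simp add: om_def el_scale)
  fix U assume U: "U \<in> carr A2"
  obtain a' \<beta>' where el': "U = el a' \<beta>'" "convergent \<beta>'" using U S2_E[of U] by auto
  show "om (vadd A2 T U) = om T + om U"
    using T U el el' A2.add_closed[OF T U] by (simp add: om_def el_add)
qed (simp add: om_def)

lemma omj_bound:
  assumes "T \<in> S2"
  shows "cmod (omj j T) \<le> 2 * nrm BL T"
proof -
  have "cmod (omj j T) \<le> cmod (aco T) + cmod (w j) * cmod (bco T j)"
    using assms norm_triangle_ineq[of "aco T" "w j * bco T j"] by (simp add: omj_def norm_mult)
  also have "\<dots> \<le> nrm BL T + 1 * nrm BL T"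
    using aco_bound[OF S2_sub[OF assms]] bco_bound[OF S2_sub[OF assms]] cmod_w
    by (intro add_mono mult_mono) simp_all
  finally show ?thesis by simp
qed

lemma omj_closed: "omj j \<in> carr (dual A2)"
proof (rule A2.dualI[where K = 2])
  fix T assume T: "T \<in> carr A2"
  then show "cmod (omj j T) \<le> 2 * nrm A2 T" using omj_bound by simp
  obtain a \<beta> where el: "T = el a \<beta>" "convergent \<beta>" using T S2_E[of T] by auto
  show "omj j (vscale A2 c T) = c * omj j T" for c
    using T el A2.scale_closed[OF T, of c] by (simp add: omj_def el_scale algebra_simps)
  fix U assume U: "U \<in> carr A2"
  obtain a' \<beta>' where el': "U = el a' \<beta>'" "convergent \<beta>'" using U S2_E[of U] by auto
  show "omj j (vadd A2 T U) = omj j T + omj j U"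
    using T U el el' A2.add_closed[OF T U] by (simp add: omj_def el_add algebra_simps)
qed (simp add: omj_def)

lemma mult_N2:
  assumes "convergent \<beta>"
  shows "amult BL (el a \<beta>) N2 = vadd BL (vscale BL a N2) (el 0 (\<lambda>j. w j * \<beta> j))"
    "amult BL N2 (el a \<beta>) = vadd BL (vscale BL a N2) (el 0 (\<lambda>j. w j * \<beta> j))"
  unfolding N2_def el_mult[OF convergent_const] el_mult[OF assms] el_scale el_add
  by (simp_all add: algebra_simps)

lemma mult_E2:
  assumes "T \<in> S2"
  shows "amult BL T (E2 j) = vscale BL (omj j T) (E2 j)" "amult BL (E2 j) T = vscale BL (omj j T) (E2 j)"
proof -
  obtain a \<beta> where T: "T = el a \<beta>" "convergent \<beta>" using S2_E[OF assms] .
  have c: "convergent (\<lambda>i. if i = j then 1 else (0::complex))"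
    using E2_S2[of j] S2_E unfolding E2_def by (metis bco_el)
  have o: "omj j T = a + w j * \<beta> j" using assms T by (simp add: omj_def)
  show "amult BL T (E2 j) = vscale BL (omj j T) (E2 j)"
    unfolding o unfolding E2_def T(1) el_mult[OF c] el_scale by (rule arg_cong2[of _ _ _ _ el]) auto
  show "amult BL (E2 j) T = vscale BL (omj j T) (E2 j)"
    unfolding o unfolding E2_def T(1) el_mult[OF T(2)] el_scale by (rule arg_cong2[of _ _ _ _ el]) auto
qed

text \<open>Multiplying \<open>N2\<close> by \<open>T\<close> gives \<open>a\<close> times
  \<open>N2\<close> plus an element with null coefficients \<open>w j * \<beta> j\<close>. On the
  latter \<open>\<phi>\<close> is the sum of its values on the \<open>X j\<close>, so it drops out
  of the difference and only \<open>a = om T\<close> remains.\<close>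

lemma F2_translate:
  assumes \<phi>: "\<phi> \<in> carr (dual A2)" and T: "T \<in> S2"
  shows "\<phi> (amult BL T N2) - (\<Sum>j. \<phi> (amult BL T (E2 j))) = om T * F2 \<phi>"
    and "\<phi> (amult BL N2 T) - (\<Sum>j. \<phi> (amult BL (E2 j) T)) = om T * F2 \<phi>"
    and "(\<lambda>j. omj j T * \<phi> (E2 j)) sums (\<phi> (amult BL N2 T) - om T * F2 \<phi>)"
proof -
  obtain a \<beta> where el: "T = el a \<beta>" "convergent \<beta>" using S2_E[OF T] .
  obtain b where "\<beta> \<longlonglongrightarrow> b" using el(2) convergent_def by blast
  then have g: "(\<lambda>j. w j * \<beta> j) \<longlonglongrightarrow> 0" using tendsto_mult[OF w_lim] by force
  have gS: "el 0 (\<lambda>j. w j * \<beta> j) \<in> S2" using g by (intro S2_I) (auto simp: convergent_def)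
  have om: "om T = a" "omj j T = a + w j * \<beta> j" for j using T el by (simp_all add: om_def omj_def)
  have N: "\<phi> (amult BL T N2) = a * \<phi> N2 + \<phi> (el 0 (\<lambda>j. w j * \<beta> j))"
    "\<phi> (amult BL N2 T) = a * \<phi> N2 + \<phi> (el 0 (\<lambda>j. w j * \<beta> j))"
    unfolding el(1) mult_N2[OF el(2)]
    using A2.dual_add[OF \<phi>, of "vscale BL a N2" "el 0 (\<lambda>j. w j * \<beta> j)"] A2.dual_scale[OF \<phi>, of N2 a]
      A2.scale_closed[of N2 a] gS by simp_all
  have E: "\<phi> (amult BL T (E2 j)) = omj j T * \<phi> (E2 j)" "\<phi> (amult BL (E2 j) T) = omj j T * \<phi> (E2 j)" for j
    unfolding mult_E2[OF T] using A2.dual_scale[OF \<phi>, of "E2 j"] by simp_all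
  have "(\<lambda>j. a * \<phi> (E2 j) + (w j * \<beta> j) * \<phi> (E2 j)) sums (a * (\<Sum>j. \<phi> (E2 j)) + \<phi> (el 0 (\<lambda>j. w j * \<beta> j)))"
    by (intro sums_add sums_mult summable_sums \<phi>_E2_summable'[OF \<phi>] \<phi>_c0_sums[OF \<phi> g])
  then have s: "(\<lambda>j. omj j T * \<phi> (E2 j)) sums (a * (\<Sum>j. \<phi> (E2 j)) + \<phi> (el 0 (\<lambda>j. w j * \<beta> j)))"
    by (simp add: om algebra_simps)
  then have S: "(\<Sum>j. omj j T * \<phi> (E2 j)) = a * (\<Sum>j. \<phi> (E2 j)) + \<phi> (el 0 (\<lambda>j. w j * \<beta> j))"
    by (simp add: sums_iff)
  have F: "F2 \<phi> = \<phi> N2 - (\<Sum>j. \<phi> (E2 j))" using \<phi> by (simp add: F2_def)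
  show "\<phi> (amult BL T N2) - (\<Sum>j. \<phi> (amult BL T (E2 j))) = om T * F2 \<phi>"
    "\<phi> (amult BL N2 T) - (\<Sum>j. \<phi> (amult BL (E2 j) T)) = om T * F2 \<phi>"
    unfolding N E S F om(1) by (simp_all add: algebra_simps)
  have "\<phi> (amult BL N2 T) - om T * F2 \<phi> = a * (\<Sum>j. \<phi> (E2 j)) + \<phi> (el 0 (\<lambda>j. w j * \<beta> j))"
    unfolding N F om(1) by (simp add: algebra_simps)
  then show "(\<lambda>j. omj j T * \<phi> (E2 j)) sums (\<phi> (amult BL N2 T) - om T * F2 \<phi>)" using s by simp
qed

lemma arens_right_F2:
  assumes G: "G \<in> carr (dual (dual A2))" and \<phi>: "\<phi> \<in> carr (dual A2)"
  shows "arens A2 G F2 \<phi> = G om * F2 \<phi>"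
proof -
  have "lact A2 F2 \<phi> = vscale (dual A2) (F2 \<phi>) om"
  proof (rule A2.dual_eqI)
    fix T assume T: "T \<in> carr A2"
    have "F2 (rmul A2 \<phi> T) = \<phi> (amult BL T N2) - (\<Sum>j. \<phi> (amult BL T (E2 j)))"
      using A2.rmul_closed[OF \<phi> T] by (simp add: F2_def)
    then show "lact A2 F2 \<phi> T = vscale (dual A2) (F2 \<phi>) om T"
      using F2_translate(1)[OF \<phi>, of T] T by simp
  qed (simp_all add: F2_closed \<phi> om_closed)
  then show ?thesis
    using \<phi> G om_closed by (simp add: A2.bidual_scale mult.commute)
qed

text \<open>Here \<open>F2\<close> is evaluated at \<open>lact A2 G \<phi>\<close>, so
  \<open>G\<close> must be interchanged with an infinite sum of multiples of the
  \<open>omj j\<close>. The interchange is legitimate because this series converges in the norm of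
  the dual.\<close>

lemma arens_left_F2:
  assumes G: "G \<in> carr (dual (dual A2))" and \<phi>: "\<phi> \<in> carr (dual A2)"
  shows "arens A2 F2 G \<phi> = G om * F2 \<phi>"
proof -
  interpret D: banach "dual A2" by (rule A2.dual_banach)
  \<comment> \<open>The sum of the series in closed form, as supplied pointwise by the third part of
    \<open>F2_translate\<close>.\<close>
  define d where "d = vsub (dual A2) (rmul A2 \<phi> N2) (vscale (dual A2) (F2 \<phi>) om)"
  have rN: "rmul A2 \<phi> N2 \<in> carr (dual A2)" using \<phi> by (intro A2.rmul_closed) simp_all
  have dD: "d \<in> carr (dual A2)" unfolding d_def by (intro D.sub_closed rN D.scale_closed om_closed)
  have rE: "rmul A2 \<phi> (E2 j) = vscale (dual A2) (\<phi> (E2 j)) (omj j)" for j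
  proof (rule A2.dual_eqI)
    fix T assume T: "T \<in> carr A2"
    then show "rmul A2 \<phi> (E2 j) T = vscale (dual A2) (\<phi> (E2 j)) (omj j) T"
      using mult_E2(2)[of T j] A2.dual_scale[OF \<phi>, of "E2 j"] by simp
  qed (simp_all add: \<phi> omj_closed)
  \<comment> \<open>Partial sums of the series, with the addition of the dual.\<close>
  define p where "p n = rec_nat (vzero (dual A2)) (\<lambda>j q. vadd (dual A2) q (vscale (dual A2) (\<phi> (E2 j)) (omj j))) n" for n
  have pS: "p 0 = vzero (dual A2)" "p (Suc n) = vadd (dual A2) (p n) (vscale (dual A2) (\<phi> (E2 n)) (omj n))" for n
    by (simp_all add: p_def)
  have pD: "p n \<in> carr (dual A2)" for n
    by (induction n) (simp_all add: pS omj_closed)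
  have p_app: "p n T = (\<Sum>j<n. omj j T * \<phi> (E2 j))" if "T \<in> S2" for n T
    using that by (induction n) (simp_all add: pS mult.commute)
  have Gp: "G (p n) = (\<Sum>j<n. G (rmul A2 \<phi> (E2 j)))" for n
  proof (induction n)
    case 0
    then show ?case using A2.bidual_zero[OF G] by (simp add: pS)
  next
    case (Suc n)
    then show ?case
      using A2.bidual_add[OF G pD[of n] A2.dual_scale_closed[OF omj_closed[of n], of "\<phi> (E2 n)"]]
      by (simp add: pS rE)
  qed
  \<comment> \<open>A tail of the summable series of \<open>cmod (\<phi> (E2 j))\<close>; the factor
    two is the bound on \<open>omj j\<close>.\<close>
  define r where "r n = 2 * ((\<Sum>j. cmod (\<phi> (E2 j))) - (\<Sum>j<n. cmod (\<phi> (E2 j))))" for n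
  have sm: "summable (\<lambda>j. cmod (\<phi> (E2 j)))" by (rule \<phi>_E2_summable[OF \<phi>])
  have r_lim: "r \<longlonglongrightarrow> 0"
  proof -
    have "(\<lambda>n. 2 * ((\<Sum>j. cmod (\<phi> (E2 j))) - (\<Sum>j<n. cmod (\<phi> (E2 j))))) \<longlonglongrightarrow>
        2 * ((\<Sum>j. cmod (\<phi> (E2 j))) - (\<Sum>j. cmod (\<phi> (E2 j))))"
      by (intro tendsto_intros summable_LIMSEQ[OF sm])
    then show ?thesis unfolding r_def by simp
  qed
  have le: "nrm (dual A2) (vsub (dual A2) d (p n)) \<le> r n" for n
  proof (rule A2.dual_nrm_le)
    show "r n \<ge> 0" unfolding r_def using sum_le_suminf[OF sm, of "{..<n}"] by simp
    fix T assume "T \<in> carr A2"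
    then have T: "T \<in> S2" by simp
    have "(\<lambda>j. omj j T * \<phi> (E2 j)) sums d T"
      using F2_translate(3)[OF \<phi> T] T N2_S2 by (simp add: d_def mult.commute)
    then have "(\<lambda>j. omj (j + n) T * \<phi> (E2 (j + n))) sums (d T - (\<Sum>j<n. omj j T * \<phi> (E2 j)))"
      by (rule sums_split_initial_segment)
    then have eq: "d T - p n T = (\<Sum>j. omj (j + n) T * \<phi> (E2 (j + n)))"
      using p_app[OF T] by (simp add: sums_iff)
    have smn: "summable (\<lambda>j. cmod (\<phi> (E2 (j + n))))" using sm by (subst summable_iff_shift)
    have "cmod (d T - p n T) \<le> (\<Sum>j. 2 * nrm BL T * cmod (\<phi> (E2 (j + n))))"
      unfolding eq
    proof (rule norm_suminf_le)
      show "norm (omj (j + n) T * \<phi> (E2 (j + n))) \<le> 2 * nrm BL T * cmod (\<phi> (E2 (j + n)))" for j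
        unfolding norm_mult by (intro mult_right_mono omj_bound[OF T]) simp
      show "summable (\<lambda>j. 2 * nrm BL T * cmod (\<phi> (E2 (j + n))))" using smn by (rule summable_mult)
    qed
    also have "\<dots> = r n * nrm A2 T"
      using suminf_mult[OF smn, of "2 * nrm BL T"] suminf_split_initial_segment[OF sm, of n] by (simp add: r_def)
    finally show "cmod (vsub (dual A2) d (p n) T) \<le> r n * nrm A2 T" using T by simp
  qed
  have "(\<lambda>n. G d - G (p n)) \<longlonglongrightarrow> 0"
  proof (rule Lim_null_comparison[OF always_eventually], intro allI)
    show "(\<lambda>n. nrm (dual (dual A2)) G * r n) \<longlonglongrightarrow> 0" using tendsto_mult_left[OF r_lim] by force
    fix n
    have "cmod (G (vsub (dual A2) d (p n))) \<le> nrm (dual (dual A2)) G * nrm (dual A2) (vsub (dual A2) d (p n))"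
      by (rule A2.bidual_bound[OF G D.sub_closed[OF dD pD]])
    also have "\<dots> \<le> nrm (dual (dual A2)) G * r n"
      using A2.bidual_ge_0[OF G] le by (intro mult_left_mono)
    finally show "norm (G d - G (p n)) \<le> nrm (dual (dual A2)) G * r n"
      using A2.bidual_sub[OF G dD pD] by simp
  qed
  then have "(\<lambda>n. G d - (G d - G (p n))) \<longlonglongrightarrow> G d - 0" by (intro tendsto_diff tendsto_const)
  then have "(\<lambda>j. G (rmul A2 \<phi> (E2 j))) sums G d" unfolding sums_def Gp by simp
  then have "(\<Sum>j. G (rmul A2 \<phi> (E2 j))) = G d" by (simp add: sums_iff)
  then have "arens A2 F2 G \<phi> = G (rmul A2 \<phi> N2) - G d"
    using \<phi> A2.lact_closed[OF G \<phi>] N2_S2 E2_S2 by (simp add: F2_def)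
  also have "G d = G (rmul A2 \<phi> N2) - F2 \<phi> * G om"
    unfolding d_def A2.bidual_sub[OF G rN A2.dual_scale_closed[OF om_closed]] A2.bidual_scale[OF G om_closed] by simp
  finally show ?thesis by (simp add: mult.commute)
qed

lemma A2_bidual_not_semiprime: "\<not> semiprime (bidual A2)"
proof (rule A2.bidual_not_semiprime[OF F2_closed om_closed])
  have omE: "om (E2 j) = 0" for j using E2_S2[of j] by (simp add: om_def) (simp add: E2_def)
  have omN: "om N2 = 0" using N2_S2 by (simp add: om_def) (simp add: N2_def)
  show "F2 om = 0" using om_closed by (simp add: F2_def omE omN)
  \<comment> \<open>The limit of the coefficients is one on \<open>N2\<close> and zero on each
    \<open>E2 j\<close>, so it sees only infinity.\<close>
  define \<psi> where "\<psi> = (\<lambda>T\<in>S2. lim (bco T))"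
  have \<psi>_el: "\<psi> (el a \<beta>) = lim \<beta>" if "convergent \<beta>" for a \<beta>
    using S2_I[OF that] by (simp add: \<psi>_def)
  show \<psi>D: "\<psi> \<in> carr (dual A2)"
  proof (rule A2.dualI[where K = 1])
    fix T assume T: "T \<in> carr A2"
    then obtain a \<beta> where el: "T = el a \<beta>" "convergent \<beta>" using S2_E[of T] by auto
    have b: "\<beta> \<longlonglongrightarrow> lim \<beta>" using el(2) by (simp add: convergent_LIMSEQ_iff)
    have "cmod (lim \<beta>) \<le> nrm BL T"
      using T bco_bound[OF S2_sub, of T] el
      by (intro LIMSEQ_le_const2[OF tendsto_norm[OF b]]) auto
    then show "cmod (\<psi> T) \<le> 1 * nrm A2 T" using \<psi>_el[OF el(2), of a] el by simp
    show "\<psi> (vscale A2 c T) = c * \<psi> T" for c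
    proof -
      have "(\<lambda>j. c * \<beta> j) \<longlonglongrightarrow> c * lim \<beta>" by (rule tendsto_mult_left[OF b])
      then have "lim (\<lambda>j. c * \<beta> j) = c * lim \<beta>" "convergent (\<lambda>j. c * \<beta> j)"
        by (auto simp: limI convergent_def)
      then show ?thesis using \<psi>_el el by (simp add: el_scale)
    qed
    fix U assume "U \<in> carr A2"
    then obtain a' \<beta>' where el': "U = el a' \<beta>'" "convergent \<beta>'" using S2_E[of U] by auto
    have b': "\<beta>' \<longlonglongrightarrow> lim \<beta>'" using el'(2) by (simp add: convergent_LIMSEQ_iff)
    have "(\<lambda>j. \<beta> j + \<beta>' j) \<longlonglongrightarrow> lim \<beta> + lim \<beta>'" by (rule tendsto_add[OF b b'])
    then have "lim (\<lambda>j. \<beta> j + \<beta>' j) = lim \<beta> + lim \<beta>'" "convergent (\<lambda>j. \<beta> j + \<beta>' j)"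
      by (auto simp: limI convergent_def)
    then show "\<psi> (vadd A2 T U) = \<psi> T + \<psi> U" using \<psi>_el el el' by (simp add: el_add)
  qed (simp add: \<psi>_def)
  have "\<psi> N2 = 1" unfolding N2_def using \<psi>_el[OF convergent_const] by simp
  moreover have "\<psi> (E2 j) = 0" for j
  proof -
    have "(\<lambda>i. if i = j then 1 else 0) \<longlonglongrightarrow> (0::complex)"
      by (intro tendsto_eventually) (auto simp: eventually_sequentially intro!: exI[of _ "Suc j"])
    then show ?thesis unfolding E2_def using \<psi>_el[of "\<lambda>i. if i = j then 1 else 0"] by (auto simp: limI convergent_def)
  qed
  ultimately show "F2 \<psi> \<noteq> 0" using \<psi>D by (simp add: F2_def)
qed (simp_all add: arens_right_F2 arens_left_F2 del: arens_app)

section \<open>The Volterra operator in an orthonormal basis\<close>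

definition ip :: "(real \<Rightarrow> real) \<Rightarrow> (real \<Rightarrow> real) \<Rightarrow> real" where
  "ip f g = integral {0..1} (\<lambda>x. f x * g x)"

definition vol :: "(real \<Rightarrow> real) \<Rightarrow> real \<Rightarrow> real" where
  "vol f x = integral {0..x} f"

abbreviation cont :: "(real \<Rightarrow> real) \<Rightarrow> bool" where
  "cont f \<equiv> continuous_on {0..1} f"

lemma cont_integrable: "cont f \<Longrightarrow> x \<le> 1 \<Longrightarrow> f integrable_on {0..x}"
  by (rule integrable_continuous_real) (auto intro: continuous_on_subset)

lemma vol_0 [simp]: "vol f 0 = 0"
  by (simp add: vol_def)

lemma vol_cong: "\<lbrakk>\<And>t. t \<in> {0..1} \<Longrightarrow> f t = g t; x \<in> {0..1}\<rbrakk> \<Longrightarrow> vol f x = vol g x"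
  unfolding vol_def by (rule integral_cong) simp

lemma vol_deriv: "\<lbrakk>cont f; x \<in> {0..1}\<rbrakk> \<Longrightarrow> (vol f has_real_derivative f x) (at x within {0..1})"
  unfolding vol_def[abs_def] by (rule integral_has_real_derivative)

lemma vol_cont: "cont f \<Longrightarrow> cont (vol f)"
  by (rule DERIV_continuous_on[where D = f]) (rule vol_deriv)

lemma ip_cong:
  assumes "\<And>t. t \<in> {0..1} \<Longrightarrow> f t = f' t" "\<And>t. t \<in> {0..1} \<Longrightarrow> g t = g' t"
  shows "ip f g = ip f' g'"
  unfolding ip_def by (rule integral_cong) (simp add: assms)

lemma ip_integrable: "\<lbrakk>cont f; cont g\<rbrakk> \<Longrightarrow> (\<lambda>x. f x * g x) integrable_on {0..1}"
  by (intro integrable_continuous_real continuous_intros)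

lemma ip_commute: "ip f g = ip g f"
  by (simp add: ip_def mult.commute)

lemma ip_lin_left: "\<lbrakk>cont f; cont g; cont h\<rbrakk> \<Longrightarrow> ip (\<lambda>x. a * f x + b * g x) h = a * ip f h + b * ip g h"
proof -
  assume c: "cont f" "cont g" "cont h"
  have "ip (\<lambda>x. a * f x + b * g x) h = integral {0..1} (\<lambda>x. a * (f x * h x) + b * (g x * h x))"
    by (simp add: ip_def algebra_simps)
  also have "\<dots> = integral {0..1} (\<lambda>x. a * (f x * h x)) + integral {0..1} (\<lambda>x. b * (g x * h x))"
    using c by (intro integral_add integrable_continuous_real continuous_intros)
  also have "\<dots> = a * ip f h + b * ip g h" by (simp add: ip_def)
  finally show ?thesis .
qed

lemma ip_ge_0: "cont f \<Longrightarrow> 0 \<le> ip f f"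
  unfolding ip_def by (rule integral_nonneg[OF ip_integrable]) simp_all

text \<open>A nonzero value at the left endpoint is the form in which nonvanishing propagates
  through the Lanczos recursion.\<close>

lemma ip_pos:
  assumes f: "cont f" and nz: "f 0 \<noteq> 0"
  shows "0 < ip f f"
proof -
  have "ip f f \<noteq> 0"
  proof
    assume "ip f f = 0"
    then have "((\<lambda>x. f x * f x) has_integral 0) (cbox 0 1)"
      using ip_integrable[OF f f] by (simp add: ip_def has_integral_iff)
    then have "f 0 * f 0 = 0"
      using f by (intro has_integral_0_cbox_imp_0[of 0 1 "\<lambda>x. f x * f x" 0]) (auto intro!: continuous_intros)
    then show False using nz by simp
  qed
  then show ?thesis using ip_ge_0[OF f] by simp
qed

text \<open>Integration by parts: the Volterra operator plus its adjoint is the projection onto the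
  constants.\<close>

lemma ip_vol_parts:
  assumes f: "cont f" and g: "cont g"
  shows "ip (vol f) g + ip f (vol g) = ip f (\<lambda>_. 1) * ip g (\<lambda>_. 1)"
proof -
  have "((\<lambda>x. vol f x * g x + f x * vol g x) has_integral vol f 1 * vol g 1 - vol f 0 * vol g 0) {0..1}"
  proof (rule fundamental_theorem_of_calculus)
    fix x :: real assume x: "x \<in> {0..1}"
    have "((\<lambda>x. vol f x * vol g x) has_real_derivative vol f x * g x + f x * vol g x) (at x within {0..1})"
      using DERIV_mult[OF vol_deriv[OF f x] vol_deriv[OF g x]] by (simp add: algebra_simps)
    then show "((\<lambda>x. vol f x * vol g x) has_vector_derivative vol f x * g x + f x * vol g x) (at x within {0..1})"
      by (simp add: has_real_derivative_iff_has_vector_derivative)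
  qed simp
  then have "integral {0..1} (\<lambda>x. vol f x * g x + f x * vol g x) = vol f 1 * vol g 1"
    by (simp add: integral_unique)
  moreover have "integral {0..1} (\<lambda>x. vol f x * g x + f x * vol g x) = ip (vol f) g + ip f (vol g)"
    unfolding ip_def by (intro integral_add ip_integrable vol_cont f g)
  ultimately show ?thesis by (simp add: ip_def vol_def)
qed

text \<open>The square of \<open>f\<close> minus the constant \<open>vol f x\<close> has nonnegative
  integral over \<open>{0..x}\<close>. This constant, rather than the mean, avoids dividing by
  \<open>x\<close>; that \<open>x\<close> is at most one settles the rest.\<close>

lemma vol_sq_le:
  assumes f: "cont f" and x: "x \<in> {0..1}"
  shows "(vol f x)\<^sup>2 \<le> ip f f"
proof -
  let ?t = "vol f x"
  have ff: "(\<lambda>s. f s * f s) integrable_on {0..x}" and fi: "f integrable_on {0..x}"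
    using f x by (intro cont_integrable continuous_intros; simp)+
  have "0 \<le> integral {0..x} (\<lambda>s. (f s - ?t) * (f s - ?t))"
    using f x by (intro integral_nonneg cont_integrable continuous_intros) simp_all
  also have "(\<lambda>s. (f s - ?t) * (f s - ?t)) = (\<lambda>s. f s * f s - (2 * ?t) * f s + ?t * ?t)"
    by (simp add: algebra_simps fun_eq_iff)
  also have "integral {0..x} \<dots> = integral {0..x} (\<lambda>s. f s * f s) - 2 * ?t * ?t + ?t * ?t * x"
  proof -
    have "((\<lambda>s. f s * f s - (2 * ?t) * f s + ?t * ?t) has_integral
        integral {0..x} (\<lambda>s. f s * f s) - (2 * ?t) * ?t + (x - 0) *\<^sub>R (?t * ?t)) {0..x}"
    proof (intro has_integral_add has_integral_diff has_integral_mult_right)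
      show "((\<lambda>s. f s * f s) has_integral integral {0..x} (\<lambda>s. f s * f s)) {0..x}"
        using ff by (rule integrable_integral)
      show "(f has_integral ?t) {0..x}" unfolding vol_def using fi by (rule integrable_integral)
      show "((\<lambda>s. ?t * ?t) has_integral (x - 0) *\<^sub>R (?t * ?t)) {0..x}"
        using has_integral_const_real[of "?t * ?t" 0 x] x by simp
    qed
    then show ?thesis by (simp add: integral_unique mult_ac)
  qed
  also have "\<dots> \<le> integral {0..x} (\<lambda>s. f s * f s) - ?t * ?t"
    using mult_left_mono[of x 1 "?t * ?t"] x by (simp add: mult.assoc)
  finally have "?t * ?t \<le> integral {0..x} (\<lambda>s. f s * f s)" by simp
  also have "\<dots> \<le> integral {0..1} (\<lambda>s. f s * f s)"
    using x ff ip_integrable[OF f f] by (intro integral_subset_le) auto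
  finally show ?thesis by (simp add: ip_def power2_eq_square)
qed

lemma ip_le_sup:
  assumes f: "cont f" and le: "\<And>x. x \<in> {0..1} \<Longrightarrow> (f x)\<^sup>2 \<le> K"
  shows "ip f f \<le> K"
proof -
  have "ip f f \<le> integral {0..1} (\<lambda>_::real. K)"
    unfolding ip_def
    by (intro integral_le ip_integrable f) (use le in \<open>auto simp: power2_eq_square\<close>)
  then show ?thesis by simp
qed

lemma vol_pow_cont: "cont f \<Longrightarrow> cont ((vol ^^ m) f)"
  by (induction m) (simp_all add: vol_cont)

text \<open>The first integration turns the square norm into a supremum bound. Each of the
  \<open>m\<close> later ones integrates a monomial and contributes to the factorial.\<close>

lemma vol_pow_le:
  assumes f: "cont f" and x: "x \<in> {0..1}"
  shows "\<bar>(vol ^^ Suc m) f x\<bar> \<le> x ^ m / fact m * sqrt (ip f f)"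
  using x
proof (induction m arbitrary: x)
  case 0
  show ?case using vol_sq_le[OF f 0] by (simp add: real_le_rsqrt abs_le_square_iff flip: real_sqrt_abs)
next
  case (Suc m)
  let ?s = "sqrt (ip f f)"
  have "((\<lambda>t. t ^ m / fact m * ?s) has_integral x ^ Suc m / fact (Suc m) * ?s - 0 ^ Suc m / fact (Suc m) * ?s) {0..x}"
  proof (rule fundamental_theorem_of_calculus)
    fix t :: real
    have "((\<lambda>t. t ^ Suc m / fact (Suc m) * ?s) has_real_derivative (real (Suc m) * t ^ m) / fact (Suc m) * ?s) (at t within {0..x})"
      using DERIV_pow[of "Suc m" t "{0..x}"] by (intro DERIV_cmult_right DERIV_cdivide) simp
    moreover have "(real (Suc m) * t ^ m) / fact (Suc m) * ?s = t ^ m / fact m * ?s"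
      by (simp add: field_simps del: of_nat_Suc)
    ultimately show "((\<lambda>t. t ^ Suc m / fact (Suc m) * ?s) has_vector_derivative t ^ m / fact m * ?s) (at t within {0..x})"
      by (simp add: has_real_derivative_iff_has_vector_derivative)
  qed (use Suc.prems in simp)
  then have i: "((\<lambda>t. t ^ m / fact m * ?s) has_integral x ^ Suc m / fact (Suc m) * ?s) {0..x}" by simp
  have "norm (integral {0..x} ((vol ^^ Suc m) f)) \<le> integral {0..x} (\<lambda>t. t ^ m / fact m * ?s)"
  proof (rule integral_norm_bound_integral)
    show "(vol ^^ Suc m) f integrable_on {0..x}"
      using Suc.prems by (intro cont_integrable vol_pow_cont f) simp
    show "(\<lambda>t. t ^ m / fact m * ?s) integrable_on {0..x}" using i by blast
    show "norm ((vol ^^ Suc m) f t) \<le> t ^ m / fact m * ?s" if "t \<in> {0..x}" for t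
      using Suc.IH[of t] that Suc.prems by simp
  qed
  also have "\<dots> = x ^ Suc m / fact (Suc m) * ?s" using i by (rule integral_unique)
  finally have "norm (integral {0..x} ((vol ^^ Suc m) f)) \<le> x ^ Suc m / fact (Suc m) * ?s" .
  moreover have "(vol ^^ Suc (Suc m)) f x = integral {0..x} ((vol ^^ Suc m) f)"
    by (simp add: vol_def[of "vol ((vol ^^ m) f)"])
  ultimately show ?case by (simp only: real_norm_def)
qed

lemma ip_vol_pow_le:
  assumes f: "cont f"
  shows "ip ((vol ^^ Suc m) f) ((vol ^^ Suc m) f) \<le> ip f f / (fact m)\<^sup>2"
proof (rule ip_le_sup[OF vol_pow_cont[OF f]])
  fix x :: real assume x: "x \<in> {0..1}"
  have "\<bar>(vol ^^ Suc m) f x\<bar> \<le> x ^ m / fact m * sqrt (ip f f)" by (rule vol_pow_le[OF f x])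
  also have "\<dots> \<le> 1 / fact m * sqrt (ip f f)"
    using x ip_ge_0[OF f] by (intro mult_right_mono divide_right_mono power_le_one) simp_all
  finally have "\<bar>(vol ^^ Suc m) f x\<bar>\<^sup>2 \<le> (1 / fact m * sqrt (ip f f))\<^sup>2"
    by (intro power_mono) simp_all
  then show "((vol ^^ Suc m) f x)\<^sup>2 \<le> ip f f / (fact m)\<^sup>2"
    using ip_ge_0[OF f] by (simp add: power_mult_distrib power_divide)
qed

text \<open>Lanczos recursion: the Volterra operator is skew-adjoint up to half the projection onto the
  constants, so orthonormalising the sequence \<open>1, V 1, V (V 1), \<dots>\<close> makes its matrix tridiagonal.
  The triple contains the previous function, the current one and the last coefficient.\<close>

fun lan :: "nat \<Rightarrow> (real \<Rightarrow> real) \<times> (real \<Rightarrow> real) \<times> real" where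
  "lan 0 = (\<lambda>x. - 1/2, \<lambda>x. 1, 1)"
| "lan (Suc n) = (case lan n of (q, p, b) \<Rightarrow>
     (p, \<lambda>x. (vol p x + b * q x) / sqrt (ip (\<lambda>x. vol p x + b * q x) (\<lambda>x. vol p x + b * q x)),
      sqrt (ip (\<lambda>x. vol p x + b * q x) (\<lambda>x. vol p x + b * q x))))"

definition bas :: "nat \<Rightarrow> real \<Rightarrow> real" where
  "bas n = fst (snd (lan n))"

definition res :: "nat \<Rightarrow> real \<Rightarrow> real" where
  "res n x = (case lan n of (q, p, b) \<Rightarrow> vol p x + b * q x)"

definition bb :: "nat \<Rightarrow> real" where
  "bb n = sqrt (ip (res n) (res n))"

lemma bas_0: "bas 0 = (\<lambda>x. 1)"
  by (simp add: bas_def)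

lemma bas_Suc: "bas (Suc n) = (\<lambda>x. res n x / bb n)"
  by (simp add: bas_def res_def[abs_def] bb_def split: prod.split)

lemma lan_Suc: "lan (Suc n) = (bas n, bas (Suc n), bb n)"
  unfolding bas_Suc by (simp add: bas_def bb_def res_def[abs_def] split: prod.split)

text \<open>The starting data \<open>- 1/2\<close> and \<open>1\<close> of \<open>lan\<close> are an
  artificial predecessor: they make the first residual \<open>vol 1 - 1/2\<close>, which is
  orthogonal to the constants.\<close>

lemma res_0: "res 0 x = vol (bas 0) x - 1/2"
  by (simp add: res_def bas_0)

lemma res_Suc: "res (Suc n) x = vol (bas (Suc n)) x + bb n * bas n x"
  by (simp add: res_def lan_Suc del: lan.simps)

text \<open>Nonvanishing at zero keeps the recursion from breaking down: Volterra images vanish at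
  zero, so the next residual takes there the nonzero value \<open>bb n * bas n 0\<close>, and its
  norm is positive.\<close>

definition lan_ok :: "nat \<Rightarrow> bool" where
  "lan_ok n \<longleftrightarrow> (\<forall>k\<le>n. cont (bas k)) \<and> (\<forall>i\<le>n. \<forall>j\<le>n. ip (bas i) (bas j) = (if i = j then 1 else 0)) \<and>
     (\<forall>k\<le>n. bas k 0 \<noteq> 0) \<and> (\<forall>k<n. 0 < bb k)"

lemma vol_bas:
  "0 < bb 0 \<Longrightarrow> vol (bas 0) x = 1/2 * bas 0 x + bb 0 * bas 1 x"
  "0 < bb (Suc n) \<Longrightarrow> vol (bas (Suc n)) x = bb (Suc n) * bas (Suc (Suc n)) x - bb n * bas n x"
  using res_0[of x] res_Suc[of n x] bas_Suc[of 0] bas_Suc[of "Suc n"] by (simp_all add: bas_0)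

text \<open>By near skewness, pairing \<open>vol (bas n)\<close> with an earlier
  \<open>bas j\<close> means pairing \<open>bas n\<close> with \<open>vol (bas j)\<close>, which
  involves only neighbours of \<open>j\<close>. So only \<open>j = n - 1\<close> contributes, and
  the term added in the residual cancels it.\<close>

lemma lan_ok_step:
  assumes ok: "lan_ok n"
  shows "lan_ok (Suc n)"
proof -
  have c: "cont (bas k)" if "k \<le> n" for k using ok that by (simp add: lan_ok_def)
  have o: "ip (bas i) (bas j) = (if i = j then 1 else 0)" if "i \<le> n" "j \<le> n" for i j
    using ok that by (simp add: lan_ok_def)
  have z: "bas k 0 \<noteq> 0" if "k \<le> n" for k using ok that by (simp add: lan_ok_def)
  have b: "0 < bb k" if "k < n" for k using ok that by (simp add: lan_ok_def)
  have one: "ip f (\<lambda>_. 1) = ip f (bas 0)" for f by (simp add: bas_0)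
  have rc: "cont (res n)"
  proof (cases n)
    case 0
    then show ?thesis unfolding res_0[abs_def] 0
      using c[of 0] by (intro continuous_intros vol_cont) simp
  next
    case (Suc m)
    then have "cont (bas m)" "cont (bas (Suc m))" using c by simp_all
    then show ?thesis unfolding Suc res_Suc[abs_def]
      by (intro continuous_intros vol_cont)
  qed
  have r0: "res n 0 \<noteq> 0"
  proof (cases n)
    case (Suc m)
    then show ?thesis using b[of m] z[of m] by (simp add: res_Suc)
  qed (simp add: res_0)
  have bpos: "0 < bb n" unfolding bb_def using ip_pos[OF rc r0] by simp
  have orth: "ip (res n) (bas j) = 0" if j: "j \<le> n" for j
  proof (cases n)
    case 0
    have "ip (res 0) (bas 0) = ip (\<lambda>x. 1 * vol (bas 0) x + (-1/2) * bas 0 x) (bas 0)"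
      by (rule ip_cong) (simp_all add: res_0 bas_0)
    also have "\<dots> = 1 * ip (vol (bas 0)) (bas 0) + (-1/2) * ip (bas 0) (bas 0)"
      using c[of 0] by (intro ip_lin_left vol_cont) simp_all
    also have "ip (vol (bas 0)) (bas 0) = 1/2"
      using ip_vol_parts[of "bas 0" "bas 0"] c[of 0] o[of 0 0] ip_commute[of "bas 0" "vol (bas 0)"]
      by (simp add: one)
    finally show ?thesis using 0 j o[of 0 0] by simp
  next
    case (Suc m)
    have e1: "ip (res n) (bas j) = ip (vol (bas n)) (bas j) + bb m * ip (bas m) (bas j)"
    proof -
      have "ip (res n) (bas j) = ip (\<lambda>x. 1 * vol (bas n) x + bb m * bas m x) (bas j)"
        by (rule ip_cong) (simp_all add: Suc res_Suc)
      also have "\<dots> = 1 * ip (vol (bas n)) (bas j) + bb m * ip (bas m) (bas j)"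
        using c j Suc by (intro ip_lin_left vol_cont) simp_all
      finally show ?thesis by simp
    qed
    \<comment> \<open>The rank-one term of integration by parts is zero, as \<open>bas n\<close>
      with \<open>n > 0\<close> is orthogonal to \<open>bas 0\<close>, the constant one.\<close>
    have e2: "ip (vol (bas n)) (bas j) = - ip (bas n) (vol (bas j))"
      using ip_vol_parts[OF c[of n] c[OF j]] o[of n 0] Suc by (simp add: one)
    show ?thesis
    proof (cases "j = n")
      case True
      then have "ip (vol (bas n)) (bas j) = 0"
        using e2 ip_commute[of "bas n" "vol (bas n)"] by simp
      then show ?thesis using e1 True o[of m n] Suc by simp
    next
      case False
      then have jm: "j \<le> m" using j Suc by simp
      have "ip (vol (bas j)) (bas n) = (if j = m then bb m else 0)"
      proof (cases j)
        case 0
        have "ip (vol (bas j)) (bas n) = ip (\<lambda>x. 1/2 * bas 0 x + bb 0 * bas 1 x) (bas n)"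
          unfolding 0 using b[of 0] Suc by (intro ip_cong vol_bas) simp_all
        also have "\<dots> = 1/2 * ip (bas 0) (bas n) + bb 0 * ip (bas 1) (bas n)"
          using c Suc by (intro ip_lin_left) simp_all
        finally show ?thesis using o[of 0 n] o[of 1 n] Suc 0 by auto
      next
        case (Suc i)
        have "ip (vol (bas j)) (bas n) = ip (\<lambda>x. bb j * bas (Suc j) x + (- bb i) * bas i x) (bas n)"
          unfolding Suc using b[of "Suc i"] jm Suc \<open>n = Suc m\<close> by (intro ip_cong) (simp_all add: vol_bas)
        also have "\<dots> = bb j * ip (bas (Suc j)) (bas n) + (- bb i) * ip (bas i) (bas n)"
          using c jm Suc \<open>n = Suc m\<close> by (intro ip_lin_left) simp_all
        finally show ?thesis using o[of "Suc j" n] o[of i n] jm Suc \<open>n = Suc m\<close> by auto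
      qed
      then show ?thesis
        using e1 e2 ip_commute[of "bas n" "vol (bas j)"] o[of m j] jm Suc by auto
    qed
  qed
  have newc: "cont (bas (Suc n))"
    unfolding bas_Suc using rc bpos by (intro continuous_intros) simp_all
  have scale: "ip (bas (Suc n)) g = ip (res n) g / bb n" for g
  proof -
    have "ip (bas (Suc n)) g = integral {0..1} (\<lambda>x. (1 / bb n) * (res n x * g x))"
      by (simp add: ip_def bas_Suc)
    also have "\<dots> = (1 / bb n) * ip (res n) g" unfolding ip_def by (rule integral_mult_right)
    finally show ?thesis by simp
  qed
  have new1: "ip (bas (Suc n)) (bas (Suc n)) = 1"
  proof -
    have "ip (bas (Suc n)) (bas (Suc n)) = ip (res n) (bas (Suc n)) / bb n" by (rule scale)
    also have "ip (res n) (bas (Suc n)) = ip (res n) (res n) / bb n"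
      using scale[of "res n"] ip_commute by metis
    also have "ip (res n) (res n) = bb n * bb n"
      unfolding bb_def using ip_ge_0[OF rc] by simp
    finally show ?thesis using bpos by simp
  qed
  have new0: "ip (bas (Suc n)) (bas j) = 0" "ip (bas j) (bas (Suc n)) = 0" if "j \<le> n" for j
    using scale[of "bas j"] orth[OF that] ip_commute[of "bas j"] by simp_all
  have "bas (Suc n) 0 \<noteq> 0" using r0 bpos by (simp add: bas_Suc)
  then show ?thesis
    unfolding lan_ok_def using c o z b bpos newc new1 new0 by (auto simp: le_Suc_eq less_Suc_eq)
qed

lemma lan_ok: "lan_ok n"
proof (induction n)
  case 0
  have "ip (bas 0) (bas 0) = 1" by (simp add: ip_def bas_0)
  then show ?case unfolding lan_ok_def by (simp add: bas_0 continuous_on_const)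
qed (rule lan_ok_step)

lemma bas_cont: "cont (bas k)"
  using lan_ok[of k] by (simp add: lan_ok_def)

lemma bas_orth: "ip (bas i) (bas j) = (if i = j then 1 else 0)"
  using lan_ok[of "max i j"] by (simp add: lan_ok_def)

lemma bb_pos: "0 < bb k"
  using lan_ok[of "Suc k"] by (simp add: lan_ok_def)

lemma vol_bas_0: "vol (bas 0) x = 1/2 * bas 0 x + bb 0 * bas 1 x"
  by (rule vol_bas(1)[OF bb_pos])

lemma vol_bas_Suc: "vol (bas (Suc n)) x = bb (Suc n) * bas (Suc (Suc n)) x - bb n * bas n x"
  by (rule vol_bas(2)[OF bb_pos])

text \<open>The coefficient is the inner product of \<open>vol (bas n)\<close> and
  \<open>bas (Suc n)\<close>. Both have norm at most one, and the arithmetic-geometric mean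
  inequality bounds the product.\<close>

lemma bb_le_1: "bb n \<le> 1"
proof -
  have V: "cont (vol (bas n))" by (rule vol_cont[OF bas_cont])
  have b: "bb n = ip (vol (bas n)) (bas (Suc n))"
  proof (cases n)
    case 0
    have "ip (vol (bas 0)) (bas 1) = ip (\<lambda>x. 1/2 * bas 0 x + bb 0 * bas 1 x) (bas 1)"
      by (intro ip_cong vol_bas_0) simp_all
    also have "\<dots> = 1/2 * ip (bas 0) (bas 1) + bb 0 * ip (bas 1) (bas 1)"
      by (intro ip_lin_left bas_cont)
    finally show ?thesis using 0 by (simp add: bas_orth)
  next
    case (Suc m)
    have "ip (vol (bas n)) (bas (Suc n)) = ip (\<lambda>x. bb n * bas (Suc n) x + (- bb m) * bas m x) (bas (Suc n))"
      by (intro ip_cong) (simp_all add: Suc vol_bas_Suc)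
    also have "\<dots> = bb n * ip (bas (Suc n)) (bas (Suc n)) + (- bb m) * ip (bas m) (bas (Suc n))"
      by (intro ip_lin_left bas_cont)
    finally show ?thesis using Suc by (simp add: bas_orth)
  qed
  have "ip (vol (bas n)) (vol (bas n)) \<le> 1"
  proof (rule ip_le_sup[OF V])
    show "(vol (bas n) x)\<^sup>2 \<le> 1" if "x \<in> {0..1}" for x
      using vol_sq_le[OF bas_cont that, of n] by (simp add: bas_orth)
  qed
  moreover have "ip (vol (bas n)) (bas (Suc n)) \<le> 1/2 * ip (vol (bas n)) (vol (bas n)) + 1/2 * ip (bas (Suc n)) (bas (Suc n))"
  proof -
    have "ip (vol (bas n)) (bas (Suc n)) \<le>
        integral {0..1} (\<lambda>x. 1/2 * (vol (bas n) x * vol (bas n) x) + 1/2 * (bas (Suc n) x * bas (Suc n) x))"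
      unfolding ip_def
    proof (rule integral_le)
      show "(\<lambda>x. 1/2 * (vol (bas n) x * vol (bas n) x) + 1/2 * (bas (Suc n) x * bas (Suc n) x)) integrable_on {0..1}"
        by (intro integrable_continuous_real continuous_intros V bas_cont)
      show "vol (bas n) x * bas (Suc n) x \<le> 1/2 * (vol (bas n) x * vol (bas n) x) + 1/2 * (bas (Suc n) x * bas (Suc n) x)" for x
        using sum_squares_bound[of "vol (bas n) x" "bas (Suc n) x"] by (simp add: power2_eq_square)
    qed (intro ip_integrable V bas_cont)
    also have "\<dots> = 1/2 * ip (vol (bas n)) (vol (bas n)) + 1/2 * ip (bas (Suc n)) (bas (Suc n))"
      unfolding ip_def
      by (subst integral_add) (simp_all add: ip_integrable V bas_cont)
    finally show ?thesis .
  qed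
  ultimately show ?thesis using b by (simp add: bas_orth)
qed

text \<open>The matrix of the Volterra operator in the basis, acting on sequences over a real field.\<close>

definition jac :: "(nat \<Rightarrow> 'a::real_field) \<Rightarrow> nat \<Rightarrow> 'a" where
  "jac c n = (if n = 0 then c 0 / 2 else of_real (bb (n - 1)) * c (n - 1)) - of_real (bb n) * c (Suc n)"

section \<open>Transfer of the Volterra estimates to coefficient sequences\<close>

definition syn :: "nat \<Rightarrow> (nat \<Rightarrow> real) \<Rightarrow> real \<Rightarrow> real" where
  "syn N c x = (\<Sum>n<N. c n * bas n x)"

lemma syn_cont: "cont (syn N c)"
  unfolding syn_def[abs_def] by (intro continuous_intros bas_cont)

lemma syn_ip: "ip (syn N c) (syn N c) = (\<Sum>n<N. (c n)\<^sup>2)"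
proof -
  have "ip (syn N c) (syn N c) = integral {0..1} (\<lambda>x. \<Sum>i<N. \<Sum>j<N. (c i * c j) * (bas i x * bas j x))"
    by (simp add: ip_def syn_def sum_product mult_ac)
  also have "\<dots> = (\<Sum>i<N. \<Sum>j<N. (c i * c j) * ip (bas i) (bas j))"
  proof -
    have "integral {0..1} (\<lambda>x. \<Sum>i<N. \<Sum>j<N. (c i * c j) * (bas i x * bas j x)) =
        (\<Sum>i<N. integral {0..1} (\<lambda>x. \<Sum>j<N. (c i * c j) * (bas i x * bas j x)))"
      by (rule integral_sum) (auto intro!: integrable_continuous_real continuous_intros bas_cont)
    also have "\<dots> = (\<Sum>i<N. \<Sum>j<N. integral {0..1} (\<lambda>x. (c i * c j) * (bas i x * bas j x)))"
      by (intro sum.cong refl integral_sum) (auto intro!: integrable_continuous_real continuous_intros bas_cont)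
    finally show ?thesis by (simp add: ip_def)
  qed
  also have "\<dots> = (\<Sum>i<N. (c i)\<^sup>2)"
    by (simp add: bas_orth power2_eq_square if_distrib cong: if_cong)
  finally show ?thesis .
qed

text \<open>The two extra terms come from cutting the tridiagonal matrix at row \<open>N\<close>:
  one belongs to the next row, the other restores the entry that row \<open>N\<close> takes from
  column \<open>Suc N\<close>.\<close>

lemma vol_syn_aux:
  "(\<Sum>n<Suc N. c n * vol (bas n) x) =
     (\<Sum>n<Suc N. jac c n * bas n x) + bb N * c N * bas (Suc N) x + bb N * c (Suc N) * bas N x"
proof (induction N)
  case 0
  show ?case by (simp add: vol_bas_0 jac_def algebra_simps)
next
  case (Suc N)
  have "(\<Sum>n<Suc (Suc N). c n * vol (bas n) x) = (\<Sum>n<Suc N. c n * vol (bas n) x) + c (Suc N) * vol (bas (Suc N)) x"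
    by simp
  also have "\<dots> = (\<Sum>n<Suc N. jac c n * bas n x) + bb N * c N * bas (Suc N) x + bb N * c (Suc N) * bas N x
      + c (Suc N) * (bb (Suc N) * bas (Suc (Suc N)) x - bb N * bas N x)"
    unfolding Suc.IH vol_bas_Suc ..
  also have "\<dots> = (\<Sum>n<Suc (Suc N). jac c n * bas n x) + bb (Suc N) * c (Suc N) * bas (Suc (Suc N)) x
      + bb (Suc N) * c (Suc (Suc N)) * bas (Suc N) x"
    by (simp add: jac_def[of c "Suc N"] algebra_simps)
  finally show ?case .
qed

lemma vol_syn:
  assumes c: "\<And>n. n \<ge> N \<Longrightarrow> c n = 0" and x: "x \<in> {0..1}"
  shows "vol (syn N c) x = syn (Suc N) (jac c) x"
proof (cases N)
  case 0
  then have "c = (\<lambda>_. 0)" using c by (intro ext) simp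
  moreover have "syn 0 c = (\<lambda>x. 0)" by (simp add: syn_def fun_eq_iff)
  ultimately show ?thesis using 0 by (simp add: syn_def vol_def jac_def)
next
  case (Suc M)
  have "vol (syn N c) x = (\<Sum>n<N. c n * vol (bas n) x)"
    unfolding vol_def syn_def[abs_def]
    using x by (subst integral_sum) (auto intro!: cont_integrable continuous_intros bas_cont)
  also have "\<dots> = (\<Sum>n<N. jac c n * bas n x) + bb M * c M * bas N x"
    using vol_syn_aux[of c x M] c[of "Suc M"] Suc by simp
  also have "bb M * c M * bas N x = jac c N * bas N x"
    using c[of "Suc N"] Suc by (simp add: jac_def)
  finally show ?thesis by (simp add: syn_def[of "Suc N"])
qed

lemma jac_supp: "(\<And>n. n \<ge> N \<Longrightarrow> c n = 0) \<Longrightarrow> n \<ge> Suc N \<Longrightarrow> jac c n = 0"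
  by (auto simp: jac_def)

lemma jac_pow_supp: "(\<And>n. n \<ge> N \<Longrightarrow> c n = 0) \<Longrightarrow> n \<ge> N + m \<Longrightarrow> (jac ^^ m) c n = 0"
proof (induction m arbitrary: n)
  case (Suc m)
  have "jac ((jac ^^ m) c) n = 0"
    by (rule jac_supp[of "N + m"]) (use Suc in simp_all)
  then show ?case by simp
qed simp

lemma vol_pow_syn:
  assumes c: "\<And>n. n \<ge> N \<Longrightarrow> c n = 0" and x: "x \<in> {0..1}"
  shows "(vol ^^ m) (syn N c) x = syn (N + m) ((jac ^^ m) c) x"
  using x
proof (induction m arbitrary: x)
  case (Suc m)
  have "(vol ^^ Suc m) (syn N c) x = vol (syn (N + m) ((jac ^^ m) c)) x"
    using Suc by (simp, intro vol_cong) simp_all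
  also have "\<dots> = syn (Suc (N + m)) (jac ((jac ^^ m) c)) x"
    using Suc.prems jac_pow_supp[OF c] by (intro vol_syn) simp_all
  finally show ?case by simp
qed simp

lemma jac_pow_real_bound:
  fixes c :: "nat \<Rightarrow> real"
  assumes c: "\<And>n. n \<ge> N \<Longrightarrow> c n = 0"
  shows "(\<Sum>n<N + Suc m. ((jac ^^ Suc m) c n)\<^sup>2) \<le> (\<Sum>n<N. (c n)\<^sup>2) / (fact m)\<^sup>2"
proof -
  have "(\<Sum>n<N + Suc m. ((jac ^^ Suc m) c n)\<^sup>2) = ip (syn (N + Suc m) ((jac ^^ Suc m) c)) (syn (N + Suc m) ((jac ^^ Suc m) c))"
    by (rule syn_ip[symmetric])
  also have "\<dots> = ip ((vol ^^ Suc m) (syn N c)) ((vol ^^ Suc m) (syn N c))"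
    by (intro ip_cong vol_pow_syn[symmetric, OF c]) simp_all
  also have "\<dots> \<le> ip (syn N c) (syn N c) / (fact m)\<^sup>2"
    by (rule ip_vol_pow_le[OF syn_cont])
  finally show ?thesis by (simp add: syn_ip)
qed

lemma Re_jac_pow: "Re ((jac ^^ m) c n) = (jac ^^ m) (\<lambda>n. Re (c n)) n"
proof (induction m arbitrary: n)
  case (Suc m)
  then show ?case by (simp add: jac_def)
qed simp

lemma Im_jac_pow: "Im ((jac ^^ m) c n) = (jac ^^ m) (\<lambda>n. Im (c n)) n"
proof (induction m arbitrary: n)
  case (Suc m)
  then show ?case by (simp add: jac_def)
qed simp

text \<open>Finite propagation in a band matrix: each application of \<open>jac\<close> looks one
  index further.\<close>

lemma jac_pow_local:
  assumes "\<And>k. k \<le> n + m \<Longrightarrow> c k = d k"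
  shows "(jac ^^ m) c n = (jac ^^ m) d n"
  using assms
proof (induction m arbitrary: n)
  case (Suc m)
  have "(jac ^^ m) c k = (jac ^^ m) d k" if "k \<le> Suc n" for k
    by (rule Suc.IH) (use Suc.prems that in simp)
  then show ?case by (simp add: jac_def[of "(jac ^^ m) c" n] jac_def[of "(jac ^^ m) d" n])
qed simp

lemma jac_pow_bound:
  assumes c: "l2 c"
  shows "l2 ((jac ^^ Suc m) c) \<and> nrm2 ((jac ^^ Suc m) c) \<le> 1 / fact m * nrm2 c"
proof -
  let ?J = "(jac ^^ Suc m) c"
  have part: "(\<Sum>n<M. (cmod (?J n))\<^sup>2) \<le> (nrm2 c)\<^sup>2 / (fact m)\<^sup>2" for M
  proof -
    \<comment> \<open>Large enough for the truncation \<open>d\<close> to leave the first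
      \<open>M\<close> entries of the iterate unchanged, while the estimate for finitely supported
      sequences applies to it.\<close>
    define N where "N = M + Suc m"
    define d where "d k = (if k < N then c k else 0)" for k
    have eq: "?J n = (jac ^^ Suc m) d n" if "n < M" for n
      by (rule jac_pow_local) (use that in \<open>simp add: d_def N_def\<close>)
    have sq: "(cmod z)\<^sup>2 = (Re z)\<^sup>2 + (Im z)\<^sup>2" for z by (simp add: cmod_def)
    have "(\<Sum>n<M. (cmod (?J n))\<^sup>2) = (\<Sum>n<M. (cmod ((jac ^^ Suc m) d n))\<^sup>2)"
      by (intro sum.cong) (simp_all add: eq del: funpow.simps)
    also have "\<dots> \<le> (\<Sum>n<N + Suc m. (cmod ((jac ^^ Suc m) d n))\<^sup>2)"
      by (rule sum_mono2) (auto simp: N_def)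
    also have "\<dots> = (\<Sum>n<N + Suc m. ((jac ^^ Suc m) (\<lambda>n. Re (d n)) n)\<^sup>2) + (\<Sum>n<N + Suc m. ((jac ^^ Suc m) (\<lambda>n. Im (d n)) n)\<^sup>2)"
      by (simp only: sq Re_jac_pow Im_jac_pow sum.distrib)
    also have "\<dots> \<le> (\<Sum>n<N. (Re (d n))\<^sup>2) / (fact m)\<^sup>2 + (\<Sum>n<N. (Im (d n))\<^sup>2) / (fact m)\<^sup>2"
      by (intro add_mono jac_pow_real_bound) (simp_all add: d_def)
    also have "\<dots> = (\<Sum>n<N. (cmod (d n))\<^sup>2) / (fact m)\<^sup>2"
      by (simp only: sq sum.distrib add_divide_distrib)
    also have "(\<Sum>n<N. (cmod (d n))\<^sup>2) = (\<Sum>n<N. (cmod (c n))\<^sup>2)"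
      by (intro sum.cong) (simp_all add: d_def)
    also have "(\<Sum>n<N. (cmod (c n))\<^sup>2) / (fact m)\<^sup>2 \<le> (nrm2 c)\<^sup>2 / (fact m)\<^sup>2"
      unfolding nrm2_sq[OF c] using c by (intro divide_right_mono sum_le_suminf) (simp_all add: l2_def)
    finally show ?thesis .
  qed
  have l: "l2 ?J" unfolding l2_def by (rule summableI_nonneg_bounded[OF _ part]) simp
  have "(\<Sum>n. (cmod (?J n))\<^sup>2) \<le> (1 / fact m * nrm2 c)\<^sup>2"
    using suminf_le_const[OF l[unfolded l2_def] part] by (simp add: power_mult_distrib power_divide)
  then have "nrm2 ?J \<le> 1 / fact m * nrm2 c"
    unfolding nrm2_def[of ?J] using nrm2_ge_0[OF c] by (intro real_le_lsqrt) simp_all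
  with l show ?thesis ..
qed

text \<open>The entries off the diagonal are skew, so their real parts telescope. Left over are the
  corner entry \<open>1/2\<close> and one boundary term, which tends to zero for square-summable
  \<open>c\<close>.\<close>

lemma jac_accretive_aux:
  "(\<Sum>n<Suc N. Re (jac c n * cnj (c n))) = (cmod (c 0))\<^sup>2 / 2 - bb N * Re (c (Suc N) * cnj (c N))"
proof (induction N)
  case 0
  show ?case
    unfolding cmod_power2 by (simp add: jac_def power2_eq_square algebra_simps add_divide_distrib)
next
  case (Suc N)
  show ?case
    unfolding sum.lessThan_Suc[of _ "Suc N"] Suc.IH by (simp add: jac_def algebra_simps)
qed

lemma jac_accretive:
  assumes c: "l2 c"
  shows "0 \<le> Re (\<Sum>n. jac c n * cnj (c n))"
proof -
  have "l2 (jac c)" using jac_pow_bound[OF c, of 0] by simp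
  then have sm: "summable (\<lambda>n. jac c n * cnj (c n))" using c by (rule l2_inner_summable)
  have "(\<lambda>n. (cmod (c n))\<^sup>2) \<longlonglongrightarrow> 0" using c unfolding l2_def by (rule summable_LIMSEQ_zero)
  then have "(\<lambda>n. sqrt ((cmod (c n))\<^sup>2)) \<longlonglongrightarrow> sqrt 0" by (rule tendsto_real_sqrt)
  then have c0: "(\<lambda>n. cmod (c n)) \<longlonglongrightarrow> 0" by simp
  have "(\<lambda>N. bb N * Re (c (Suc N) * cnj (c N))) \<longlonglongrightarrow> 0"
  proof (rule Lim_null_comparison[OF always_eventually], intro allI)
    show "(\<lambda>N. cmod (c (Suc N)) * cmod (c N)) \<longlonglongrightarrow> 0"
      using tendsto_mult[OF LIMSEQ_Suc[OF c0] c0] by simp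
    fix N
    have "norm (bb N * Re (c (Suc N) * cnj (c N))) = bb N * \<bar>Re (c (Suc N) * cnj (c N))\<bar>"
      using bb_pos[of N] by (simp add: abs_mult)
    also have "\<dots> \<le> 1 * cmod (c (Suc N) * cnj (c N))"
      using bb_pos[of N] bb_le_1[of N] by (intro mult_mono abs_Re_le_cmod) simp_all
    finally show "norm (bb N * Re (c (Suc N) * cnj (c N))) \<le> cmod (c (Suc N)) * cmod (c N)"
      by (simp add: norm_mult)
  qed
  then have "(\<lambda>N. (cmod (c 0))\<^sup>2 / 2 - bb N * Re (c (Suc N) * cnj (c N))) \<longlonglongrightarrow> (cmod (c 0))\<^sup>2 / 2 - 0"
    by (intro tendsto_diff tendsto_const)
  then have "(\<lambda>N. \<Sum>n<Suc N. Re (jac c n * cnj (c n))) \<longlonglongrightarrow> (cmod (c 0))\<^sup>2 / 2"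
    unfolding jac_accretive_aux by simp
  moreover have "(\<lambda>N. \<Sum>n<Suc N. Re (jac c n * cnj (c n))) \<longlonglongrightarrow> Re (\<Sum>n. jac c n * cnj (c n))"
  proof -
    have "(\<lambda>N. Re (\<Sum>n<N. jac c n * cnj (c n))) \<longlonglongrightarrow> Re (\<Sum>n. jac c n * cnj (c n))"
      by (intro tendsto_Re summable_LIMSEQ sm)
    from LIMSEQ_Suc[OF this] show ?thesis by (simp only: Re_sum)
  qed
  ultimately have eq: "Re (\<Sum>n. jac c n * cnj (c n)) = (cmod (c 0))\<^sup>2 / 2" by (rule LIMSEQ_unique[rotated])
  show ?thesis unfolding eq by simp
qed

section \<open>An approximately unital radical operator algebra\<close>

context nalgebra
begin

lemma tendsto_nrm_mult_right:
  assumes "tendsto_nrm x l" "\<And>n. x n \<in> carr V" "l \<in> carr V" "y \<in> carr V"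
  shows "tendsto_nrm (\<lambda>n. x n \<otimes> y) (l \<otimes> y)"
proof (rule tendsto_nrm_sandwich)
  show "(\<lambda>n. nrm V (x n \<ominus> l) * nrm V y) \<longlonglongrightarrow> 0"
    using tendsto_mult_right[OF assms(1)[unfolded tendsto_nrm_def], of "nrm V y"] by simp
  show "nrm V (x n \<otimes> y \<ominus> l \<otimes> y) \<le> nrm V (x n \<ominus> l) * nrm V y" for n
    using nrm_mult[of "x n \<ominus> l" y] assms by (simp add: mult_sub_left)
qed (use assms in simp_all)

lemma tendsto_nrm_mult_left:
  assumes "tendsto_nrm x l" "\<And>n. x n \<in> carr V" "l \<in> carr V" "y \<in> carr V"
  shows "tendsto_nrm (\<lambda>n. y \<otimes> x n) (y \<otimes> l)"
proof (rule tendsto_nrm_sandwich)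
  show "(\<lambda>n. nrm V y * nrm V (x n \<ominus> l)) \<longlonglongrightarrow> 0"
    using tendsto_mult_left[OF assms(1)[unfolded tendsto_nrm_def], of "nrm V y"] by simp
  show "nrm V (y \<otimes> x n \<ominus> y \<otimes> l) \<le> nrm V y * nrm V (x n \<ominus> l)" for n
    using nrm_mult[of y "x n \<ominus> l"] assms by (simp add: mult_sub_right)
qed (use assms in simp_all)

lemma subalgebraI:
  assumes "\<And>x. x \<in> S \<Longrightarrow> x \<in> carr V" "\<zero> \<in> S" "\<And>x y. \<lbrakk>x \<in> S; y \<in> S\<rbrakk> \<Longrightarrow> x \<oplus> y \<in> S"
    "\<And>c x. x \<in> S \<Longrightarrow> c \<odot> x \<in> S" "\<And>x y. \<lbrakk>x \<in> S; y \<in> S\<rbrakk> \<Longrightarrow> x \<otimes> y \<in> S"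
  shows "subalgebra_of V S"
  using assms unfolding subalgebra_of_def subspace_of_def by blast

lemma
  assumes "subalgebra_of V S"
  shows subalgebra_zero: "\<zero> \<in> S"
    and subalgebra_add: "\<lbrakk>x \<in> S; y \<in> S\<rbrakk> \<Longrightarrow> x \<oplus> y \<in> S"
    and subalgebra_scale: "x \<in> S \<Longrightarrow> c \<odot> x \<in> S"
    and subalgebra_mult: "\<lbrakk>x \<in> S; y \<in> S\<rbrakk> \<Longrightarrow> x \<otimes> y \<in> S"
  using assms unfolding subalgebra_of_def subspace_of_def by blast+

lemma norm_closedI:
  assumes "\<And>x. x \<in> S \<Longrightarrow> x \<in> carr V"
    "\<And>x l. \<lbrakk>\<And>n. x n \<in> S; l \<in> carr V; tendsto_nrm x l\<rbrakk> \<Longrightarrow> l \<in> S"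
  shows "norm_closed V S"
  unfolding norm_closed_iff
proof (intro conjI allI impI)
  show "S \<subseteq> carr V" using assms(1) by (rule subsetI)
  show "l \<in> S" if "(\<forall>n. x n \<in> S) \<and> l \<in> carr V \<and> tendsto_nrm x l" for x l
    by (rule assms(2)[of x]) (use that in simp_all)
qed

lemma norm_closedD: "\<lbrakk>norm_closed V S; \<And>n. x n \<in> S; l \<in> carr V; tendsto_nrm x l\<rbrakk> \<Longrightarrow> l \<in> S"
  unfolding norm_closed_iff by blast

text \<open>Centralizers are closed subalgebras, so minimality of the generated algebra applies to
  them.\<close>

definition centralizer :: "'a set \<Rightarrow> 'a set" where
  "centralizer X = {x \<in> carr V. \<forall>y\<in>X. x \<otimes> y = y \<otimes> x}"

lemma centralizer_subalgebra:
  assumes X: "X \<subseteq> carr V"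
  shows "subalgebra_of V (centralizer X)"
proof (rule subalgebraI)
  have XV: "y \<in> carr V" if "y \<in> X" for y using X that by blast
  show "\<zero> \<in> centralizer X" using XV by (simp add: centralizer_def)
  fix x assume x: "x \<in> centralizer X"
  show "x \<in> carr V" using x by (simp add: centralizer_def)
  show "c \<odot> x \<in> centralizer X" for c using x XV by (simp add: centralizer_def)
  fix x' assume x': "x' \<in> centralizer X"
  show "x \<oplus> x' \<in> centralizer X" using x x' XV by (simp add: centralizer_def distrib_left distrib_right)
  have "(x \<otimes> x') \<otimes> y = y \<otimes> (x \<otimes> x')" if y: "y \<in> X" for y
  proof -
    have V: "x \<in> carr V" "x' \<in> carr V" "y \<in> carr V" and c: "x \<otimes> y = y \<otimes> x" "x' \<otimes> y = y \<otimes> x'"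
      using x x' y XV by (simp_all add: centralizer_def)
    have "(x \<otimes> x') \<otimes> y = x \<otimes> (y \<otimes> x')" using V c by (simp add: mult_assoc)
    also have "\<dots> = (x \<otimes> y) \<otimes> x'" using V by (simp add: mult_assoc)
    also have "\<dots> = y \<otimes> (x \<otimes> x')" using V c by (simp add: mult_assoc)
    finally show ?thesis .
  qed
  then show "x \<otimes> x' \<in> centralizer X" using x x' by (simp add: centralizer_def)
qed

lemma centralizer_closed:
  assumes X: "X \<subseteq> carr V"
  shows "norm_closed V (centralizer X)"
proof (rule norm_closedI)
  show "x \<in> carr V" if "x \<in> centralizer X" for x using that by (simp add: centralizer_def)
  fix x l assume x: "\<And>n. x n \<in> centralizer X" and l: "l \<in> carr V" and lim: "tendsto_nrm x l"
  have xV: "x n \<in> carr V" for n using x by (simp add: centralizer_def)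
  have "l \<otimes> y = y \<otimes> l" if y: "y \<in> X" for y
  proof -
    have yV: "y \<in> carr V" using X y by blast
    have "(\<lambda>n. x n \<otimes> y) = (\<lambda>n. y \<otimes> x n)" using x y by (simp add: centralizer_def)
    then show ?thesis
      using tendsto_nrm_unique[OF tendsto_nrm_mult_right[OF lim xV l yV], of "y \<otimes> l"]
        tendsto_nrm_mult_left[OF lim xV l yV] xV l yV by simp
  qed
  then show "l \<in> centralizer X" using l by (simp add: centralizer_def)
qed

end

section \<open>The Volterra operator and the closed algebra it generates\<close>

definition volop :: "(real \<Rightarrow> complex) \<Rightarrow> real \<Rightarrow> complex" where
  "volop = op_of jac"

lemma jac_lin:
  fixes c d :: "nat \<Rightarrow> complex"
  shows "jac (\<lambda>n. c n + d n) n = jac c n + jac d n" "jac (\<lambda>n. a * c n) n = a * jac c n"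
  by (simp_all add: jac_def algebra_simps add_divide_distrib)

lemma volop_closed [simp]: "volop \<in> carr BL"
  unfolding volop_def by (rule op_of_closed[OF jac_lin, where K = 1]) (use jac_pow_bound[of _ 0] in simp)

lemma volop_app: "f \<in> carr ell2 \<Longrightarrow> volop f = fun_of (jac (seq_of f))"
  by (simp add: volop_def op_of_app)

lemma pw_volop: "f \<in> carr ell2 \<Longrightarrow> BL.pw volop m f = fun_of ((jac ^^ Suc m) (seq_of f))"
proof (induction m arbitrary: f)
  case (Suc m)
  have "volop f \<in> carr ell2" using Suc.prems by simp
  moreover have "seq_of (volop f) = jac (seq_of f)" using Suc.prems by (simp add: volop_app)
  ultimately have "BL.pw volop (Suc m) f = fun_of ((jac ^^ Suc m) (jac (seq_of f)))"
    using Suc by simp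
  then show ?case by (simp add: funpow_swap1)
qed (simp add: volop_app)

lemma pw_volop_nrm: "nrm BL (BL.pw volop m) \<le> 1 / fact m"
proof (rule ell2.op_nrm_le)
  fix f assume f: "f \<in> carr ell2"
  have "l2 ((jac ^^ Suc m) (seq_of f)) \<and> nrm2 ((jac ^^ Suc m) (seq_of f)) \<le> 1 / fact m * nrm2 (seq_of f)"
    by (rule jac_pow_bound[OF ell2_D[OF f]])
  then show "hnorm ell2 (BL.pw volop m f) \<le> 1 / fact m * hnorm ell2 f"
    using f by (simp only: pw_volop hnorm_ell2 fun_of_ell2 seq_of_fun_of)
qed simp

text \<open>Expanding the square on the right gives the left side plus the square of the norm of
  \<open>f\<close> plus a cross term that is nonnegative by accretivity.\<close>

lemma volop_accretive:
  assumes f: "f \<in> carr ell2" and t: "t \<ge> 0"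
  shows "hnorm ell2 (vscale ell2 (of_real t) (volop f)) \<le> hnorm ell2 (vadd ell2 f (vscale ell2 (of_real t) (volop f)))"
proof (rule power2_le_imp_le)
  let ?g = "vscale ell2 (of_real t) (volop f)"
  have V: "volop f \<in> carr ell2" and g: "?g \<in> carr ell2" using f by simp_all
  have "Re (cinner ell2 (volop f) f) = Re (\<Sum>n. jac (seq_of f) n * cnj (seq_of f n))"
    using f by (simp add: ell2_sel(5) volop_app seq_of_def)
  then have "0 \<le> Re (cinner ell2 (volop f) f)" using jac_accretive[OF ell2_D[OF f]] by simp
  moreover have "Re (cinner ell2 f ?g) = t * Re (cinner ell2 (volop f) f)"
    using ell2.inner_scale_right[OF V f, of "of_real t"] ell2.inner_commute[OF V f] by simp
  ultimately have "0 \<le> Re (cinner ell2 f ?g)" using t by simp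
  then show "(hnorm ell2 ?g)\<^sup>2 \<le> (hnorm ell2 (vadd ell2 f ?g))\<^sup>2"
    unfolding ell2.hnorm_add_sq[OF f g] by simp
  show "0 \<le> hnorm ell2 (vadd ell2 f ?g)" using f g by (intro ell2.hnorm_ge_0) simp
qed

text \<open>As an intersection, \<open>S3\<close> comes with an induction principle: a property that
  defines a closed subalgebra and holds for \<open>volop\<close> holds throughout.\<close>

definition S3 :: "((real \<Rightarrow> complex) \<Rightarrow> real \<Rightarrow> complex) set" where
  "S3 = \<Inter> {S. subalgebra_of BL S \<and> norm_closed BL S \<and> volop \<in> S}"

definition A3 :: "((real \<Rightarrow> complex) \<Rightarrow> real \<Rightarrow> complex) cnalg" where
  "A3 = BL\<lparr>carr := S3\<rparr>"

lemma S3_least: "\<lbrakk>subalgebra_of BL S; norm_closed BL S; volop \<in> S; T \<in> S3\<rbrakk> \<Longrightarrow> T \<in> S"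
  unfolding S3_def by blast

lemma S3_I: "(\<And>S. \<lbrakk>subalgebra_of BL S; norm_closed BL S; volop \<in> S\<rbrakk> \<Longrightarrow> T \<in> S) \<Longrightarrow> T \<in> S3"
  unfolding S3_def by blast

lemma volop_S3 [simp]: "volop \<in> S3"
  by (rule S3_I)

lemma S3_sub: "T \<in> S3 \<Longrightarrow> T \<in> carr BL"
proof (rule S3_least[of "carr BL"])
  show "subalgebra_of BL (carr BL)" by (rule BL.subalgebraI) simp_all
  show "norm_closed BL (carr BL)" by (rule BL.norm_closedI) simp_all
qed simp_all

lemma S3_subalgebra: "subalgebra_of BL S3"
proof (rule BL.subalgebraI)
  show "vzero BL \<in> S3" by (rule S3_I) (rule BL.subalgebra_zero)
  fix T assume T: "T \<in> S3"
  show "T \<in> carr BL" by (rule S3_sub[OF T])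
  show "vscale BL c T \<in> S3" for c
    by (rule S3_I, rule BL.subalgebra_scale) (simp_all add: S3_least[OF _ _ _ T])
  fix U assume U: "U \<in> S3"
  show "vadd BL T U \<in> S3"
    by (rule S3_I, rule BL.subalgebra_add) (simp_all add: S3_least[OF _ _ _ T] S3_least[OF _ _ _ U])
  show "amult BL T U \<in> S3"
    by (rule S3_I, rule BL.subalgebra_mult) (simp_all add: S3_least[OF _ _ _ T] S3_least[OF _ _ _ U])
qed

lemma S3_closed: "norm_closed BL S3"
proof (rule BL.norm_closedI[OF S3_sub])
  fix T U assume T: "\<And>n. T n \<in> S3" and U: "U \<in> carr BL" and lim: "BL.tendsto_nrm T U"
  show "U \<in> S3"
  proof (rule S3_I)
    fix S assume S: "subalgebra_of BL S" "norm_closed BL S" "volop \<in> S"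
    show "U \<in> S" by (rule BL.norm_closedD[OF S(2) _ U lim]) (rule S3_least[OF S T])
  qed
qed

interpretation A3: banach_algebra A3
  unfolding A3_def by (rule BL.closed_subalgebra[OF S3_subalgebra S3_closed])

lemma A3_sel [simp]: "carr A3 = S3" "vadd A3 = vadd BL" "vscale A3 = vscale BL" "vzero A3 = vzero BL"
  "amult A3 = amult BL" "nrm A3 = nrm BL"
  by (simp_all add: A3_def)

lemma vsub_A3 [simp]: "vsub A3 = vsub BL"
  by (intro ext) (simp add: vsub_def)

lemma A3_tendsto: "A3.tendsto_nrm x l \<longleftrightarrow> BL.tendsto_nrm x l"
  by (simp add: A3.tendsto_nrm_def BL.tendsto_nrm_def)

lemma A3_pw: "A3.pw x n = BL.pw x n"
  by (induction n) simp_all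

lemma A3_operator_algebra: "operator_algebra A3"
  unfolding operator_algebra_def
  by (intro exI[of _ ell2] exI[of _ S3] conjI S3_subalgebra S3_closed A3_def)
     (simp add: hilbert_iff ell2.hilbert_axioms)

text \<open>Double centralizer argument: all of \<open>S3\<close> commutes with
  \<open>volop\<close>, so \<open>volop\<close> lies in the centralizer of \<open>S3\<close>, and
  hence so does \<open>S3\<close>.\<close>

lemma S3_commute:
  assumes "T \<in> S3" "U \<in> S3"
  shows "amult BL T U = amult BL U T"
proof -
  have sub: "S3 \<subseteq> carr BL" using S3_sub by blast
  have vs: "{volop} \<subseteq> carr BL" by simp
  have V: "volop \<in> BL.centralizer {volop}" by (simp add: BL.centralizer_def)
  have C: "R \<in> BL.centralizer {volop}" if "R \<in> S3" for R
    by (rule S3_least[OF BL.centralizer_subalgebra[OF vs] BL.centralizer_closed[OF vs] V that])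
  have "amult BL volop R = amult BL R volop" if "R \<in> S3" for R
    using C[OF that] by (simp add: BL.centralizer_def)
  then have "volop \<in> BL.centralizer S3" by (simp add: BL.centralizer_def)
  then have "T \<in> BL.centralizer S3"
    using S3_least[OF BL.centralizer_subalgebra[OF sub] BL.centralizer_closed[OF sub] _ assms(1)] by simp
  then show ?thesis using assms(2) by (simp add: BL.centralizer_def)
qed

lemma A3_commutative: "commutative A3"
  unfolding commutative_def using S3_commute by simp

lemma volop_radical: "volop \<in> jacobson_radical A3"
proof (rule A3.quasinilpotent_in_radical[OF A3_commutative])
  show "volop \<in> carr A3" by simp
  fix K :: real assume K: "K \<ge> 0"
  have "summable (\<lambda>n. K ^ n / fact n)"
    using summable_exp[of K] by (simp add: divide_inverse mult.commute)
  then have "(\<lambda>n. K ^ n / fact n) \<longlonglongrightarrow> 0" by (rule summable_LIMSEQ_zero)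
  then have "(\<lambda>n. K * (K ^ n / fact n)) \<longlonglongrightarrow> 0" using tendsto_mult_left[of _ 0 _ K] by force
  then have "\<forall>\<^sub>F n in sequentially. K * (K ^ n / fact n) < 1" by (rule order_tendstoD) simp
  then obtain n where n: "K * (K ^ n / fact n) < 1" by (meson eventually_sequentially order.refl)
  have "K ^ Suc n * nrm BL (BL.pw volop n) \<le> K ^ Suc n * (1 / fact n)"
    using K by (intro mult_left_mono pw_volop_nrm) simp
  also have "\<dots> = K * (K ^ n / fact n)" by simp
  finally have "K ^ Suc n * nrm BL (BL.pw volop n) < 1" using n by (rule le_less_trans)
  then show "\<exists>n. K ^ Suc n * nrm A3 (A3.pw volop n) < 1"
    unfolding A3_sel A3_pw by blast
qed

text \<open>The radical is an intersection of closed left ideals, hence a closed subalgebra; as it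
  contains the generator, it is everything.\<close>

lemma A3_radical: "radical_algebra A3"
proof -
  have radD: "T \<in> S3" "\<And>L. maximal_modular_left_ideal A3 L \<Longrightarrow> T \<in> L" if "T \<in> jacobson_radical A3" for T
    using that by (simp_all add: jacobson_radical_def)
  have radI: "T \<in> jacobson_radical A3" if "T \<in> S3" "\<And>L. maximal_modular_left_ideal A3 L \<Longrightarrow> T \<in> L" for T
    using that by (simp add: jacobson_radical_def)
  note ideal = A3.maximal_ideal
  have sub: "subalgebra_of BL (jacobson_radical A3)"
  proof (rule BL.subalgebraI)
    show "vzero BL \<in> jacobson_radical A3"
      by (rule radI) (use BL.subalgebra_zero[OF S3_subalgebra] A3.ideal_zero[OF ideal] in simp_all)
    fix T assume T: "T \<in> jacobson_radical A3"
    show "T \<in> carr BL" using radD(1)[OF T] S3_sub by simp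
    show "vscale BL c T \<in> jacobson_radical A3" for c
      by (rule radI) (use BL.subalgebra_scale[OF S3_subalgebra radD(1)[OF T]] A3.ideal_scale[OF ideal radD(2)[OF T]] in simp_all)
    fix U assume U: "U \<in> jacobson_radical A3"
    show "vadd BL T U \<in> jacobson_radical A3"
      by (rule radI) (use BL.subalgebra_add[OF S3_subalgebra radD(1)[OF T] radD(1)[OF U]]
          A3.ideal_add[OF ideal radD(2)[OF T] radD(2)[OF U]] in simp_all)
    show "amult BL T U \<in> jacobson_radical A3"
      by (rule radI) (use BL.subalgebra_mult[OF S3_subalgebra radD(1)[OF T] radD(1)[OF U]]
          A3.ideal_mult[OF ideal _ radD(2)[OF U], of _ T] radD(1)[OF T] in simp_all)
  qed
  have cl: "norm_closed BL (jacobson_radical A3)"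
  proof (rule BL.norm_closedI)
    show "T \<in> carr BL" if "T \<in> jacobson_radical A3" for T using radD(1)[OF that] S3_sub by simp
    fix T U assume T: "\<And>n. T n \<in> jacobson_radical A3" and U: "U \<in> carr BL" and lim: "BL.tendsto_nrm T U"
    have US: "U \<in> S3" by (rule BL.norm_closedD[OF S3_closed radD(1)[OF T] U lim])
    show "U \<in> jacobson_radical A3"
    proof (rule radI[OF US])
      fix L assume L: "maximal_modular_left_ideal A3 L"
      show "U \<in> L" by (rule A3.maximal_closed[OF L radD(2)[OF T L]]) (use lim US in \<open>simp_all add: A3_tendsto\<close>)
    qed
  qed
  have "T \<in> jacobson_radical A3" if "T \<in> S3" for T
    by (rule S3_least[OF sub cl volop_radical that])
  then show ?thesis
    unfolding radical_algebra_def using radD(1) by auto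
qed

text \<open>The approximate identity \<open>e = t V / (1 + t V)\<close>. It is contractive because \<open>V\<close> is accretive:
  for \<open>g = f - e f\<close> one has \<open>f = g + t V g\<close> and \<open>e f = t V g\<close>.\<close>

lemma ex_approx_unit:
  assumes t: "t > 0"
  shows "\<exists>e\<in>S3. nrm BL e \<le> 1 \<and> nrm BL (vsub BL (amult BL e volop) volop) \<le> 1 / t"
proof -
  \<comment> \<open>A quasi-inverse \<open>a\<close> of \<open>- t V\<close> satisfies
    \<open>a + t a V = - t V\<close>, so its negative \<open>e\<close> satisfies
    \<open>e + t e V = t V\<close>, the equation of the desired element.\<close>
  have "vscale A3 (- of_real t) volop \<in> jacobson_radical A3"
    using A3_radical A3.scale_closed[of volop "- of_real t"] unfolding radical_algebra_def by simp
  then obtain a where a: "a \<in> S3" "vsub BL a (amult BL a (vscale BL (- of_real t) volop)) = vscale BL (- of_real t) volop"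
    using A3.jacobson_quasi_inverse by force
  define e where "e = vscale BL (-1) a"
  have aB: "a \<in> carr BL" using S3_sub[OF a(1)] .
  have eS: "e \<in> S3" unfolding e_def by (rule BL.subalgebra_scale[OF S3_subalgebra a(1)])
  have eB: "e \<in> carr BL" using S3_sub[OF eS] .
  have e_eq: "e f x + of_real t * volop (e f) x = of_real t * volop f x" "e (volop f) = volop (e f)"
    if f: "f \<in> carr ell2" for f x
  proof -
    show comm: "e (volop f) = volop (e f)"
      using fun_cong[OF S3_commute[OF eS volop_S3], of f] f by simp
    have Vf: "volop f \<in> carr ell2" using f by simp
    have "vsub BL a (amult BL a (vscale BL (- of_real t) volop)) f x = vscale BL (- of_real t) volop f x"
      using a(2) by simp
    then have h: "a f x + of_real t * a (volop f) x = - of_real t * volop f x"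
      using f ell2.op_scale[OF aB Vf, of "- of_real t"] ell2.scale_closed[OF Vf, of "- of_real t"]
      by (simp add: vsub_ell2 ell2_sel(4))
    have "e f x = - a f x" "e (volop f) x = - a (volop f) x"
      using f Vf by (simp_all add: e_def ell2_sel(4))
    then have "e f x + of_real t * e (volop f) x = - (a f x + of_real t * a (volop f) x)" by simp
    then show "e f x + of_real t * volop (e f) x = of_real t * volop f x"
      unfolding comm[symmetric] h by simp
  qed
  have "nrm BL e \<le> 1"
  proof (rule ell2.op_nrm_le)
    fix f assume f: "f \<in> carr ell2"
    have ef: "e f \<in> carr ell2" using eB f by simp
    define g where "g = vsub ell2 f (e f)"
    have g: "g \<in> carr ell2" unfolding g_def using f ef by (rule ell2.sub_closed)
    have Vg: "volop g x = volop f x - volop (e f) x" for x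
    proof -
      have "volop g = vsub ell2 (volop f) (volop (e f))"
        unfolding g_def vsub_def
        using f ef ell2.op_add[OF volop_closed f ell2.scale_closed[OF ef, of "-1"]] ell2.op_scale[OF volop_closed ef, of "-1"]
        by simp
      then show ?thesis by (simp add: vsub_ell2)
    qed
    have 1: "vscale ell2 (of_real t) (volop g) = e f"
      using e_eq(1)[OF f] by (simp add: fun_eq_iff ell2_sel(4) Vg algebra_simps)
    have 2: "vadd ell2 g (vscale ell2 (of_real t) (volop g)) = f"
      unfolding 1 unfolding g_def by (simp add: vsub_ell2 ell2_sel(2))
    show "hnorm ell2 (e f) \<le> 1 * hnorm ell2 f"
      using volop_accretive[OF g, of t] t unfolding 2 unfolding 1 by simp
  qed simp
  moreover have "nrm BL (vsub BL (amult BL e volop) volop) \<le> 1 / t"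
  proof -
    \<comment> \<open>Dividing \<open>e + t e V = t V\<close> by \<open>t\<close> shows that
      \<open>e V\<close> differs from \<open>V\<close> by \<open>- e / t\<close>, which is small
      because \<open>e\<close> is contractive.\<close>
    have "vsub BL (amult BL e volop) volop = vscale BL (of_real (- 1 / t)) e"
    proof (rule ell2.op_eqI)
      show "vsub BL (amult BL e volop) volop \<in> carr BL" "vscale BL (of_real (- 1 / t)) e \<in> carr BL"
        using eB by simp_all
      fix f assume f: "f \<in> carr ell2"
      show "vsub BL (amult BL e volop) volop f = vscale BL (of_real (- 1 / t)) e f"
      proof
        fix x
        have "of_real t * (volop (e f) x - volop f x) = - e f x"
          using e_eq(1)[OF f, of x] by (simp add: algebra_simps eq_neg_iff_add_eq_0)
        then have "volop (e f) x - volop f x = of_real (- 1 / t) * e f x"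
          using t by (simp add: field_simps)
        then show "vsub BL (amult BL e volop) volop f x = vscale BL (of_real (- 1 / t)) e f x"
          using f e_eq(2)[OF f] by (simp add: vsub_ell2 ell2_sel(4))
      qed
    qed
    then have "nrm BL (vsub BL (amult BL e volop) volop) = 1 / t * nrm BL e"
      using BL.nrm_scale[OF eB, of "of_real (- 1 / t)"] t by (simp add: norm_divide)
    then show ?thesis using \<open>nrm BL e \<le> 1\<close> t by (simp add: divide_right_mono)
  qed
  ultimately show ?thesis using eS by blast
qed

text \<open>The operators \<open>T\<close> with \<open>e n T\<close> tending to \<open>T\<close>
  form a subalgebra that contains the generator. It is closed because the \<open>e n\<close> are
  contractive, by an argument with three thirds of \<open>r\<close>.\<close>

lemma ex_approx_identity:
  "\<exists>e. (\<forall>n. e n \<in> S3 \<and> nrm BL (e n) \<le> 1) \<and> (\<forall>T\<in>S3. BL.tendsto_nrm (\<lambda>n. amult BL (e n) T) T)"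
proof -
  have "\<exists>e\<in>S3. nrm BL e \<le> 1 \<and> nrm BL (vsub BL (amult BL e volop) volop) \<le> 1 / real (Suc n)" for n
    by (rule ex_approx_unit) simp
  then obtain e where e: "\<And>n. e n \<in> S3" "\<And>n. nrm BL (e n) \<le> 1"
    "\<And>n. nrm BL (vsub BL (amult BL (e n) volop) volop) \<le> 1 / real (Suc n)" by metis
  have eB: "e n \<in> carr BL" for n using S3_sub[OF e(1)] .
  let ?S = "{T \<in> carr BL. BL.tendsto_nrm (\<lambda>n. amult BL (e n) T) T}"
  have sub: "subalgebra_of BL ?S"
  proof (rule BL.subalgebraI)
    show "vzero BL \<in> ?S" using BL.tendsto_nrm_const[of "vzero BL"] eB by simp
    fix T assume T: "T \<in> ?S"
    then have TB: "T \<in> carr BL" and lim: "BL.tendsto_nrm (\<lambda>n. amult BL (e n) T) T" by simp_all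
    show "T \<in> carr BL" by (rule TB)
    show "vscale BL c T \<in> ?S" for c
      using BL.tendsto_nrm_scale[OF lim _ TB, of c] eB TB by simp
    fix U assume U: "U \<in> ?S"
    then have UB: "U \<in> carr BL" and limU: "BL.tendsto_nrm (\<lambda>n. amult BL (e n) U) U" by simp_all
    show "vadd BL T U \<in> ?S"
      using BL.tendsto_nrm_add[OF lim limU _ _ TB UB] eB TB UB by (simp add: BL.distrib_left)
    show "amult BL T U \<in> ?S"
      using BL.tendsto_nrm_mult_right[OF lim _ TB UB] eB TB UB by (simp add: BL.mult_assoc)
  qed
  have cl: "norm_closed BL ?S"
  proof (rule BL.norm_closedI)
    show "T \<in> carr BL" if "T \<in> ?S" for T using that by simp
    fix T U assume T: "\<And>n. T n \<in> ?S" and U: "U \<in> carr BL" and lim: "BL.tendsto_nrm T U"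
    have TB: "T k \<in> carr BL" and Tl: "BL.tendsto_nrm (\<lambda>n. amult BL (e n) (T k)) (T k)" for k using T by simp_all
    have "BL.tendsto_nrm (\<lambda>n. amult BL (e n) U) U"
      unfolding BL.tendsto_nrm_def lim_sequentially
    proof (intro allI impI)
      fix r :: real assume r: "r > 0"
      obtain k where k: "nrm BL (vsub BL (T k) U) < r / 3"
        using order_tendstoD(2)[OF lim[unfolded BL.tendsto_nrm_def], of "r / 3"] r
        by (auto simp: eventually_sequentially)
      obtain M where M: "\<And>n. n \<ge> M \<Longrightarrow> nrm BL (vsub BL (amult BL (e n) (T k)) (T k)) < r / 3"
        using order_tendstoD(2)[OF Tl[unfolded BL.tendsto_nrm_def], of "r / 3" k] r
        by (auto simp: eventually_sequentially)
      have "nrm BL (vsub BL (amult BL (e n) U) U) < r" if n: "n \<ge> M" for n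
      proof -
        have "nrm BL (vsub BL (amult BL (e n) U) U) \<le> nrm BL (vsub BL (amult BL (e n) U) (amult BL (e n) (T k)))
            + nrm BL (vsub BL (amult BL (e n) (T k)) U)"
          using eB TB U by (intro BL.nrm_sub_triangle) simp_all
        moreover have "nrm BL (vsub BL (amult BL (e n) (T k)) U) \<le> nrm BL (vsub BL (amult BL (e n) (T k)) (T k))
            + nrm BL (vsub BL (T k) U)"
          using eB TB U by (intro BL.nrm_sub_triangle) simp_all
        moreover have "nrm BL (vsub BL (amult BL (e n) U) (amult BL (e n) (T k))) \<le> nrm BL (vsub BL (T k) U)"
        proof -
          have "nrm BL (vsub BL (amult BL (e n) U) (amult BL (e n) (T k))) = nrm BL (amult BL (e n) (vsub BL U (T k)))"
            using eB TB U by (simp add: BL.mult_sub_right)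
          also have "\<dots> \<le> nrm BL (e n) * nrm BL (vsub BL U (T k))"
            using eB TB U by (intro BL.nrm_mult) simp_all
          also have "\<dots> \<le> 1 * nrm BL (vsub BL U (T k))"
            using e(2)[of n] U TB[of k] by (intro mult_right_mono BL.nrm_ge_0 BL.sub_closed)
          finally show ?thesis using BL.nrm_sub_commute[OF U TB[of k]] by simp
        qed
        ultimately show ?thesis using k M[OF n] by simp
      qed
      then show "\<exists>M. \<forall>n\<ge>M. dist (nrm BL (vsub BL (amult BL (e n) U) U)) 0 < r"
        using eB U by (intro exI[of _ M]) (simp add: dist_real_def)
    qed
    then show "U \<in> ?S" using U by simp
  qed
  have V: "volop \<in> ?S"
  proof -
    have "BL.tendsto_nrm (\<lambda>n. amult BL (e n) volop) volop"
      by (rule BL.tendsto_nrm_sandwich[OF e(3) LIMSEQ_Suc[OF lim_inverse_n']]) (simp_all add: eB)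
    then show ?thesis by simp
  qed
  have "BL.tendsto_nrm (\<lambda>n. amult BL (e n) T) T" if "T \<in> S3" for T
    using S3_least[OF sub cl V that] by simp
  then show ?thesis using e(1,2) by blast
qed

lemma A3_approx_unital_not_radical: "approximately_unital A3 \<and> \<not> radical_algebra (bidual A3)"
proof -
  obtain e where e: "\<And>n. e n \<in> S3" "\<And>n. nrm BL (e n) \<le> 1"
    and lim: "\<And>T. T \<in> S3 \<Longrightarrow> BL.tendsto_nrm (\<lambda>n. amult BL (e n) T) T"
    using ex_approx_identity by blast
  have lim': "BL.tendsto_nrm (\<lambda>n. amult BL T (e n)) T" if "T \<in> S3" for T
    using lim[OF that] S3_commute[OF that e(1)] by simp
  have "approximately_unital A3"
    unfolding approximately_unital_def
  proof (intro exI[of _ "filtermap e sequentially"] conjI ballI)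
    show "filtermap e sequentially \<noteq> bot" by (simp add: filtermap_bot_iff)
    show "\<forall>\<^sub>F e in filtermap e sequentially. e \<in> carr A3 \<and> nrm A3 e \<le> 1"
      using e by (simp add: eventually_filtermap)
    fix T assume "T \<in> carr A3"
    then show "((\<lambda>e. nrm A3 (vsub A3 (amult A3 e T) T)) \<longlongrightarrow> 0) (filtermap e sequentially)"
      "((\<lambda>e. nrm A3 (vsub A3 (amult A3 T e) T)) \<longlongrightarrow> 0) (filtermap e sequentially)"
      using lim[of T] lim'[of T] by (simp_all add: filterlim_filtermap BL.tendsto_nrm_def)
  qed
  moreover have "\<not> radical_algebra (bidual A3)"
  proof (rule A3.bidual_not_radical[where e = e and x = volop])
    show "A3.separated" using operator_algebra_banach(2)[OF A3_operator_algebra] .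
    show "volop \<noteq> vzero A3"
    proof
      assume "volop = vzero A3"
      then have "volop (unit_vec 0) (real 0) = vzero BL (unit_vec 0) (real 0)" by simp
      moreover have "volop (unit_vec 0) (real 0) = 1/2"
        unfolding volop_app[OF unit_vec(1)] fun_of_nat by (simp add: jac_def)
      moreover have "vzero BL (unit_vec 0) (real 0) = 0" using ell2.op_app(2)[OF unit_vec(1)] by (simp add: ell2_sel(3))
      ultimately show False by simp
    qed
  qed (use e lim' in \<open>simp_all add: A3_tendsto\<close>)
  ultimately show ?thesis ..
qed

theorem proposition3p2:
  shows "(\<forall>A :: ('h \<Rightarrow> 'h) cnalg. operator_algebra A \<longrightarrow>
            (semiprime (bidual A) \<longrightarrow> semiprime A) \<and>
            (radical_algebra (bidual A) \<longrightarrow> radical_algebra A) \<and>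
            (semisimple (bidual A) \<and> commutative (bidual A) \<longrightarrow> semisimple A)) \<and>
         (\<exists>A :: ((real \<Rightarrow> complex) \<Rightarrow> (real \<Rightarrow> complex)) cnalg.
            operator_algebra A \<and> semiprime A \<and> \<not> semiprime (bidual A)) \<and>
         (\<exists>A :: ((real \<Rightarrow> complex) \<Rightarrow> (real \<Rightarrow> complex)) cnalg.
            operator_algebra A \<and> approximately_unital A \<and> radical_algebra A \<and> \<not> radical_algebra (bidual A)) \<and>
         (\<exists>A :: ((real \<Rightarrow> complex) \<Rightarrow> (real \<Rightarrow> complex)) cnalg.
            operator_algebra A \<and> unital A \<and> semisimple A \<and>
            \<not> semiprime (bidual A) \<and> \<not> semisimple (bidual A))"
proof (intro conjI allI impI)
  fix A :: "('h \<Rightarrow> 'h) cnalg" assume "operator_algebra A"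
  then interpret A: banach_algebra A by (rule operator_algebra_banach(1))
  have sep: "A.separated" using operator_algebra_banach(2)[OF \<open>operator_algebra A\<close>] .
  show "semiprime A" if "semiprime (bidual A)" using sep that by (rule A.semiprime_of_bidual)
  show "radical_algebra A" if "radical_algebra (bidual A)" using that by (rule A.radical_of_bidual)
  show "semisimple A" if "semisimple (bidual A) \<and> commutative (bidual A)"
    using that by (intro A.semisimple_of_bidual[OF sep]) simp_all
next
  \<comment> \<open>\<open>A2\<close> serves two of the existence claims, since semisimplicity
    implies semiprimeness. The same implication in the bidual shows that the bidual is not
    semisimple.\<close>
  interpret B: banach_algebra "bidual A2" by (rule A2.bidual_algebra)
  have "\<not> semisimple (bidual A2)"
    using B.semisimple_imp_semiprime A2_bidual_not_semiprime by blast
  then show "\<exists>A :: ((real \<Rightarrow> complex) \<Rightarrow> (real \<Rightarrow> complex)) cnalg.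
      operator_algebra A \<and> unital A \<and> semisimple A \<and> \<not> semiprime (bidual A) \<and> \<not> semisimple (bidual A)"
    using A2_operator_algebra A2_unital A2_semisimple A2_bidual_not_semiprime by blast
  show "\<exists>A :: ((real \<Rightarrow> complex) \<Rightarrow> (real \<Rightarrow> complex)) cnalg.
      operator_algebra A \<and> semiprime A \<and> \<not> semiprime (bidual A)"
    using A2_operator_algebra A2.semisimple_imp_semiprime[OF A2_semisimple] A2_bidual_not_semiprime by blast
  show "\<exists>A :: ((real \<Rightarrow> complex) \<Rightarrow> (real \<Rightarrow> complex)) cnalg.
      operator_algebra A \<and> approximately_unital A \<and> radical_algebra A \<and> \<not> radical_algebra (bidual A)"
    using A3_operator_algebra A3_radical A3_approx_unital_not_radical by blast
qed

end
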